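(* Let $p$ be a prime with $p\equiv 1\pmod 4$ and $p\neq 5$. As $n\to\infty$, $$\mathfrak{p}(n,\chi_p)=\mathfrak{a}_p\, n^{-3/4}\exp\!\left(\tfrac12\kappa\sqrt{\left(1-\tfrac1p\right)n}\right)\left[1+(-1)^n\mathfrak{b}_p+O(n^{-1/5})\right],$$ where $\kappa=\pi\sqrt{2/3}$, $$\mathfrak{a}_p=\left(\frac{p-1}{384p^2}\right)^{1/4}\exp\!\left(\tfrac14\sqrt p\,L(1,\chi_p)\right),$$ and $\mathfrak{b}_p=1$ if $p\equiv 1\pmod 8$, while $\mathfrak{b}_p=\exp(-\sqrt p\,L(1,\chi_p))$ if $p\equiv 5\pmod 8$.
   Context: For $f:\mathbb{N}\to\{0,\pm1\}$ and a partition $\pi=(a_1,\dots,a_k)$ of $n$, put $f(\pi)=f(a_1)\cdots f(a_k)$, and define $\mathfrak{p}(n,f)=\sum_{\pi}f(\pi)$ over all partitions $\pi$ of $n$. For an odd prime $p$, $\chi_p(n)$ is the Legendre symbol $(\frac np)$, and $L(s,\chi_p)$ is its Dirichlet $L$-function. *)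

theory Defs
  imports
    "HOL-Analysis.Analysis"
    "HOL-Number_Theory.Number_Theory"
    "HOL-Library.Landau_Symbols"
begin

definition partitions :: "nat \<Rightarrow> nat multiset set" where
  "partitions n = {\<pi>. 0 \<notin># \<pi> \<and> \<Sum>\<^sub># \<pi> = n}"

lemma size_le_sum_mset:
  fixes M :: "nat multiset"
  assumes "0 \<notin># M"
  shows "size M \<le> \<Sum>\<^sub># M"
  using assms by (induction M) auto

lemma finite_partitions: "finite (partitions n)"
proof (rule finite_subset)
  show "partitions n \<subseteq> mset ` {xs. set xs \<subseteq> {..n} \<and> length xs \<le> n}"
  proof
    fix M assume M: "M \<in> partitions n"
    obtain xs where xs: "mset xs = M" using ex_mset by blast
    have "set xs \<subseteq> {..n}"
      using M xs by (auto simp: partitions_def sum_mset_sum_list member_le_sum_list)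
    moreover have "length xs \<le> n"
      using M xs size_le_sum_mset[of M] by (auto simp: partitions_def)
    ultimately show "M \<in> mset ` {xs. set xs \<subseteq> {..n} \<and> length xs \<le> n}"
      using xs by blast
  qed
  show "finite (mset ` {xs. set xs \<subseteq> {..n} \<and> length xs \<le> n})"
    by (intro finite_imageI finite_lists_length_le) simp
qed

definition signed_partition_number :: "nat \<Rightarrow> (nat \<Rightarrow> int) \<Rightarrow> int" where
  "signed_partition_number n f = (\<Sum>\<pi>\<in>partitions n. \<Prod>a\<in>#\<pi>. f a)"

definition legendre_char :: "nat \<Rightarrow> nat \<Rightarrow> int" where
  "legendre_char p n = Legendre (int n) (int p)"

text \<open>The sum is taken in the usual order, so for a nonprincipal character it converges
  (conditionally) whenever the real part of \<open>s\<close> is positive; in particular at \<open>s = 1\<close>.\<close>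
definition dirichlet_L :: "'a::{real_normed_field,ln} \<Rightarrow> (nat \<Rightarrow> int) \<Rightarrow> 'a" where
  "dirichlet_L s f = (\<Sum>n. of_int (f (Suc n)) / of_nat (Suc n) powr s)"

definition kappa :: real where
  "kappa = pi * sqrt (2 / 3)"

definition coeff_a :: "nat \<Rightarrow> real" where
  "coeff_a p = ((real p - 1) / (384 * (real p)\<^sup>2)) powr (1 / 4)
      * exp (1 / 4 * sqrt (real p) * dirichlet_L 1 (legendre_char p))"

text \<open>The second branch is meant for \<open>p mod 8 = 5\<close>, the only other case when \<open>p mod 4 = 1\<close>.\<close>
definition coeff_b :: "nat \<Rightarrow> real" where
  "coeff_b p = (if p mod 8 = 1 then 1
      else exp (- (sqrt (real p) * dirichlet_L 1 (legendre_char p))))"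

end

theory Submission
  imports Defs "HOL-Complex_Analysis.Complex_Analysis" "HOL-Real_Asymp.Real_Asymp"
    "HOL-Probability.Distributions"
begin

text \<open>
  The generating function is \<open>H(z) = \<Prod>a. 1 / (1 - \<chi>(a) z^a) = exp \<Lambda>(z)\<close> with \<open>\<Lambda>(z) = \<Sum>k. G_k(z^k) / k\<close>,
  where \<open>G_k(w) = G0(w) = 1 / (1 - w) - 1 / (1 - w^p)\<close> for even \<open>k\<close> and
  \<open>G_k(w) = G1(w) = \<Sum>a. \<chi>(a) w^a = p^(-1/2) \<Sum>h. \<chi>(h) / (1 - \<zeta>^h w)\<close> for odd \<open>k\<close>, because the quadratic
  Gauss sum is \<open>+ sqrt p\<close>. The circle method is applied on \<open>|z| = exp (- x)\<close> with \<open>x = sqrt (A / n)\<close> and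
  \<open>A = \<pi>\<^sup>2 (1 - 1 / p) / 24\<close>.

  Near \<open>z = 1\<close> and \<open>z = - 1\<close>, that is for \<open>z = \<plusminus> exp (- t)\<close> with \<open>t\<close> in a sector, \<open>\<Lambda>(z)\<close> is \<open>A / t\<close> plus sums of
  the form \<open>\<Sum>j. h(j t) / j\<close> with \<open>h\<close> holomorphic, decaying and \<open>h(0) = 0\<close>. Such sums are Lipschitz up to
  \<open>t = 0\<close>, since the derivatives \<open>\<Sum>j. h'(j t)\<close> are Riemann sums of an exact differential. Hence only their limits
  along the real axis are needed; these come from Abel summation, the sine product and the Fourier
  expansion of \<open>\<chi>\<close>, and produce \<open>L(1, \<chi>)\<close>.

  Away from \<open>\<plusminus> 1\<close> the real part of \<open>\<Lambda>(z)\<close> is smaller than \<open>A / x\<close> by a fixed multiple of \<open>1 / x\<close>: the terms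
  with odd \<open>k\<close> can only be large near nontrivial \<open>p\<close>-th roots of unity, where the terms with small even
  \<open>k\<close> are bounded. This needs \<open>p \<ge> 13\<close>; for \<open>p = 5\<close> the primitive fifth roots of unity contribute as much as \<open>\<plusminus> 1\<close>.
\<close>

section \<open>Abelian summation\<close>

text \<open>The behaviour of \<open>Lam\<close> near \<open>1\<close> would usually come from a
  Mellin transform and the functional equation of the L-function. Real-variable arguments take their
  place here: the constant in the odd part is formally the derivative of the L-function at
  \<open>0\<close>, a regularised sum of \<open>- chi(a) ln a\<close>, and the sine product
  expresses it by the same sum of \<open>chi(r) ln (sin (pi r / p))\<close> that gives
  \<open>L(1, chi)\<close>. Comparing the two needs the exact sign of the Gauss sum, which its
  square does not reveal. The point \<open>- 1\<close> is reduced to \<open>1\<close> by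
  \<open>chi(2 m) = chi(2) chi(m)\<close>, and \<open>chi(2)\<close> alone produces the two branches
  of \<open>coeff_b\<close>. On the minor arcs the generic bound for the even part is
  \<open>pi^2 / (24 x)\<close>, larger than \<open>A / x\<close> by \<open>pi^2 / (24 p x)\<close>;
  recovering this loss together with the odd part, of order \<open>1 / (x sqrt p)\<close>, requires
  explicit numerical inequalities, which are tightest at \<open>p = 13\<close>. The relative error
  obtained is \<open>n^(-1/4)\<close>, since \<open>n x\<close> has order \<open>sqrt n\<close> and
  the Gaussian approximation costs the inverse square root of \<open>n x\<close>.\<close>

lemma abel_tail_bound:
  fixes a b :: "nat \<Rightarrow> real"
  assumes tail: "\<And>k. N \<le> k \<Longrightarrow> \<bar>\<Sum>i=N..<k. a i\<bar> \<le> e"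
    and anti: "\<And>i j. i \<le> j \<Longrightarrow> b j \<le> b i" and nonneg: "\<And>i. 0 \<le> b i"
  shows "\<bar>\<Sum>i=N..<M. a i * b i\<bar> \<le> e * b N"
proof (cases "N < M")
  case False
  have "0 \<le> e" using tail[of N] by simp
  then show ?thesis using False nonneg[of N] by simp
next
  case True
  define s where "s k = (\<Sum>i=N..<k. a i)" for k
  \<comment> \<open>Summation by parts. As \<open>b\<close> decreases, the weights
    \<open>b i - b (Suc i)\<close> and \<open>b M\<close> are nonnegative and add up to
    \<open>b N\<close>, so the bound \<open>e\<close> on the partial sums factors out.\<close>
  have parts: "(\<Sum>i=N..<k. a i * b i) = s k * b k + (\<Sum>i=N..<k. s (Suc i) * (b i - b (Suc i)))"
    if "N \<le> k" for k using that
  proof (induction k rule: dec_induct)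
    case base then show ?case by (simp add: s_def)
  next
    case (step k)
    have "s (Suc k) = s k + a k" using step by (simp add: s_def)
    then show ?case using step by (simp add: algebra_simps)
  qed
  have "\<bar>s k\<bar> \<le> e" if "N \<le> k" for k using tail[OF that] by (simp add: s_def)
  then have *: "\<bar>s k * c\<bar> \<le> e * c" if "N \<le> k" "0 \<le> c" for k c
    using that by (simp add: abs_mult mult_right_mono)
  have "\<bar>\<Sum>i=N..<M. a i * b i\<bar> \<le> \<bar>s M * b M\<bar> + (\<Sum>i=N..<M. \<bar>s (Suc i) * (b i - b (Suc i))\<bar>)"
    unfolding parts[OF less_imp_le[OF True]] by (rule order_trans[OF abs_triangle_ineq]) (simp add: sum_abs)
  also have "\<dots> \<le> e * b M + (\<Sum>i=N..<M. e * (b i - b (Suc i)))"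
    using True anti nonneg by (intro add_mono sum_mono *) auto
  also have "(\<Sum>i=N..<M. e * (b i - b (Suc i))) = e * (b N - b M)"
  proof -
    have "(\<Sum>i=N..<M. b (Suc i) - b i) = b M - b N" using True by (intro sum_Suc_diff') simp
    then have "(\<Sum>i=N..<M. b i - b (Suc i)) = b N - b M" by (simp add: sum_subtractf algebra_simps)
    then show ?thesis by (simp flip: sum_distrib_left)
  qed
  finally show ?thesis by (simp add: algebra_simps)
qed

lemma abel_regular:
  fixes a :: "nat \<Rightarrow> real" and v :: "real \<Rightarrow> real"
  assumes a: "a sums s"
    and anti: "\<And>u w. 0 < u \<Longrightarrow> u \<le> w \<Longrightarrow> v w \<le> v u" and nonneg: "\<And>u. 0 < u \<Longrightarrow> 0 \<le> v u"
    and lim: "(v \<longlongrightarrow> L) (at_right 0)"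
    and summ: "\<And>x. 0 < x \<Longrightarrow> summable (\<lambda>m. a m * v (real (Suc m) * x))"
  shows "((\<lambda>x. \<Sum>m. a m * v (real (Suc m) * x)) \<longlongrightarrow> L * s) (at_right 0)"
proof -
  have vL: "v u \<le> L" if "0 < u" for u
  proof (rule tendsto_lowerbound[OF lim])
    show "\<forall>\<^sub>F w in at_right 0. v u \<le> v w"
      using that by (auto simp: eventually_at_right_field intro!: exI[of _ u] anti)
  qed simp
  have L0: "0 \<le> L" using vL[of 1] nonneg[of 1] by simp
  show ?thesis
  proof (rule tendstoI)
    fix e :: real assume e: "0 < e"
    \<comment> \<open>Three errors of at most \<open>e / 4\<close> are added below; the summand
      \<open>1\<close> in the denominator covers \<open>L = 0\<close>.\<close>
    define d where "d = e / (4 * (L + 1))"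
    have d: "d > 0" using e L0 by (simp add: d_def)
    have dL: "d * L \<le> e / 4" using e L0 by (simp add: d_def field_simps)
    have "Cauchy (\<lambda>n. \<Sum>i<n. a i)" using a by (auto simp: sums_def intro: LIMSEQ_imp_Cauchy)
    then obtain N where N: "\<And>m n. m \<ge> N \<Longrightarrow> n \<ge> N \<Longrightarrow> dist (\<Sum>i<m. a i) (\<Sum>i<n. a i) < d"
      using d unfolding Cauchy_def by meson
    have tail: "\<bar>\<Sum>i=N..<k. a i\<bar> \<le> d" if "N \<le> k" for k
    proof -
      have "(\<Sum>i=N..<k. a i) = (\<Sum>i<k. a i) - (\<Sum>i<N. a i)"
        using sum_diff_nat_ivl[of 0 N k a] that by (simp add: atLeast0LessThan)
      then show ?thesis using N[of k N] that by (simp add: dist_real_def)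
    qed
    have taillim: "\<bar>s - (\<Sum>i<N. a i)\<bar> \<le> d"
    proof (rule tendsto_upperbound)
      show "(\<lambda>n. \<bar>(\<Sum>i<n. a i) - (\<Sum>i<N. a i)\<bar>) \<longlonglongrightarrow> \<bar>s - (\<Sum>i<N. a i)\<bar>"
        using a by (intro tendsto_intros) (simp add: sums_def)
      show "\<forall>\<^sub>F n in sequentially. \<bar>(\<Sum>i<n. a i) - (\<Sum>i<N. a i)\<bar> \<le> d"
        using N by (auto simp: eventually_sequentially dist_real_def intro!: exI[of _ N] less_imp_le)
    qed simp
    have "((\<lambda>x. v (real (Suc i) * x)) \<longlongrightarrow> L) (at_right 0)" for i
    proof (rule filterlim_compose[OF lim])
      show "LIM x at_right 0. real (Suc i) * x :> at_right 0"
        unfolding filterlim_at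
        by (auto intro!: tendsto_eq_intros simp: eventually_at_right_field intro!: exI[of _ 1])
    qed
    then have "((\<lambda>x. \<Sum>i<N. a i * v (real (Suc i) * x)) \<longlongrightarrow> (\<Sum>i<N. a i * L)) (at_right 0)"
      by (intro tendsto_sum tendsto_mult tendsto_const)
    then have "\<forall>\<^sub>F x in at_right 0. dist (\<Sum>i<N. a i * v (real (Suc i) * x)) (\<Sum>i<N. a i * L) < e / 4"
      by (rule tendstoD) (use e in simp)
    moreover have "\<forall>\<^sub>F x in at_right (0::real). x > 0" by (simp add: eventually_at_right_less)
    ultimately show "\<forall>\<^sub>F x in at_right 0. dist (\<Sum>m. a m * v (real (Suc m) * x)) (L * s) < e"
    proof eventually_elim
      case (elim x)
      define b where "b i = v (real (Suc i) * x)" for i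
      have sb: "summable (\<lambda>m. a m * b m)" using summ[of x] elim by (simp add: b_def)
      have t: "\<bar>(\<Sum>m. a m * b m) - (\<Sum>i<N. a i * b i)\<bar> \<le> d * b N"
      proof (rule tendsto_upperbound)
        show "(\<lambda>n. \<bar>(\<Sum>i<n. a i * b i) - (\<Sum>i<N. a i * b i)\<bar>) \<longlonglongrightarrow> \<bar>(\<Sum>m. a m * b m) - (\<Sum>i<N. a i * b i)\<bar>"
          using sb by (intro tendsto_intros summable_LIMSEQ)
        show "\<forall>\<^sub>F n in sequentially. \<bar>(\<Sum>i<n. a i * b i) - (\<Sum>i<N. a i * b i)\<bar> \<le> d * b N"
          unfolding eventually_sequentially
        proof (intro exI[of _ N] allI impI)
          fix n assume "N \<le> n"
          then have "(\<Sum>i<n. a i * b i) - (\<Sum>i<N. a i * b i) = (\<Sum>i=N..<n. a i * b i)"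
            using sum_diff_nat_ivl[of 0 N n "\<lambda>i. a i * b i"] by (simp add: atLeast0LessThan)
          moreover have "\<bar>\<Sum>i=N..<n. a i * b i\<bar> \<le> d * b N"
            using tail elim by (intro abel_tail_bound) (auto simp: b_def intro!: anti nonneg mult_right_mono)
          ultimately show "\<bar>(\<Sum>i<n. a i * b i) - (\<Sum>i<N. a i * b i)\<bar> \<le> d * b N" by simp
        qed
      qed simp
      also have "d * b N \<le> d * L" using d elim by (intro mult_left_mono) (auto simp: b_def intro!: vL)
      finally have t': "\<bar>(\<Sum>m. a m * b m) - (\<Sum>i<N. a i * b i)\<bar> \<le> e / 4" using dL by simp
      have "\<bar>L * s - L * (\<Sum>i<N. a i)\<bar> \<le> e / 4"
        using mult_left_mono[OF taillim L0] dL L0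
        by (simp add: abs_mult right_diff_distrib[symmetric] mult.commute)
      moreover have "\<bar>(\<Sum>i<N. a i * b i) - L * (\<Sum>i<N. a i)\<bar> < e / 4"
        using elim by (simp add: b_def dist_real_def sum_distrib_left mult.commute)
      ultimately have "\<bar>(\<Sum>m. a m * b m) - L * s\<bar> < e"
        using t' e by linarith
      then show ?case by (simp add: b_def dist_real_def)
    qed
  qed
qed

section \<open>Sums over dilations in a sector\<close>

text \<open>With \<open>t = x - i y\<close> this is the major arc \<open>|y| <= 4 x\<close>. The
  slope \<open>4\<close> is large enough for the factor \<open>9/2\<close> in
  \<open>norm_one_minus_square_ge\<close>, which the minor arcs need.\<close>

definition sector :: "complex set" where
  "sector = {t. \<bar>Im t\<bar> \<le> 4 * Re t}"

text \<open>For \<open>0 < d\<close> an open neighbourhood of \<open>sector\<close> including its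
  vertex: the larger slope gives room growing with \<open>|t|\<close>, the shift \<open>d\<close>
  gives room at the origin.\<close>

definition wide_sector :: "real \<Rightarrow> complex set" where
  "wide_sector d = {t. \<bar>Im t\<bar> < 5 * Re t + d}"

lemma open_wide_sector: "open (wide_sector d)"
  unfolding wide_sector_def by (intro open_Collect_less continuous_intros)

lemma convex_sector: "convex sector"
proof -
  have "sector = {t. Im t - 4 * Re t \<le> 0} \<inter> {t. - Im t - 4 * Re t \<le> 0}"
    by (auto simp: sector_def)
  moreover have "convex {t. Im t - 4 * Re t \<le> 0}" "convex {t. - Im t - 4 * Re t \<le> 0}"
  proof -
    have "{t. Im t - 4 * Re t \<le> 0} = {t. inner (Complex (-4) 1) t \<le> 0}"
      "{t. - Im t - 4 * Re t \<le> 0} = {t. inner (Complex (-4) (-1)) t \<le> 0}"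
      by (auto simp: inner_complex_def)
    then show "convex {t. Im t - 4 * Re t \<le> 0}" "convex {t. - Im t - 4 * Re t \<le> 0}"
      by (simp_all only: convex_halfspace_le)
  qed
  ultimately show ?thesis by (metis convex_Int)
qed

lemma sector_norm_le: "t \<in> sector \<Longrightarrow> norm t \<le> 5 * Re t"
  using cmod_le[of t] by (auto simp: sector_def)

lemma sector_Re_pos: "t \<in> sector \<Longrightarrow> t \<noteq> 0 \<Longrightarrow> 0 < Re t"
  by (metis sector_norm_le less_le_trans mult_less_cancel_left_pos mult_zero_right zero_less_norm_iff
      zero_less_numeral)

lemma sector_scale: "t \<in> sector \<Longrightarrow> 0 \<le> c \<Longrightarrow> of_real c * t \<in> sector"
  by (simp add: sector_def abs_mult mult.left_commute mult_left_mono)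

lemma sector_subset_wide: "0 < d \<Longrightarrow> sector \<subseteq> wide_sector d"
  by (auto simp: sector_def wide_sector_def)

text \<open>In \<open>sector\<close> one has \<open>Re t >= |t| / 5\<close>, and a displacement of
  length \<open>e\<close> raises \<open>|Im| - 5 Re\<close> by at most \<open>6 e\<close>. The
  radius grows like \<open>1 + |t|\<close>, which later turns Cauchy's inequality into
  decay.\<close>

lemma cball_in_wide_sector:
  assumes "t \<in> sector" "0 < d"
  shows "cball t (min d (1/5) / 12 * (1 + norm t)) \<subseteq> wide_sector d"
proof
  fix z assume "z \<in> cball t (min d (1/5) / 12 * (1 + norm t))"
  then have z: "norm (z - t) \<le> min d (1/5) / 12 * (1 + norm t)" by (simp add: dist_norm norm_minus_commute)
  have "\<bar>Im z\<bar> - \<bar>Im t\<bar> \<le> norm (z - t)" "Re t - Re z \<le> norm (z - t)"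
    using abs_Im_le_cmod[of "z - t"] abs_Re_le_cmod[of "z - t"] by auto
  then have "\<bar>Im z\<bar> - 5 * Re z \<le> \<bar>Im t\<bar> - 5 * Re t + 6 * norm (z - t)" by simp
  also have "\<dots> \<le> - Re t + 6 * norm (z - t)" using assms by (simp add: sector_def)
  also have "\<dots> \<le> - norm t / 5 + 6 * norm (z - t)" using sector_norm_le[OF assms(1)] by simp
  also have "6 * norm (z - t) \<le> min d (1/5) / 2 * (1 + norm t)" using z by simp
  also have "- norm t / 5 + min d (1/5) / 2 * (1 + norm t) < d"
  proof -
    have "min d (1/5) / 2 * norm t \<le> (1/5) * norm t" by (intro mult_right_mono) auto
    moreover have "min d (1/5) / 2 < d" using assms by (auto simp: min_def)
    ultimately show ?thesis by (simp add: algebra_simps)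
  qed
  finally show "z \<in> wide_sector d" by (simp add: wide_sector_def)
qed

text \<open>The discs on which Cauchy's inequality is applied have radius proportional to
  \<open>1 + |t|\<close>, and the second derivative loses the square of the radius.\<close>

lemma second_deriv_decay:
  assumes h: "h holomorphic_on wide_sector d" and d: "0 < d"
    and C: "\<And>t. t \<in> wide_sector d \<Longrightarrow> norm (h t) * (1 + norm t) \<le> C"
  obtains K where "0 \<le> K" "\<And>t. t \<in> sector \<Longrightarrow> norm (deriv (deriv h) t) \<le> K / (1 + norm t)^2"
proof -
  define m where "m = min d (1/5) / 12"
  have m: "0 < m" using d by (simp add: m_def)
  have "norm (h 0) * (1 + norm (0::complex)) \<le> C" by (rule C) (simp add: wide_sector_def d)
  then have C0: "0 \<le> C" by (rule order_trans[rotated]) simp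
  have "norm (deriv (deriv h) t) \<le> (2 * C / m^2) / (1 + norm t)^2" if t: "t \<in> sector" for t
  proof -
    let ?r = "m * (1 + norm t)"
    have r: "0 < ?r" using m by (simp add: add_pos_nonneg)
    have sub: "cball t ?r \<subseteq> wide_sector d" using cball_in_wide_sector[OF t d] by (simp add: m_def)
    have B: "norm (h z) \<le> C" if "z \<in> wide_sector d" for z
    proof -
      have "norm (h z) * 1 \<le> norm (h z) * (1 + norm z)" by (intro mult_left_mono) auto
      then show ?thesis using C[OF that] by simp
    qed
    have "norm ((deriv ^^ 2) h t) \<le> fact 2 * C / ?r ^ 2"
    proof (rule Cauchy_inequality)
      show "h holomorphic_on ball t ?r" using h sub ball_subset_cball by (blast intro: holomorphic_on_subset)
      show "continuous_on (cball t ?r) h"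
        using h sub by (blast intro: holomorphic_on_imp_continuous_on holomorphic_on_subset)
      show "norm (h x) \<le> C" if "norm (t - x) = ?r" for x
        by (rule B) (use sub that in \<open>auto simp: dist_norm\<close>)
    qed (fact r)
    then show ?thesis by (simp add: numeral_2_eq_2 mult_ac)
  qed
  then show ?thesis using that[of "2 * C / m^2"] C0 m by simp
qed

text \<open>A Riemann sum with step \<open>r\<close> for the integral of
  \<open>1 / (1 + u)^2\<close> over the positive half-line, which is \<open>1\<close>. Each term
  with \<open>i >= 1\<close> is at most the integral over the preceding step; the term
  \<open>i = 0\<close> contributes the extra \<open>r\<close>.\<close>

lemma sum_inverse_square_steps:
  fixes r :: real
  assumes r: "0 < r"
  shows "(\<Sum>i<n. r / (1 + real i * r)^2) \<le> r + 1"
proof -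
  have "(\<Sum>i<n. r / (1 + real i * r)^2) \<le> r + (1 - 1 / (1 + real (n - 1) * r))"
  proof (induction n)
    case (Suc n)
    show ?case
    proof (cases n)
      case (Suc k)
      let ?a = "1 + real k * r"
      have a: "0 < ?a" using r by (simp add: add_pos_nonneg)
      have "r / (?a + r)^2 \<le> r / (?a * (?a + r))"
        using a r by (intro divide_left_mono) (auto simp: power2_eq_square)
      also have "\<dots> = 1 / ?a - 1 / (?a + r)" using a r by (simp add: divide_simps)
      finally show ?thesis using Suc.IH Suc by (simp add: algebra_simps)
    qed (use r in simp)
  qed (use r in simp)
  also have "\<dots> \<le> r + 1" using r by simp
  finally show ?thesis .
qed

text \<open>Multiplied by \<open>w\<close>, the sum is a right-endpoint Riemann sum for the integral
  of \<open>deriv h\<close> from \<open>0\<close> to \<open>n w\<close>, whose value is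
  \<open>h (n w) - h 0\<close>. By Taylor each step errs by a quantity quadratic in
  \<open>|w|\<close>, and the decay of the second derivative keeps the total error at
  \<open>O(|w|)\<close> for small \<open>w\<close>. Because \<open>h 0 = 0\<close>, division by
  \<open>w\<close> leaves no term that blows up like \<open>h 0 / w\<close>.\<close>

lemma deriv_sum_bound:
  assumes h: "h holomorphic_on wide_sector d" and d: "0 < d" and h0: "h 0 = 0"
    and K: "0 \<le> K" "\<And>t. t \<in> sector \<Longrightarrow> norm (deriv (deriv h) t) \<le> K / (1 + norm t)^2"
    and w: "w \<in> sector" "w \<noteq> 0"
  shows "norm (\<Sum>j<n. deriv h (of_nat (Suc j) * w)) \<le> K * (norm w + 1) + norm (h (of_nat n * w)) / norm w"
proof -
  have d1: "(h has_field_derivative deriv h t) (at t)" if "t \<in> sector" for t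
    using holomorphic_derivI[OF h open_wide_sector] sector_subset_wide[OF d] that by blast
  have d2: "(deriv h has_field_derivative deriv (deriv h) t) (at t)" if "t \<in> sector" for t
    using holomorphic_derivI[OF holomorphic_deriv[OF h open_wide_sector] open_wide_sector]
      sector_subset_wide[OF d] that by blast
  have nw: "0 < norm w" using w by simp
  have step: "norm (h (of_nat (Suc j) * w) - h (of_nat j * w) - w * deriv h (of_nat (Suc j) * w))
      \<le> K * norm w * (norm w / (1 + real j * norm w)^2)" for j
  proof -
    let ?a = "of_nat j * w" and ?b = "of_nat (Suc j) * w"
    have ab: "?a \<in> sector" "?b \<in> sector"
      using sector_scale[OF w(1), of "real j"] sector_scale[OF w(1), of "real (Suc j)"] by auto
    then have seg: "closed_segment ?a ?b \<subseteq> sector"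
      by (simp add: closed_segment_subset convex_sector)
    have lower: "real j * norm w \<le> norm x" if x: "x \<in> closed_segment ?a ?b" for x
    proof -
      obtain u where u: "0 \<le> u" "u \<le> 1" "x = (1 - u) *\<^sub>R ?a + u *\<^sub>R ?b"
        using x by (auto simp: closed_segment_def)
      then have "x = of_real (real j + u) * w" by (simp add: scaleR_conv_of_real algebra_simps)
      then have "norm x = (real j + u) * norm w" using u by (simp only: norm_mult norm_of_real)
      then show ?thesis using u nw by simp
    qed
    \<comment> \<open>The chain of derivatives in the form required by
      \<open>complex_Taylor\<close>; the expansion is about the right endpoint \<open>?b\<close> and
      is evaluated at \<open>?a\<close>.\<close>
    define f where "f n = (if n = 0 then h else if n = 1 then deriv h else deriv (deriv h))" for n :: nat
    have "norm (f 0 ?a - (\<Sum>i\<le>1. f i ?b * (?a - ?b) ^ i / fact i))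
        \<le> (K / (1 + real j * norm w)^2) * norm (?a - ?b) ^ Suc 1 / fact 1"
    proof (rule complex_Taylor)
      show "convex (closed_segment ?a ?b)" by simp
      show "(f i has_field_derivative f (Suc i) x) (at x within closed_segment ?a ?b)"
        if "x \<in> closed_segment ?a ?b" "i \<le> 1" for i x
      proof -
        have "x \<in> sector" using seg that by blast
        then show ?thesis using d1[of x] d2[of x] that
          by (cases i) (auto simp: f_def intro: has_field_derivative_at_within)
      qed
      show "norm (f (Suc 1) x) \<le> K / (1 + real j * norm w)^2" if "x \<in> closed_segment ?a ?b" for x
      proof -
        have "norm (deriv (deriv h) x) \<le> K / (1 + norm x)^2" using K seg that by blast
        also have "\<dots> \<le> K / (1 + real j * norm w)^2"
          using lower[OF that] K nw by (intro divide_left_mono power_mono zero_less_power mult_pos_pos) (auto intro: add_pos_nonneg)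
        finally show ?thesis by (simp add: f_def)
      qed
    qed auto
    moreover have "norm (?a - ?b) = norm w"
      by (simp add: algebra_simps)
    moreover have "?a - ?b = - w" by (simp add: algebra_simps)
    ultimately have "norm (h ?a - (h ?b - w * deriv h ?b)) \<le> K / (1 + real j * norm w)^2 * norm w ^ 2"
      by (simp add: f_def numeral_2_eq_2 mult_ac)
    moreover have neg: "b - a - c = - (a - (b - c))" for a b c :: complex by simp
    have "norm (h ?a - (h ?b - w * deriv h ?b)) = norm (h ?b - h ?a - w * deriv h ?b)"
      unfolding neg norm_minus_cancel ..
    ultimately show ?thesis by (simp add: power2_eq_square)
  qed
  have tele: "(\<Sum>j<n. h (of_nat (Suc j) * w) - h (of_nat j * w)) = h (of_nat n * w)"
    using sum_lessThan_telescope[of "\<lambda>j. h (of_nat j * w)" n] h0 by simp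
  have "norm (h (of_nat n * w) - w * (\<Sum>j<n. deriv h (of_nat (Suc j) * w)))
      = norm (\<Sum>j<n. h (of_nat (Suc j) * w) - h (of_nat j * w) - w * deriv h (of_nat (Suc j) * w))"
    by (simp only: sum_subtractf[of _ _ "{..<n}"] tele[symmetric] sum_distrib_left)
  also have "\<dots> \<le> (\<Sum>j<n. K * norm w * (norm w / (1 + real j * norm w)^2))"
    by (intro sum_norm_le step)
  also have "\<dots> = K * norm w * (\<Sum>j<n. norm w / (1 + real j * norm w)^2)"
    by (simp add: sum_distrib_left)
  also have "\<dots> \<le> K * norm w * (norm w + 1)"
    using K sum_inverse_square_steps[OF nw, of n] by (intro mult_left_mono) auto
  finally have "norm (w * (\<Sum>j<n. deriv h (of_nat (Suc j) * w))) \<le> K * norm w * (norm w + 1) + norm (h (of_nat n * w))"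
    using norm_triangle_ineq2[of "w * (\<Sum>j<n. deriv h (of_nat (Suc j) * w))" "h (of_nat n * w)"]
    by (simp add: norm_minus_commute)
  then show ?thesis using nw by (simp add: norm_mult field_simps)
qed

text \<open>The weight \<open>1 / j\<close> cancels the inner derivative \<open>j\<close>, so the
  derivative in \<open>t\<close> is the unweighted sum of \<open>deriv h (j t)\<close>.\<close>

definition dilation_sum :: "(complex \<Rightarrow> complex) \<Rightarrow> complex \<Rightarrow> complex" where
  "dilation_sum h t = (\<Sum>j. h (of_nat (Suc j) * t) / of_nat (Suc j))"

lemma summable_inverse_Suc_square: "summable (\<lambda>j. 1 / (real (Suc j))^2)"
  using inverse_squares_sums by (auto simp: sums_iff algebra_simps)

lemma dilation_sum_summable:
  fixes h :: "complex \<Rightarrow> complex"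
  assumes C: "\<And>t. t \<in> sector \<Longrightarrow> norm (h t) * (1 + norm t) \<le> C"
    and t: "t \<in> sector" "t \<noteq> 0"
  shows "summable (\<lambda>j. norm (h (of_nat (Suc j) * t) / of_nat (Suc j)))"
proof (rule summable_comparison_test')
  show "summable (\<lambda>j. C / norm t * (1 / (real (Suc j))^2))"
    by (intro summable_mult summable_inverse_Suc_square)
  fix j :: nat
  let ?n = "real (Suc j)"
  have "of_nat (Suc j) * t \<in> sector" using sector_scale[OF t(1), of ?n] by simp
  from C[OF this] have "norm (h (of_nat (Suc j) * t)) * (1 + ?n * norm t) \<le> C"
    by (simp add: norm_mult del: of_nat_Suc)
  moreover have "norm (h (of_nat (Suc j) * t)) * (?n * norm t) \<le> norm (h (of_nat (Suc j) * t)) * (1 + ?n * norm t)"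
    by (intro mult_left_mono) auto
  ultimately have "norm (h (of_nat (Suc j) * t)) * (?n * norm t) \<le> C" by linarith
  then show "norm (norm (h (of_nat (Suc j) * t) / of_nat (Suc j))) \<le> C / norm t * (1 / ?n^2)"
    using t by (simp add: norm_divide power2_eq_square field_simps del: of_nat_Suc)
qed

text \<open>On the segment from \<open>s\<close> to \<open>t\<close> the derivatives of the
  truncated sums are bounded uniformly in \<open>n\<close> by \<open>deriv_sum_bound\<close>, up to
  the boundary term \<open>h (n w) / w\<close>. The decay of \<open>h\<close> makes that term
  \<open>O(1 / n)\<close>; it disappears in the limit, and the remaining constant does not
  deteriorate near \<open>0\<close>.\<close>

lemma dilation_sum_lipschitz:
  assumes h: "h holomorphic_on wide_sector d" and d: "0 < d" and h0: "h 0 = 0"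
    and C: "\<And>t. t \<in> wide_sector d \<Longrightarrow> norm (h t) * (1 + norm t) \<le> C"
  obtains K where "0 \<le> K" "\<And>s t. s \<in> sector \<Longrightarrow> t \<in> sector \<Longrightarrow> s \<noteq> 0 \<Longrightarrow> t \<noteq> 0 \<Longrightarrow>
      norm (dilation_sum h s - dilation_sum h t) \<le> K * (max (norm s) (norm t) + 1) * norm (s - t)"
proof -
  obtain K where K: "0 \<le> K" "\<And>t. t \<in> sector \<Longrightarrow> norm (deriv (deriv h) t) \<le> K / (1 + norm t)^2"
    using second_deriv_decay[OF h d C] by blast
  have Cc: "norm (h t) * (1 + norm t) \<le> C" if "t \<in> sector" for t
    using C sector_subset_wide[OF d] that by blast
  have C0: "0 \<le> C" using Cc[of 0] h0 by (simp add: sector_def)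
  have "norm (dilation_sum h s - dilation_sum h t) \<le> K * (max (norm s) (norm t) + 1) * norm (s - t)"
    if s: "s \<in> sector" "s \<noteq> 0" and t: "t \<in> sector" "t \<noteq> 0" for s t
  proof -
    \<comment> \<open>A lower bound for \<open>Re w\<close> on the segment; it affects the estimate
      only through the term that vanishes as \<open>n\<close> grows.\<close>
    define m where "m = min (Re s) (Re t)"
    have m: "0 < m" using sector_Re_pos s t by (simp add: m_def)
    define P where "P n u = (\<Sum>j<n. h (of_nat (Suc j) * u) / of_nat (Suc j))" for n u
    have bound: "norm (P n s - P n t) \<le> (K * (max (norm s) (norm t) + 1) + C / (real n * m^2)) * norm (s - t)"
      if n: "0 < n" for n
    proof (rule field_differentiable_bound)
      show "convex (closed_segment s t)" by simp
      show "s \<in> closed_segment s t" "t \<in> closed_segment s t" by auto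
      fix w assume w: "w \<in> closed_segment s t"
      have wc: "w \<in> sector" using w s t convex_sector closed_segment_subset by blast
      have Rew: "m \<le> Re w"
      proof -
        have "closed_segment s t \<subseteq> {z. m \<le> Re z}"
          by (rule closed_segment_subset) (auto simp: m_def convex_halfspace_Re_ge)
        then show ?thesis using w by blast
      qed
      then have wm: "m \<le> norm w" using complex_Re_le_cmod[of w] by linarith
      then have w0: "w \<noteq> 0" using m by auto
      have nw: "norm w \<le> max (norm s) (norm t)"
      proof -
        have "closed_segment s t \<subseteq> cball 0 (max (norm s) (norm t))"
          by (rule closed_segment_subset) auto
        then show ?thesis using w by auto
      qed
      show "(P n has_field_derivative (\<Sum>j<n. deriv h (of_nat (Suc j) * w))) (at w within closed_segment s t)"
        unfolding P_def
      proof (intro DERIV_sum)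
        fix j
        have "of_nat (Suc j) * w \<in> wide_sector d"
          using sector_scale[OF wc, of "real (Suc j)"] sector_subset_wide[OF d] by auto
        then have "(h has_field_derivative deriv h (of_nat (Suc j) * w)) (at (of_nat (Suc j) * w))"
          using holomorphic_derivI[OF h open_wide_sector] by blast
        then have "((\<lambda>u. h (of_nat (Suc j) * u)) has_field_derivative deriv h (of_nat (Suc j) * w) * of_nat (Suc j)) (at w)"
          by (rule DERIV_chain2) (auto intro!: derivative_eq_intros)
        from DERIV_cdivide[OF this, of "of_nat (Suc j)"]
        have "((\<lambda>u. h (of_nat (Suc j) * u) / of_nat (Suc j)) has_field_derivative deriv h (of_nat (Suc j) * w)) (at w)"
          by (simp del: of_nat_Suc)
        then show "((\<lambda>u. h (of_nat (Suc j) * u) / of_nat (Suc j)) has_field_derivative deriv h (of_nat (Suc j) * w))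
            (at w within closed_segment s t)"
          by (rule has_field_derivative_at_within)
      qed
      have "norm (\<Sum>j<n. deriv h (of_nat (Suc j) * w)) \<le> K * (norm w + 1) + norm (h (of_nat n * w)) / norm w"
        by (rule deriv_sum_bound[OF h d h0 K wc w0])
      also have "norm (h (of_nat n * w)) / norm w \<le> C / (real n * m^2)"
      proof -
        have "of_nat n * w \<in> sector" using sector_scale[OF wc, of "real n"] by simp
        from Cc[OF this] have 1: "norm (h (of_nat n * w)) * (1 + real n * norm w) \<le> C"
          by (simp add: norm_mult)
        have "norm (h (of_nat n * w)) * (real n * m) \<le> norm (h (of_nat n * w)) * (1 + real n * norm w)"
          using wm n by (intro mult_left_mono) (auto intro: add_increasing)
        with 1 have "norm (h (of_nat n * w)) \<le> C / (real n * m)" using n m by (simp add: field_simps)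
        then have "norm (h (of_nat n * w)) / norm w \<le> C / (real n * m) / m"
          using wm m n C0 by (intro frac_le) auto
        then show ?thesis by (simp add: power2_eq_square mult.assoc)
      qed
      also have "K * (norm w + 1) \<le> K * (max (norm s) (norm t) + 1)" using K nw by (intro mult_left_mono) auto
      finally show "norm (\<Sum>j<n. deriv h (of_nat (Suc j) * w))
          \<le> K * (max (norm s) (norm t) + 1) + C / (real n * m^2)" by simp
    qed
    have lim: "(\<lambda>n. P n u) \<longlonglongrightarrow> dilation_sum h u" if "u \<in> sector" "u \<noteq> 0" for u
      using summable_LIMSEQ[OF summable_norm_cancel[OF dilation_sum_summable[OF Cc that]]]
      by (simp add: P_def dilation_sum_def)
    show ?thesis
    proof (rule LIMSEQ_le)
      show "(\<lambda>n. norm (P n s - P n t)) \<longlonglongrightarrow> norm (dilation_sum h s - dilation_sum h t)"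
        using s t by (intro tendsto_intros lim)
      have "(\<lambda>n. C / (real n * m^2)) \<longlonglongrightarrow> 0" using m by real_asymp
      then have "(\<lambda>n. (K * (max (norm s) (norm t) + 1) + C / (real n * m^2)) * norm (s - t))
        \<longlonglongrightarrow> (K * (max (norm s) (norm t) + 1) + 0) * norm (s - t)" by (intro tendsto_intros)
      then show "(\<lambda>n. (K * (max (norm s) (norm t) + 1) + C / (real n * m^2)) * norm (s - t))
        \<longlonglongrightarrow> K * (max (norm s) (norm t) + 1) * norm (s - t)" by simp
      show "\<exists>N. \<forall>n\<ge>N. norm (P n s - P n t) \<le> (K * (max (norm s) (norm t) + 1) + C / (real n * m^2)) * norm (s - t)"
        using bound by (intro exI[of _ 1]) auto
    qed
  qed
  then show ?thesis using that[OF K(1)] by blast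
qed

text \<open>Letting one point tend to \<open>0\<close> along the positive axis in the Lipschitz
  bound promotes a limit for real arguments to an estimate with linear rate in the whole
  sector.\<close>

lemma dilation_sum_limit:
  assumes h: "h holomorphic_on wide_sector d" and d: "0 < d" and h0: "h 0 = 0"
    and C: "\<And>t. t \<in> wide_sector d \<Longrightarrow> norm (h t) * (1 + norm t) \<le> C"
    and lim: "((\<lambda>x. dilation_sum h (of_real x)) \<longlongrightarrow> l) (at_right 0)"
  obtains K where "0 \<le> K" "\<And>t. t \<in> sector \<Longrightarrow> t \<noteq> 0 \<Longrightarrow> norm (dilation_sum h t - l) \<le> K * (norm t + 1) * norm t"
proof -
  obtain K where K: "0 \<le> K" "\<And>s t. s \<in> sector \<Longrightarrow> t \<in> sector \<Longrightarrow> s \<noteq> 0 \<Longrightarrow> t \<noteq> 0 \<Longrightarrow>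
      norm (dilation_sum h s - dilation_sum h t) \<le> K * (max (norm s) (norm t) + 1) * norm (s - t)"
    using dilation_sum_lipschitz[OF h d h0 C] by blast
  have "norm (dilation_sum h t - l) \<le> K * (norm t + 1) * norm t" if t: "t \<in> sector" "t \<noteq> 0" for t
  proof (rule tendsto_le)
    show "((\<lambda>x. norm (dilation_sum h t - dilation_sum h (of_real x))) \<longlongrightarrow> norm (dilation_sum h t - l)) (at_right 0)"
      by (intro tendsto_intros lim)
    have "((\<lambda>x::real. K * (max (norm t) (norm (of_real x :: complex)) + 1) * norm (t - of_real x)) \<longlongrightarrow>
        K * (max (norm t) (norm (of_real 0 :: complex)) + 1) * norm (t - of_real 0)) (at_right 0)"
      by (intro tendsto_intros tendsto_max)
    then show "((\<lambda>x::real. K * (max (norm t) (norm (of_real x :: complex)) + 1) * norm (t - of_real x)) \<longlongrightarrow>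
        K * (norm t + 1) * norm t) (at_right 0)" by simp
    show "\<forall>\<^sub>F x in at_right 0. norm (dilation_sum h t - dilation_sum h (of_real x)) \<le>
       K * (max (norm t) (norm (of_real x :: complex)) + 1) * norm (t - of_real x)"
      using eventually_at_right_less[of "0::real"]
      by eventually_elim (intro K, use t in \<open>auto simp: sector_def\<close>)
  qed simp
  then show ?thesis using that[OF K(1)] by blast
qed

section \<open>The function \<open>1 / (exp t - 1) - 1 / t\<close>\<close>

text \<open>The part with \<open>Re t <= 1\<close> lies in a compact set with
  \<open>|t| <= 7\<close> on which \<open>f\<close> is still holomorphic, thanks to the larger shift
  \<open>2 * d\<close>. Elsewhere \<open>|t| <= 7 Re t\<close> converts \<open>B / Re t\<close> into
  the required decay.\<close>

lemma wide_sector_bound: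
  assumes f: "f holomorphic_on wide_sector (2 * d)" and d: "0 < d" "d \<le> 1"
    and B: "\<And>t. t \<in> wide_sector d \<Longrightarrow> 1 \<le> Re t \<Longrightarrow> norm (f t) \<le> B / Re t" and B0: "0 \<le> B"
  obtains C where "\<And>t. t \<in> wide_sector d \<Longrightarrow> norm (f t) * (1 + norm t) \<le> C"
proof -
  define K where "K = {t. \<bar>Im t\<bar> \<le> 5 * Re t + d} \<inter> {t. Re t \<le> 1}"
  have "closed K" unfolding K_def by (intro closed_Int closed_Collect_le continuous_intros)
  moreover have "bounded K"
  proof (rule boundedI)
    fix t assume "t \<in> K"
    then show "norm t \<le> 7" using cmod_le[of t] d by (auto simp: K_def)
  qed
  ultimately have "compact K" by (simp add: compact_eq_bounded_closed)
  moreover have "K \<subseteq> wide_sector (2 * d)" using d by (auto simp: K_def wide_sector_def)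
  then have "continuous_on K f"
    using f holomorphic_on_imp_continuous_on continuous_on_subset by blast
  ultimately have "bounded (f ` K)" by (intro compact_imp_bounded compact_continuous_image)
  then obtain M where M: "\<And>t. t \<in> K \<Longrightarrow> norm (f t) \<le> M" by (auto simp: bounded_iff)
  have "norm (f t) * (1 + norm t) \<le> max (M * 8) (B * 8)" if t: "t \<in> wide_sector d" for t
  proof (cases "Re t \<le> 1")
    case True
    then have tK: "t \<in> K" using t by (auto simp: K_def wide_sector_def)
    have n: "norm t \<le> 7" using cmod_le[of t] d t True by (auto simp: wide_sector_def)
    have "norm (f t) * (1 + norm t) \<le> norm (f t) * 8" using n by (intro mult_left_mono) auto
    then show ?thesis using M[OF tK] by linarith
  next
    case False
    have n: "norm t \<le> 7 * Re t" using cmod_le[of t] d t False by (auto simp: wide_sector_def)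
    have "norm (f t) * (1 + norm t) \<le> (B / Re t) * (8 * Re t)"
      using n False B[OF t] B0 by (intro mult_mono) auto
    also have "\<dots> = B * 8" using False by simp
    finally show ?thesis by simp
  qed
  then show ?thesis using that by blast
qed

text \<open>\<open>1 / (exp t - 1)\<close> without its pole at the origin; the value
  \<open>-1/2\<close> is the Bernoulli number \<open>B_1\<close>. As it does not vanish, only
  differences such as \<open>psi t - psi (p t)\<close> qualify for the dilation sums.\<close>

definition psi :: "complex \<Rightarrow> complex" where
  "psi t = (if t = 0 then -1/2 else 1 / (exp t - 1) - 1 / t)"

lemma exp_eq_1_nonzero:
  fixes t :: complex
  assumes "exp t = 1" "t \<noteq> 0"
  shows "Re t = 0" and "2 * pi \<le> \<bar>Im t\<bar>"
proof -
  obtain n :: int where n: "Re t = 0" "Im t = of_int (2 * n) * pi" using assms(1) by (auto simp: exp_eq_1)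
  have "n \<noteq> 0" using n assms(2) by (auto simp: complex_eq_iff)
  then have "1 \<le> \<bar>n\<bar>" by simp
  then have "1 \<le> \<bar>real_of_int n\<bar>" by linarith
  then show "2 * pi \<le> \<bar>Im t\<bar>" using n by (simp add: abs_mult)
  show "Re t = 0" by (rule n)
qed

lemma psi_tendsto: "(psi \<longlongrightarrow> - 1/2) (at 0)"
proof -
  have e1: "((\<lambda>t::complex. (exp t - 1) / t) \<longlongrightarrow> 1) (at 0)"
    using DERIV_exp[of "0::complex"] by (simp add: has_field_derivative_iff)
  have e2: "((\<lambda>t::complex. (exp t - 1 - t) / t^2) \<longlongrightarrow> 1/2) (at 0)"
  proof (rule Lim_transform2)
    show "((\<lambda>t::complex. 1/2) \<longlongrightarrow> 1/2) (at 0)" by simp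
    show "((\<lambda>t::complex. 1/2 - (exp t - 1 - t) / t^2) \<longlongrightarrow> 0) (at 0)"
    proof (rule Lim_null_comparison)
      have "((\<lambda>t::complex. exp \<bar>Re t\<bar> * norm t / 2) \<longlongrightarrow> exp \<bar>Re 0\<bar> * norm (0::complex) / 2) (at 0)"
        by (intro tendsto_intros) auto
      then show "((\<lambda>t::complex. exp \<bar>Re t\<bar> * norm t / 2) \<longlongrightarrow> 0) (at 0)" by simp
      show "\<forall>\<^sub>F t in at 0. norm (1/2 - (exp t - 1 - t) / t^2) \<le> exp \<bar>Re t\<bar> * norm t / 2"
        unfolding eventually_at
      proof (intro exI[of _ 1] conjI ballI impI)
        fix t :: complex assume "t \<noteq> 0 \<and> dist t 0 < 1"
        then have t: "t \<noteq> 0" by simp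
        have "norm (exp t - (1 + t + t^2 / 2)) \<le> exp \<bar>Re t\<bar> * norm t ^ 3 / 2"
          using Taylor_exp[of t 2] by (simp add: numeral_2_eq_2 numeral_3_eq_3)
        then have "norm (exp t - (1 + t + t^2 / 2)) / norm t ^ 2 \<le> exp \<bar>Re t\<bar> * norm t ^ 3 / 2 / norm t ^ 2"
          by (rule divide_right_mono) simp
        also have "\<dots> = exp \<bar>Re t\<bar> * norm t / 2" using t by (simp add: field_simps power2_eq_square power3_eq_cube)
        also have "norm (exp t - (1 + t + t^2 / 2)) / norm t ^ 2 = norm ((exp t - (1 + t + t^2 / 2)) / t^2)"
          by (simp add: norm_divide norm_power)
        also have "(exp t - (1 + t + t^2 / 2)) / t^2 = - (1/2 - (exp t - 1 - t) / t^2)"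
          using t by (simp add: field_simps)
        finally show "norm (1/2 - (exp t - 1 - t) / t^2) \<le> exp \<bar>Re t\<bar> * norm t / 2"
          by (simp only: norm_minus_cancel)
      qed simp
    qed
  qed
  have "((\<lambda>t::complex. - ((exp t - 1 - t) / t^2) / ((exp t - 1) / t)) \<longlongrightarrow> - (1/2) / 1) (at 0)"
    by (intro tendsto_intros e1 e2) auto
  moreover have "\<forall>\<^sub>F t in at 0. - ((exp t - 1 - t) / t^2) / ((exp t - 1) / t) = psi t"
    unfolding eventually_at
  proof (intro exI[of _ 1] conjI ballI impI)
    fix t :: complex assume t: "t \<noteq> 0 \<and> dist t 0 < 1"
    have "exp t \<noteq> 1"
      using exp_eq_1_nonzero(2)[of t] abs_Im_le_cmod[of t] t pi_gt3 by auto
    then show "- ((exp t - 1 - t) / t^2) / ((exp t - 1) / t) = psi t"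
      using t by (simp add: psi_def field_simps power2_eq_square)
  qed simp
  ultimately show ?thesis by (auto intro: Lim_transform_eventually)
qed

text \<open>The remaining poles \<open>2 pi i n\<close> lie on the imaginary axis, where
  \<open>wide_sector 1\<close> stays below height \<open>1\<close>; the singularity at
  \<open>0\<close> is removable by \<open>psi_tendsto\<close>.\<close>

lemma psi_holomorphic: "psi holomorphic_on wide_sector 1"
proof (rule no_isolated_singularity'[where K = "{0}"])
  show "(psi \<longlongrightarrow> psi z) (at z within wide_sector 1)" if "z \<in> {0}" for z
    using psi_tendsto that by (auto simp: psi_def intro: tendsto_within_subset)
  have ne: "exp t \<noteq> 1" if t: "t \<in> wide_sector 1 - {0}" for t :: complex
    using exp_eq_1_nonzero[of t] t pi_gt3 by (auto simp: wide_sector_def)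
  have "(\<lambda>t. 1 / (exp t - 1) - 1 / t) holomorphic_on wide_sector 1 - {0}"
    by (intro holomorphic_intros) (use ne in auto)
  then show "psi holomorphic_on wide_sector 1 - {0}"
    by (rule holomorphic_transform) (auto simp: psi_def)
qed (auto simp: open_wide_sector)

lemma psi_bound:
  obtains C where "\<And>t. t \<in> wide_sector (1/2) \<Longrightarrow> norm (psi t) * (1 + norm t) \<le> C"
proof (rule wide_sector_bound[of psi "1/2" 2])
  show "psi holomorphic_on wide_sector (2 * (1/2))" using psi_holomorphic by simp
  fix t :: complex assume t: "1 \<le> Re t"
  then have t0: "t \<noteq> 0" by auto
  have "Re t \<le> exp (Re t) - 1" using exp_ge_add_one_self[of "Re t"] by linarith
  also have "\<dots> \<le> norm (exp t - 1)" using norm_triangle_ineq2[of "exp t" 1] by simp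
  finally have "norm (1 / (exp t - 1)) \<le> 1 / Re t" using t by (simp add: norm_divide frac_le)
  moreover have "norm (1 / t) \<le> 1 / Re t"
    using t complex_Re_le_cmod[of t] by (simp add: norm_divide frac_le)
  ultimately show "norm (psi t) \<le> 2 / Re t"
    using norm_triangle_ineq4[of "1 / (exp t - 1)" "1 / t"] t0 by (simp add: psi_def)
qed auto

section \<open>\<open>psi\<close> on the positive axis and the constant
  \<open>- ln p / 2\<close>\<close>

definition rpsi :: "real \<Rightarrow> real" where
  "rpsi x = 1 / (exp x - 1) - 1 / x"

lemma psi_of_real: "x \<noteq> 0 \<Longrightarrow> psi (of_real x) = of_real (rpsi x)"
  by (simp add: psi_def rpsi_def exp_of_real)

lemma rpsi_tendsto: "(rpsi \<longlongrightarrow> - 1/2) (at_right 0)"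
  unfolding rpsi_def by real_asymp

lemma rpsi_nonpos:
  assumes "0 < x"
  shows "rpsi x \<le> 0"
proof -
  have "1 / (exp x - 1) \<le> 1 / x"
  proof (rule divide_left_mono)
    show "x \<le> exp x - 1" using exp_ge_add_one_self[of x] by linarith
    then show "0 < (exp x - 1) * x" using assms by (intro mult_pos_pos) auto
  qed simp
  then show ?thesis by (simp add: rpsi_def)
qed

lemma rpsi_lower: "0 < x \<Longrightarrow> - 1 / x \<le> rpsi x"
  by (simp add: rpsi_def)

text \<open>The derivative is \<open>1 / u^2 - 1 / (2 sinh (u / 2))^2\<close>, nonnegative because
  \<open>sinh (u / 2) >= u / 2\<close>.\<close>

lemma rpsi_mono:
  assumes "0 < x" "x \<le> y"
  shows "rpsi x \<le> rpsi y"
proof (rule DERIV_nonneg_imp_nondecreasing[OF assms(2)])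
  fix u assume "x \<le> u" "u \<le> y"
  with assms have u: "0 < u" by simp
  have e: "0 < exp u - 1" using u by simp
  have "u / 2 \<le> (exp (u / 2) - inverse (exp (u / 2))) / 2" using real_le_x_sinh[of "u / 2"] u by simp
  then have "u * exp (u / 2) \<le> (exp (u / 2) - inverse (exp (u / 2))) * exp (u / 2)"
    by (intro mult_right_mono) auto
  also have "\<dots> = exp u - 1" by (simp add: left_diff_distrib flip: exp_add)
  finally have "(u * exp (u / 2))^2 \<le> (exp u - 1)^2" using u by (intro power_mono) auto
  then have "u^2 * exp u \<le> (exp u - 1)^2" by (simp add: power_mult_distrib flip: exp_double)
  then have "exp u / (exp u - 1)^2 \<le> 1 / u^2" using u e by (simp add: field_simps)
  moreover have "(rpsi has_real_derivative (- exp u / (exp u - 1)^2 + 1 / u^2)) (at u)"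
    unfolding rpsi_def using u e
    by (auto intro!: derivative_eq_intros simp: power2_eq_square)
  ultimately show "\<exists>y. (rpsi has_real_derivative y) (at u) \<and> 0 \<le> y" by force
qed

text \<open>The partial sums are \<open>harm n - harm (n div p)\<close>: the Euler-Mascheroni
  constants cancel and \<open>ln (n / (n div p))\<close> remains. These coefficients arise when the
  terms with arguments \<open>m x\<close> and \<open>p m x\<close> of a dilation sum are collected
  by argument.\<close>

lemma harm_sums_ln:
  assumes p: "2 \<le> p"
  shows "(\<lambda>m. (if p dvd Suc m then 1 - real p else 1) / real (Suc m)) sums ln (real p)"
proof -
  have part: "(\<Sum>m<n. (if p dvd Suc m then 1 - real p else 1) / real (Suc m)) = harm n - harm (n div p)" for n
  proof (induction n)
    case (Suc n)
    show ?case
    proof (cases "p dvd Suc n")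
      case True
      then obtain k where k: "Suc n = p * k" by blast
      then have k0: "k > 0" by (cases k) auto
      have d: "Suc n div p = Suc (n div p)" using True p by (simp add: div_Suc dvd_eq_mod_eq_0)
      moreover have "Suc n div p = k" using k p by simp
      ultimately have "Suc (n div p) = k" by simp
      moreover have "(harm (Suc (n div p)) :: real) = harm (n div p) + 1 / real (Suc (n div p))"
        by (simp add: harm_Suc inverse_eq_divide del: of_nat_Suc)
      ultimately have "(harm (Suc n div p) :: real) = harm (n div p) + 1 / real k" using d by simp
      moreover have "real p / real (Suc n) = 1 / real k" using k p k0 by (simp only: k) simp
      ultimately show ?thesis using True Suc.IH
        by (simp add: harm_Suc diff_divide_distrib inverse_eq_divide del: of_nat_Suc)
    next
      case False
      then have "Suc n div p = n div p" using p by (simp add: div_Suc dvd_eq_mod_eq_0)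
      then show ?thesis using False Suc.IH by (simp add: harm_Suc inverse_eq_divide)
    qed
  qed (simp add: harm_def)
  have fl: "filterlim (\<lambda>n. n div p) at_top sequentially"
    unfolding filterlim_at_top
  proof
    fix Z :: nat
    show "\<forall>\<^sub>F n in sequentially. Z \<le> n div p"
      using p by (auto simp: eventually_sequentially less_eq_div_iff_mult_less_eq intro!: exI[of _ "Z * p"])
  qed
  have g: "(\<lambda>n. harm n - ln (real n)) \<longlonglongrightarrow> (euler_mascheroni :: real)" by (rule euler_mascheroni_LIMSEQ)
  have g': "(\<lambda>n. harm (n div p) - ln (real (n div p))) \<longlonglongrightarrow> (euler_mascheroni :: real)"
    by (rule filterlim_compose[OF g fl])
  have "(\<lambda>n. ln (real n) - ln (of_int \<lfloor>real n / real p\<rfloor>)) \<longlonglongrightarrow> - ln (inverse (real p))"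
    using p by real_asymp
  then have l: "(\<lambda>n. ln (real n) - ln (real (n div p))) \<longlonglongrightarrow> ln (real p)"
    using p by (simp add: floor_divide_of_nat_eq ln_inverse)
  have "(\<lambda>n. (harm n - ln (real n)) - (harm (n div p) - ln (real (n div p))) + (ln (real n) - ln (real (n div p))))
      \<longlonglongrightarrow> euler_mascheroni - euler_mascheroni + ln (real p)"
    by (intro tendsto_intros g g' l)
  then show ?thesis unfolding sums_def part by (simp add: algebra_simps)
qed

lemma rpsi_sum_summable:
  assumes "0 < x"
  shows "summable (\<lambda>m. rpsi (real (Suc m) * x) / real (Suc m))"
proof (rule summable_comparison_test')
  show "summable (\<lambda>j. 1 / x * (1 / (real (Suc j))^2))"
    by (intro summable_mult summable_inverse_Suc_square)
  fix m :: nat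
  have "\<bar>rpsi (real (Suc m) * x)\<bar> \<le> 1 / (real (Suc m) * x)"
    using rpsi_lower[of "real (Suc m) * x"] rpsi_nonpos[of "real (Suc m) * x"] assms by simp
  from divide_right_mono[OF this, of "real (Suc m)"]
  show "norm (rpsi (real (Suc m) * x) / real (Suc m)) \<le> 1 / x * (1 / (real (Suc m))^2)"
    by (simp add: power2_eq_square mult_ac del: of_nat_Suc)
qed

text \<open>With \<open>m = p j\<close>, the term \<open>rpsi (p j x) / j\<close> equals
  \<open>p rpsi (m x) / m\<close>; collecting by argument gives \<open>rpsi (m x)\<close> the
  coefficients of \<open>harm_sums_ln\<close>. Then \<open>abel_regular\<close> applies to
  \<open>- rpsi\<close>, which decreases from the limit \<open>1/2\<close>.\<close>

lemma rpsi_difference_limit: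
  assumes p: "2 \<le> p"
  shows "((\<lambda>x. dilation_sum (\<lambda>t. psi t - psi (of_nat p * t)) (of_real x)) \<longlongrightarrow> of_real (- ln (real p) / 2)) (at_right 0)"
proof -
  define a where "a m = (if p dvd Suc m then 1 - real p else 1) / real (Suc m)" for m
  have a: "a sums ln (real p)" using harm_sums_ln[OF p] unfolding a_def .
  have sums: "(\<lambda>m. a m * rpsi (real (Suc m) * x)) sums
      (\<Sum>m. (rpsi (real (Suc m) * x) - rpsi (real p * (real (Suc m) * x))) / real (Suc m))" if x: "0 < x" for x
  proof -
    \<comment> \<open>\<open>f\<close> spreads the second series over the multiples of
      \<open>p\<close>. As index \<open>m\<close> stands for \<open>Suc m\<close>, the multiple
      \<open>p * Suc j\<close> sits at \<open>g j = p * Suc j - 1\<close>.\<close>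
    define f where "f m = (if p dvd Suc m then real p * rpsi (real (Suc m) * x) / real (Suc m) else 0)" for m
    define g where "g j = p * Suc j - 1" for j
    have g: "Suc (g j) = p * Suc j" for j using p by (simp add: g_def)
    have "strict_mono g"
      unfolding strict_mono_Suc_iff using p by (auto simp: g_def)
    moreover have "f n = 0" if n: "n \<notin> range g" for n
    proof -
      have "\<not> p dvd Suc n"
      proof
        assume "p dvd Suc n"
        then obtain k where k: "Suc n = p * k" by blast
        then obtain j where "k = Suc j" by (cases k) auto
        then have "n = g j" using k by (simp add: g_def)
        then show False using n by blast
      qed
      then show ?thesis by (simp add: f_def)
    qed
    ultimately have iff: "(\<lambda>n. f (g n)) sums c \<longleftrightarrow> f sums c" for c by (rule sums_mono_reindex)
    have fg: "f (g n) = rpsi (real (Suc n) * (real p * x)) / real (Suc n)" for n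
      using p by (simp add: f_def g mult_ac del: of_nat_Suc mult_Suc_right)
    have 1: "(\<lambda>m. rpsi (real (Suc m) * x) / real (Suc m)) sums (\<Sum>m. rpsi (real (Suc m) * x) / real (Suc m))"
      using rpsi_sum_summable[OF x] by (rule summable_sums)
    have "summable (\<lambda>m. rpsi (real (Suc m) * (real p * x)) / real (Suc m))"
      using rpsi_sum_summable[of "real p * x"] x p by simp
    then have 2: "(\<lambda>m. rpsi (real (Suc m) * (real p * x)) / real (Suc m)) sums (\<Sum>m. rpsi (real (Suc m) * (real p * x)) / real (Suc m))"
      by (rule summable_sums)
    then have 3: "f sums (\<Sum>m. rpsi (real (Suc m) * (real p * x)) / real (Suc m))"
      using iff fg by simp
    have "(\<lambda>m. rpsi (real (Suc m) * x) / real (Suc m) - f m) = (\<lambda>m. a m * rpsi (real (Suc m) * x))"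
      by (auto simp: fun_eq_iff a_def f_def diff_divide_distrib left_diff_distrib)
    with sums_diff[OF 1 3] have "(\<lambda>m. a m * rpsi (real (Suc m) * x)) sums
       ((\<Sum>m. rpsi (real (Suc m) * x) / real (Suc m)) - (\<Sum>m. rpsi (real (Suc m) * (real p * x)) / real (Suc m)))"
      by simp
    moreover have "(\<lambda>m. rpsi (real (Suc m) * x) / real (Suc m) - rpsi (real (Suc m) * (real p * x)) / real (Suc m)) sums
       ((\<Sum>m. rpsi (real (Suc m) * x) / real (Suc m)) - (\<Sum>m. rpsi (real (Suc m) * (real p * x)) / real (Suc m)))"
      using sums_diff[OF 1 2] .
    ultimately show ?thesis by (simp add: sums_iff diff_divide_distrib mult.left_commute)
  qed
  have "((\<lambda>x. \<Sum>m. a m * (- rpsi (real (Suc m) * x))) \<longlongrightarrow> 1/2 * ln (real p)) (at_right 0)"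
  proof (rule abel_regular[OF a])
    show "((\<lambda>u. - rpsi u) \<longlongrightarrow> 1/2) (at_right 0)" using tendsto_minus[OF rpsi_tendsto] by simp
    show "summable (\<lambda>m. a m * - rpsi (real (Suc m) * x))" if "0 < x" for x
      using summable_minus[OF sums_summable[OF sums[OF that]]] by simp
  qed (auto intro: rpsi_mono rpsi_nonpos)
  then have "((\<lambda>x. of_real (- (\<Sum>m. a m * (- rpsi (real (Suc m) * x)))) :: complex) \<longlongrightarrow> of_real (- (1/2 * ln (real p)))) (at_right 0)"
    by (intro tendsto_of_real tendsto_minus)
  moreover have "\<forall>\<^sub>F x in at_right 0. of_real (- (\<Sum>m. a m * (- rpsi (real (Suc m) * x)))) =
      dilation_sum (\<lambda>t. psi t - psi (of_nat p * t)) (of_real x)"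
    using eventually_at_right_less[of "0::real"]
  proof eventually_elim
    case (elim x)
    have "- (\<Sum>m. a m * (- rpsi (real (Suc m) * x))) = (\<Sum>m. a m * rpsi (real (Suc m) * x))"
      using suminf_minus[OF sums_summable[OF sums[OF elim]]] by simp
    also have "\<dots> = (\<Sum>m. (rpsi (real (Suc m) * x) - rpsi (real p * (real (Suc m) * x))) / real (Suc m))"
      using sums[OF elim] by (simp add: sums_iff)
    finally have "of_real (- (\<Sum>m. a m * (- rpsi (real (Suc m) * x)))) =
        (of_real (\<Sum>m. (rpsi (real (Suc m) * x) - rpsi (real p * (real (Suc m) * x))) / real (Suc m)) :: complex)" by simp
    also have "\<dots> = (\<Sum>m. of_real ((rpsi (real (Suc m) * x) - rpsi (real p * (real (Suc m) * x))) / real (Suc m)))"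
    proof (rule suminf_of_real)
      have "summable (\<lambda>m. rpsi (real (Suc m) * (real p * x)) / real (Suc m))"
        using rpsi_sum_summable[of "real p * x"] elim p by simp
      from summable_diff[OF rpsi_sum_summable[OF elim] this]
      show "summable (\<lambda>m. (rpsi (real (Suc m) * x) - rpsi (real p * (real (Suc m) * x))) / real (Suc m))"
        by (simp add: diff_divide_distrib mult.left_commute)
    qed
    also have "\<dots> = dilation_sum (\<lambda>t. psi t - psi (of_nat p * t)) (of_real x)"
      unfolding dilation_sum_def
    proof (rule suminf_cong)
      fix m
      have "psi (of_nat (Suc m) * of_real x) = of_real (rpsi (real (Suc m) * x))"
        using psi_of_real[of "real (Suc m) * x"] elim by simp
      moreover have "psi (of_nat p * (of_nat (Suc m) * of_real x)) = of_real (rpsi (real p * (real (Suc m) * x)))"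
        using psi_of_real[of "real p * (real (Suc m) * x)"] elim p by simp
      ultimately show "of_real ((rpsi (real (Suc m) * x) - rpsi (real p * (real (Suc m) * x))) / real (Suc m)) =
        (psi (of_nat (Suc m) * of_real x) - psi (of_nat p * (of_nat (Suc m) * of_real x))) / of_nat (Suc m)"
        by simp
    qed
    finally show ?case .
  qed
  ultimately show ?thesis by (auto intro: Lim_transform_eventually)
qed

lemma even_part_asymptotics:
  assumes p: "2 \<le> p"
  obtains K where "0 \<le> K" "\<And>t. t \<in> sector \<Longrightarrow> t \<noteq> 0 \<Longrightarrow>
    norm (dilation_sum (\<lambda>t. psi t - psi (of_nat p * t)) t - of_real (- ln (real p) / 2)) \<le> K * (norm t + 1) * norm t"
    and "\<And>t. t \<in> sector \<Longrightarrow> t \<noteq> 0 \<Longrightarrow>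
      summable (\<lambda>j. norm ((psi (of_nat (Suc j) * t) - psi (of_nat p * (of_nat (Suc j) * t))) / of_nat (Suc j)))"
proof -
  let ?h = "\<lambda>t. psi t - psi (of_nat p * t)"
  \<comment> \<open>Small enough for \<open>of_nat p * t\<close> to stay in
    \<open>wide_sector (1/2)\<close>, where \<open>psi_bound\<close> holds.\<close>
  let ?d = "1 / (2 * real p)"
  have d: "0 < ?d" using p by simp
  have sub: "t \<in> wide_sector (1/2)" "of_nat p * t \<in> wide_sector (1/2)" if "t \<in> wide_sector ?d" for t
  proof -
    have t: "\<bar>Im t\<bar> < 5 * Re t + ?d" using that by (simp add: wide_sector_def)
    moreover have "?d \<le> 1/2" using p by simp
    ultimately show "t \<in> wide_sector (1/2)" by (simp add: wide_sector_def)
    have "real p * \<bar>Im t\<bar> < real p * (5 * Re t + ?d)" using t p by simp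
    also have "\<dots> = 5 * (real p * Re t) + 1/2" using p by (simp add: field_simps)
    finally show "of_nat p * t \<in> wide_sector (1/2)" by (simp add: wide_sector_def abs_mult)
  qed
  have half: "wide_sector (1/2) \<subseteq> wide_sector 1" by (auto simp: wide_sector_def)
  have hol: "?h holomorphic_on wide_sector ?d"
  proof (intro holomorphic_intros)
    show "psi holomorphic_on wide_sector ?d"
      using psi_holomorphic by (rule holomorphic_on_subset) (use sub half in blast)
    have "(psi \<circ> (\<lambda>t. of_nat p * t)) holomorphic_on wide_sector ?d"
      by (rule holomorphic_on_compose_gen[OF _ psi_holomorphic]) (use sub half in \<open>auto intro!: holomorphic_intros\<close>)
    then show "(\<lambda>t. psi (of_nat p * t)) holomorphic_on wide_sector ?d" by (simp add: o_def)
  qed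
  obtain C where C: "\<And>t. t \<in> wide_sector (1/2) \<Longrightarrow> norm (psi t) * (1 + norm t) \<le> C"
    using psi_bound by blast
  have B: "norm (?h t) * (1 + norm t) \<le> C + C" if t: "t \<in> wide_sector ?d" for t
  proof -
    have "norm t \<le> norm (of_nat p * t)" using p by (simp add: norm_mult mult_le_cancel_right1)
    then have "norm (psi (of_nat p * t)) * (1 + norm t) \<le> norm (psi (of_nat p * t)) * (1 + norm (of_nat p * t))"
      by (intro mult_left_mono) auto
    also have "\<dots> \<le> C" by (rule C) (use sub t in blast)
    finally have 1: "norm (psi (of_nat p * t)) * (1 + norm t) \<le> C" .
    have "norm (?h t) * (1 + norm t) \<le> (norm (psi t) + norm (psi (of_nat p * t))) * (1 + norm t)"
      by (intro mult_right_mono norm_triangle_ineq4) auto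
    also have "\<dots> \<le> C + C" using 1 C[of t] sub t by (simp add: distrib_right)
    finally show ?thesis .
  qed
  have Bs: "norm (?h t) * (1 + norm t) \<le> C + C" if "t \<in> sector" for t
    using B sector_subset_wide[OF d] that by blast
  obtain K where "0 \<le> K" "\<And>t. t \<in> sector \<Longrightarrow> t \<noteq> 0 \<Longrightarrow>
    norm (dilation_sum ?h t - of_real (- ln (real p) / 2)) \<le> K * (norm t + 1) * norm t"
    using dilation_sum_limit[OF hol d _ B rpsi_difference_limit[OF p]] by (auto simp: psi_def)
  then show ?thesis
    by (rule that) (use dilation_sum_summable[OF Bs] in auto)
qed

section \<open>The quadratic character and its Gauss sum\<close>

text \<open>Jordan's inequality, with the argument scaled to the unit interval: the sine is concave
  there and lies above its chord.\<close>

lemma sin_half_pi_ge: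
  fixes s :: real
  assumes "0 \<le> s" "s \<le> 1"
  shows "s \<le> sin (pi * s / 2)"
proof -
  have "convex_on {0..1} (\<lambda>u::real. - sin (pi * u / 2))"
  proof (rule f''_ge0_imp_convex)
    fix u :: real assume u: "u \<in> {0..1}"
    show "((\<lambda>u. - sin (pi * u / 2)) has_real_derivative (- (pi / 2 * cos (pi * u / 2)))) (at u)"
      by (auto intro!: derivative_eq_intros)
    show "((\<lambda>u. - (pi / 2 * cos (pi * u / 2))) has_real_derivative ((pi / 2)^2 * sin (pi * u / 2))) (at u)"
      by (auto intro!: derivative_eq_intros simp: power2_eq_square)
    have "pi * u / 2 \<le> pi" using u by (simp add: mult_le_cancel_left1)
    then show "0 \<le> (pi / 2)^2 * sin (pi * u / 2)" using u by (intro mult_nonneg_nonneg sin_ge_zero) auto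
  qed auto
  from convex_onD[OF this, of s 0 1] assms show ?thesis by simp
qed

lemma cos_half_pi_ge:
  fixes s :: real
  assumes "0 \<le> s" "s \<le> 1"
  shows "1 - s \<le> cos (pi * s / 2)"
proof -
  have "sin (pi * (1 - s) / 2) = cos (pi * s / 2)"
    by (simp add: cos_sin_eq algebra_simps diff_divide_distrib)
  then show ?thesis using sin_half_pi_ge[of "1 - s"] assms by simp
qed

lemma sum_mult_reindex_mod:
  fixes f :: "nat \<Rightarrow> 'a::comm_monoid_add"
  assumes "coprime h p" and "0 < p"
  shows "(\<Sum>a<p. f (a * h mod p)) = (\<Sum>a<p. f a)"
proof (rule sum.reindex_bij_betw)
  have inj: "inj_on (\<lambda>a. a * h mod p) {..<p}"
  proof (rule inj_onI)
    fix a b assume ab: "a \<in> {..<p}" "b \<in> {..<p}" "a * h mod p = b * h mod p"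
    then have "[a = b] (mod p)" using assms(1) by (metis cong_def cong_mult_rcancel_nat)
    then show "a = b" using ab by (simp add: cong_def)
  qed
  moreover have "(\<lambda>a. a * h mod p) ` {..<p} \<subseteq> {..<p}" using assms by auto
  ultimately show "bij_betw (\<lambda>a. a * h mod p) {..<p} {..<p}"
    by (simp add: bij_betw_def endo_inj_surj)
qed

lemma sum_split_parity:
  fixes f :: "nat \<Rightarrow> 'a::comm_monoid_add"
  shows "(\<Sum>m=1..2*q+1. f m) = (\<Sum>r=1..q. f (2 * r)) + (\<Sum>r\<le>q. f (2 * r + 1))"
  by (induction q) (simp_all add: add_ac)

lemma sum_symmetric_odd:
  fixes g :: "nat \<Rightarrow> 'a::comm_ring_1"
  assumes "\<And>r. 1 \<le> r \<Longrightarrow> r \<le> q \<Longrightarrow> g (2 * q + 1 - r) = g r"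
  shows "(\<Sum>r<2*q+1. g r) = g 0 + 2 * (\<Sum>r=1..q. g r)"
proof -
  have "{..<2*q+1} = insert 0 ({1..q} \<union> {q+1..2*q})" by auto
  then have "(\<Sum>r<2*q+1. g r) = g 0 + ((\<Sum>r=1..q. g r) + (\<Sum>r=q+1..2*q. g r))"
    by (simp add: sum.union_disjoint)
  also have "(\<Sum>r=q+1..2*q. g r) = (\<Sum>r=1..q. g (2 * q + 1 - r))"
    by (rule sum.reindex_bij_witness[of _ "\<lambda>r. 2*q+1-r" "\<lambda>r. 2*q+1-r"]) auto
  also have "\<dots> = (\<Sum>r=1..q. g r)" using assms by (intro sum.cong) auto
  finally show ?thesis by simp
qed

locale prime_1_mod_4 =
  fixes p :: nat
  assumes prime_p: "prime p" and p_mod_4: "[p = 1] (mod 4)" and p_ne_5: "p \<noteq> 5"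
begin

lemma p_ge_13: "13 \<le> p"
proof (rule ccontr)
  assume "\<not> 13 \<le> p"
  moreover have "p mod 4 = 1" using p_mod_4 by (simp add: cong_def)
  ultimately have "p \<in> {1, 5, 9}" by (auto, presburger)
  moreover have "\<not> prime (9::nat)"
  proof
    assume "prime (9::nat)"
    moreover have "(3::nat) dvd 9" by simp
    ultimately have "(3::nat) = 1 \<or> (3::nat) = 9" unfolding prime_nat_iff by blast
    then show False by simp
  qed
  ultimately show False using prime_p p_ne_5 by auto
qed

lemma p_pos: "0 < p"
  using p_ge_13 by simp

lemma p_eq: obtains k where "p = 4 * k + 1" "3 \<le> k"
proof -
  have "p mod 4 = 1" using p_mod_4 by (simp add: cong_def)
  then have "p = 4 * (p div 4) + 1" by (metis mult_div_mod_eq)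
  then show ?thesis using that[of "p div 4"] p_ge_13 by simp
qed

abbreviation chi :: "nat \<Rightarrow> int" where
  "chi \<equiv> legendre_char p"

lemma chi_mod: "chi (n mod p) = chi n"
proof -
  have "[int (n mod p) = int n] (mod int p)" by (simp add: cong_def zmod_int)
  then have "[int (n mod p) = a] (mod int p) \<longleftrightarrow> [int n = a] (mod int p)"
    "[a = int (n mod p)] (mod int p) \<longleftrightarrow> [a = int n] (mod int p)" for a
    by (auto simp: cong_def)
  then show ?thesis by (simp add: legendre_char_def Legendre_def QuadRes_def)
qed

lemma chi_cong: "[m = n] (mod p) \<Longrightarrow> chi m = chi n"
  by (metis chi_mod cong_def)

lemma chi_zero_iff: "chi n = 0 \<longleftrightarrow> p dvd n"
  by (simp add: legendre_char_def Legendre_def cong_0_iff)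

lemma chi_values: "chi n \<in> {-1, 0, 1}"
  by (simp add: legendre_char_def Legendre_def)

lemma abs_chi_le: "\<bar>chi n\<bar> \<le> 1"
  using chi_values[of n] by auto

lemma chi_square: "chi n * chi n = (if p dvd n then 0 else 1)"
  using chi_values[of n] chi_zero_iff[of n] by auto

lemma chi_euler: "[chi n = int n ^ ((p - 1) div 2)] (mod int p)"
  unfolding legendre_char_def using euler_criterion[of p "int n"] prime_p p_ge_13 by simp

text \<open>Both values lie in \<open>{-1, 0, 1}\<close> and differ by at most \<open>2 < p\<close>,
  so congruences obtained from Euler's criterion are equalities.\<close>

lemma chi_eqI:
  assumes "[chi m = c] (mod int p)" "c \<in> {-1, 0, 1}"
  shows "chi m = c"
proof -
  have "int p dvd chi m - c" using assms(1) by (simp add: cong_iff_dvd_diff)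
  moreover have "\<bar>chi m - c\<bar> < int p" using abs_chi_le[of m] assms(2) p_ge_13 by auto
  ultimately show ?thesis using zdvd_imp_le[of "int p" "\<bar>chi m - c\<bar>"] by fastforce
qed

lemma chi_mult: "chi (m * n) = chi m * chi n"
proof (rule chi_eqI)
  have "[chi (m * n) = int m ^ ((p - 1) div 2) * int n ^ ((p - 1) div 2)] (mod int p)"
    using chi_euler[of "m * n"] by (simp add: power_mult_distrib)
  moreover have "[chi m * chi n = int m ^ ((p - 1) div 2) * int n ^ ((p - 1) div 2)] (mod int p)"
    by (intro cong_mult chi_euler)
  ultimately show "[chi (m * n) = chi m * chi n] (mod int p)" using cong_sym cong_trans by blast
  show "chi m * chi n \<in> {-1, 0, 1}" using chi_values[of m] chi_values[of n] by auto
qed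

text \<open>\<open>- 1\<close> is a quadratic residue because the Euler exponent
  \<open>(p - 1) div 2 = 2 * k\<close> is even. That \<open>chi\<close> is an even character is
  behind the vanishing first moment, \<open>g1 0 = 0\<close> and the real Gauss sum.\<close>

lemma chi_minus:
  assumes "n \<le> p"
  shows "chi (p - n) = chi n"
proof (rule chi_eqI)
  obtain k where k: "p = 4 * k + 1" by (rule p_eq)
  then have e: "(p - 1) div 2 = 2 * k" by simp
  have "[int (p - n) = - int n] (mod int p)"
    using assms by (simp add: of_nat_diff cong_iff_dvd_diff)
  then have "[int (p - n) ^ ((p - 1) div 2) = (- int n) ^ ((p - 1) div 2)] (mod int p)" by (rule cong_pow)
  also have "(- int n) ^ ((p - 1) div 2) = int n ^ ((p - 1) div 2)" unfolding e by simp
  finally show "[chi (p - n) = chi n] (mod int p)"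
    using chi_euler[of "p - n"] chi_euler[of n] cong_sym cong_trans by blast
  show "chi n \<in> {-1, 0, 1}" by (rule chi_values)
qed

lemma chi_0: "chi 0 = 0" and chi_1: "chi (Suc 0) = 1"
proof -
  show "chi 0 = 0" by (simp add: chi_zero_iff)
  have "QuadRes (int p) 1" unfolding QuadRes_def by (rule exI[of _ 1]) simp
  then show "chi (Suc 0) = 1" using p_ge_13 by (auto simp: legendre_char_def Legendre_def cong_0_iff)
qed

text \<open>Gauss's lemma: of the doubles of \<open>1, ..., 2 k\<close> exactly those of
  \<open>k + 1, ..., 2 k\<close> exceed \<open>(p - 1) / 2 = 2 k\<close>, which gives
  \<open>(-1)^k\<close>; and \<open>k\<close> is even exactly for
  \<open>p mod 8 = 1\<close>.\<close>

lemma chi_2: "chi 2 = (if p mod 8 = 1 then 1 else -1)"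
proof -
  obtain k where k: "p = 4 * k + 1" "3 \<le> k" by (rule p_eq)
  interpret G: GAUSS p 2
    using prime_p p_ge_13 by unfold_locales (auto simp: cong_0_iff zdvd_not_zless)
  have h: "(int p - 1) div 2 = 2 * int k" using k by simp
  have "G.E = (\<lambda>x. 2 * x) ` {int k<..2 * int k}"
  proof (intro equalityI subsetI)
    fix y assume "y \<in> G.E"
    then obtain x where x: "0 < x" "x \<le> 2 * int k" "y = (x * 2) mod int p" "2 * int k < y"
      by (auto simp: G.E_def G.C_def G.B_def G.A_def h)
    then have "y = 2 * x" using k by simp
    then show "y \<in> (\<lambda>x. 2 * x) ` {int k<..2 * int k}" using x by (intro image_eqI[of _ _ x]) auto
  next
    fix y assume "y \<in> (\<lambda>x. 2 * x) ` {int k<..2 * int k}"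
    then obtain x where x: "int k < x" "x \<le> 2 * int k" "y = 2 * x" by auto
    have "y = (x * 2) mod int p" using x k by simp
    then show "y \<in> G.E" using x by (auto simp: G.E_def G.C_def G.B_def G.A_def h)
  qed
  then have "card G.E = card {int k<..2 * int k}" by (simp add: card_image inj_on_def)
  then have "card G.E = k" by simp
  then have "chi 2 = (-1) ^ k" using G.gauss_lemma by (simp add: legendre_char_def)
  moreover have "p mod 8 = 1 \<longleftrightarrow> even k" using k by presburger
  ultimately show ?thesis by auto
qed

text \<open>The number of square roots of \<open>a\<close> modulo \<open>p\<close> is
  \<open>1 + chi a\<close>; the sum over \<open>m\<close> is grouped by the residue of
  \<open>m * m\<close>.\<close>

lemma sum_squares_mod:
  fixes f :: "nat \<Rightarrow> 'a::comm_ring_1"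
  shows "(\<Sum>m<p. f (m * m mod p)) = (\<Sum>a<p. (1 + of_int (chi a)) * f a)"
proof -
  have roots: "int (card {m\<in>{..<p}. m * m mod p = a}) = 1 + chi a" if a: "a < p" for a
  proof (cases "\<exists>m<p. m * m mod p = a")
    case False
    have "\<not> QuadRes (int p) (int a)"
    proof
      assume "QuadRes (int p) (int a)"
      then obtain y where y: "[y^2 = int a] (mod int p)" by (auto simp: QuadRes_def)
      define m where "m = nat (y mod int p)"
      have m: "int m = y mod int p" "m < p" using p_pos by (auto simp: m_def nat_less_iff)
      have "int (m * m mod p) = (y * y) mod int p" using m by (simp add: zmod_int mod_mult_eq)
      also have "\<dots> = int a" using y a by (simp add: cong_def power2_eq_square)
      finally have "m * m mod p = a" by simp
      then show False using False m by blast
    qed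
    moreover have "\<not> [int a = 0] (mod int p)"
    proof
      assume "[int a = 0] (mod int p)"
      then have "a = 0" using a by (auto simp: cong_def)
      then show False using False p_pos by auto
    qed
    ultimately have "chi a = -1" by (simp add: legendre_char_def Legendre_def)
    moreover have "{m\<in>{..<p}. m * m mod p = a} = {}" using False by auto
    ultimately show ?thesis by simp
  next
    case True
    then obtain m where m: "m < p" "m * m mod p = a" by blast
    have root_iff: "n * n mod p = a \<longleftrightarrow> n = m \<or> n + m = p \<or> (m = 0 \<and> n = 0)" if n: "n < p" for n
    proof
      assume "n * n mod p = a"
      then have "[int n * int n = int m * int m] (mod int p)"
        using m by (metis cong_def of_nat_mult zmod_int)
      then have "int p dvd (int n - int m) * (int n + int m)"
        by (simp add: cong_iff_dvd_diff algebra_simps)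
      then have "int p dvd int n - int m \<or> int p dvd int n + int m"
        using prime_p by (simp add: prime_dvd_mult_iff)
      then show "n = m \<or> n + m = p \<or> (m = 0 \<and> n = 0)"
      proof
        assume "int p dvd int n - int m"
        then have "[int n = int m] (mod int p)" by (simp add: cong_iff_dvd_diff)
        then show ?thesis using m n by (simp add: cong_def)
      next
        assume "int p dvd int n + int m"
        then have "p dvd n + m" by (metis of_nat_add of_nat_dvd_iff)
        then obtain c where c: "n + m = p * c" by blast
        have "p * c < p * 2" using m n unfolding c[symmetric] by simp
        then have "c < 2" by simp
        then have "c = 0 \<or> c = 1" by auto
        then show ?thesis using c by auto
      qed
    next
      assume "n = m \<or> n + m = p \<or> (m = 0 \<and> n = 0)"
      then show "n * n mod p = a"
      proof (elim disjE)
        assume nm: "n + m = p"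
        then have "[int n = - int m] (mod int p)" by (simp add: cong_iff_dvd_diff flip: of_nat_add)
        then have "[int n * int n = int m * int m] (mod int p)" using cong_mult by fastforce
        then have "int (n * n mod p) = int (m * m mod p)" by (simp add: cong_def zmod_int)
        then show ?thesis using m by simp
      qed (use m in auto)
    qed
    show ?thesis
    proof (cases "m = 0")
      case True
      then have "a = 0" using m by simp
      then have "chi a = 0" by (simp add: chi_0)
      moreover have "{n\<in>{..<p}. n * n mod p = a} = {0}" using root_iff True p_pos by auto
      ultimately show ?thesis by simp
    next
      case False
      have "[int m ^ 2 = int a] (mod int p)" using m by (auto simp: cong_def power2_eq_square zmod_int)
      then have "QuadRes (int p) (int a)" by (auto simp: QuadRes_def)
      moreover have "\<not> [int a = 0] (mod int p)"
      proof
        assume "[int a = 0] (mod int p)"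
        then have "p dvd a" by (simp add: cong_0_iff)
        then have "p dvd m * m" using m by (metis dvd_mod_iff dvd_refl)
        then have "p dvd m" using prime_p by (simp add: prime_dvd_mult_iff)
        then show False using m False by (auto dest: dvd_imp_le)
      qed
      ultimately have "chi a = 1" by (simp add: legendre_char_def Legendre_def)
      moreover have "{n\<in>{..<p}. n * n mod p = a} = {m, p - m}"
      proof (intro equalityI subsetI)
        fix n assume "n \<in> {n\<in>{..<p}. n * n mod p = a}"
        then have "n < p" "n * n mod p = a" by blast+
        then have "n = m \<or> n + m = p" using root_iff[of n] False by blast
        then show "n \<in> {m, p - m}" by auto
      next
        fix n assume "n \<in> {m, p - m}"
        then have "n < p" "n = m \<or> n + m = p" using m(1) False by auto
        then show "n \<in> {n\<in>{..<p}. n * n mod p = a}" using root_iff[of n] by blast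
      qed
      moreover have "m \<noteq> p - m"
      proof
        assume "m = p - m"
        then have "p = 2 * m" using m by simp
        then show False using p_mod_4 by (auto simp: cong_def) presburger
      qed
      ultimately show ?thesis by simp
    qed
  qed
  have "(\<Sum>m<p. f (m * m mod p)) = (\<Sum>a<p. \<Sum>m | m \<in> {..<p} \<and> m * m mod p = a. f (m * m mod p))"
    using p_pos by (intro sum.group[symmetric]) auto
  also have "\<dots> = (\<Sum>a<p. (1 + of_int (chi a)) * f a)"
  proof (rule sum.cong)
    fix a assume "a \<in> {..<p}"
    then have "of_int (int (card {m\<in>{..<p}. m * m mod p = a})) = (1 + of_int (chi a) :: 'a)"
      using roots[of a] by simp
    then have c: "of_nat (card {m\<in>{..<p}. m * m mod p = a}) = (1 + of_int (chi a) :: 'a)" by simp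
    have "(\<Sum>m | m \<in> {..<p} \<and> m * m mod p = a. f (m * m mod p)) = (\<Sum>m | m \<in> {..<p} \<and> m * m mod p = a. f a)"
      by (rule sum.cong) auto
    then show "(\<Sum>m | m \<in> {..<p} \<and> m * m mod p = a. f (m * m mod p)) = (1 + of_int (chi a)) * f a"
      using c by simp
  qed simp
  finally show ?thesis .
qed

lemma sum_chi: "(\<Sum>a<p. chi a) = 0"
proof -
  have "(\<Sum>m<p. (1::int)) = (\<Sum>a<p. (1 + chi a) * 1)"
    using sum_squares_mod[of "\<lambda>_. 1::int"] by simp
  then show ?thesis by (simp add: sum.distrib)
qed

definition zeta :: complex where
  "zeta = cis (2 * pi / real p)"

definition gauss_sum :: complex where
  "gauss_sum = (\<Sum>a<p. of_int (chi a) * zeta ^ a)"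

lemma zeta_power: "zeta ^ a = cis (2 * pi * real a / real p)"
proof -
  have "zeta ^ a = cis (real a * (2 * pi / real p))" unfolding zeta_def by (rule Complex.DeMoivre)
  also have "real a * (2 * pi / real p) = 2 * pi * real a / real p" by simp
  finally show ?thesis .
qed

lemma norm_zeta: "norm (zeta ^ a) = 1"
  by (simp add: zeta_power)

lemma zeta_power_p: "zeta ^ p = 1"
  using p_pos by (simp add: zeta_power)

lemma zeta_mod: "zeta ^ (a mod p) = zeta ^ a"
proof -
  have "zeta ^ a = zeta ^ (p * (a div p) + a mod p)" by simp
  also have "\<dots> = zeta ^ (a mod p)" by (simp only: power_add power_mult zeta_power_p) simp
  finally show ?thesis ..
qed

lemma zeta_eq_1_iff: "zeta ^ a = 1 \<longleftrightarrow> p dvd a"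
proof
  assume "zeta ^ a = 1"
  then have "zeta ^ (a mod p) = 1" by (simp add: zeta_mod)
  then have "cos (2 * pi * (real (a mod p) / real p)) = 1"
    by (simp add: zeta_power complex_eq_iff)
  then obtain n :: int where "2 * pi * (real (a mod p) / real p) = 2 * pi * of_int n"
    by (auto simp: cos_one_2pi_int)
  then have "2 * pi * (real (a mod p) / real p) = 2 * pi * of_int n" by (simp only:)
  then have n: "real (a mod p) / real p = of_int n" by (subst (asm) mult_cancel_left) simp
  have "0 \<le> real (a mod p) / real p" "real (a mod p) / real p < 1"
    using p_pos by auto
  then have "n = 0" unfolding n by linarith
  then show "p dvd a" using n p_pos by auto
next
  assume "p dvd a"
  then show "zeta ^ a = 1" by (auto simp: power_mult zeta_power_p elim!: dvdE)
qed

lemma sum_zeta: "(\<Sum>h<p. zeta ^ (h * a)) = (if p dvd a then of_nat p else 0)"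
proof (cases "p dvd a")
  case True
  then have "zeta ^ (h * a) = 1" for h by (simp add: zeta_eq_1_iff)
  then show ?thesis using True by simp
next
  case False
  have "(\<Sum>h<p. zeta ^ (h * a)) = (\<Sum>h<p. (zeta ^ a) ^ h)"
    by (simp add: power_mult[symmetric] mult.commute)
  also have "\<dots> = 0"
  proof -
    have "(zeta ^ a) ^ p = 1" by (metis mult.commute power_mult power_one zeta_power_p)
    then show ?thesis using False by (simp add: sum_gp_strict zeta_eq_1_iff)
  qed
  finally show ?thesis using False by simp
qed

text \<open>If \<open>p\<close> divides \<open>h\<close>, both sides vanish because the values of
  \<open>chi\<close> add up to \<open>0\<close>. Otherwise substituting \<open>a * h\<close> for
  \<open>a\<close> pulls out \<open>chi h\<close>, whose square is \<open>1\<close>.\<close>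

lemma gauss_sum_twist: "(\<Sum>a<p. of_int (chi a) * zeta ^ (a * h)) = of_int (chi h) * gauss_sum"
proof (cases "p dvd h")
  case True
  then have "(\<Sum>a<p. of_int (chi a) * zeta ^ (a * h)) = (\<Sum>a<p. of_int (chi a))"
    by (intro sum.cong) (auto simp: zeta_eq_1_iff[THEN iffD2])
  also have "\<dots> = of_int (\<Sum>a<p. chi a)" by simp
  finally show ?thesis using True by (simp add: sum_chi chi_zero_iff[THEN iffD2])
next
  case False
  then have cop: "coprime h p" using prime_p by (metis coprime_commute prime_imp_coprime)
  have "gauss_sum = (\<Sum>a<p. of_int (chi (a * h mod p)) * zeta ^ (a * h mod p))"
    unfolding gauss_sum_def
    by (rule sum_mult_reindex_mod[OF cop p_pos, symmetric])
  also have "\<dots> = (\<Sum>a<p. of_int (chi h) * (of_int (chi a) * zeta ^ (a * h)))"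
    by (simp add: chi_mod zeta_mod chi_mult mult_ac)
  finally have "of_int (chi h) * gauss_sum = (of_int (chi h * chi h) :: complex) * (\<Sum>a<p. of_int (chi a) * zeta ^ (a * h))"
    by (simp add: sum_distrib_left mult.assoc)
  then show ?thesis using False by (simp add: chi_square)
qed

text \<open>One factor is expanded by \<open>gauss_sum_twist\<close>; orthogonality of the roots of
  unity then keeps only \<open>a = p - 1\<close>, where \<open>chi (p - 1) = 1\<close>.\<close>

lemma gauss_sum_square: "gauss_sum^2 = of_nat p"
proof -
  have "gauss_sum^2 = (\<Sum>h<p. (of_int (chi h) * gauss_sum) * zeta ^ h)"
    by (simp add: power2_eq_square gauss_sum_def[of] sum_distrib_right mult_ac)
  also have "\<dots> = (\<Sum>h<p. \<Sum>a<p. of_int (chi a) * zeta ^ (h * (a + 1)))"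
    by (simp only: gauss_sum_twist[symmetric] sum_distrib_right mult.assoc power_add[symmetric])
      (simp add: algebra_simps)
  also have "\<dots> = (\<Sum>a<p. of_int (chi a) * (\<Sum>h<p. zeta ^ (h * (a + 1))))"
    by (subst sum.swap) (simp add: sum_distrib_left)
  also have "\<dots> = (\<Sum>a<p. if a = p - 1 then of_nat p else 0)"
  proof (rule sum.cong)
    fix a assume "a \<in> {..<p}"
    then have "p dvd a + 1 \<longleftrightarrow> a = p - 1" using p_pos by (auto dest: dvd_imp_le)
    moreover have "chi (p - 1) = 1" using chi_minus[of 1] chi_1 p_pos by simp
    ultimately show "of_int (chi a) * (\<Sum>h<p. zeta ^ (h * (a + 1))) = (if a = p - 1 then of_nat p else 0)"
      by (simp only: sum_zeta) auto
  qed simp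
  also have "\<dots> = of_nat p" using p_pos by (simp add: sum.delta)
  finally show ?thesis .
qed


section \<open>The sign of the quadratic Gauss sum\<close>

lemma zeta_square_sum: "gauss_sum = (\<Sum>m<p. zeta ^ (m * m))"
proof -
  have "(\<Sum>m<p. zeta ^ (m * m)) = (\<Sum>m<p. zeta ^ (m * m mod p))" by (simp add: zeta_mod)
  also have "\<dots> = (\<Sum>a<p. zeta ^ a) + gauss_sum"
    using sum_squares_mod[of "\<lambda>a. zeta ^ a"] by (simp add: gauss_sum_def distrib_right sum.distrib)
  also have "(\<Sum>a<p. zeta ^ a) = 0" using sum_zeta[of 1] p_ge_13 by simp
  finally show ?thesis by simp
qed

text \<open>In this form of the Gauss sum the phase is stationary only at \<open>m = 0\<close>, so that summation by parts
  controls the terms with \<open>m > sqrt p\<close>.\<close>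
lemma Re_gauss_sum: "Im gauss_sum = 0 \<Longrightarrow> Re gauss_sum = 1 + 2 * (\<Sum>m=1..p. cos (pi * real (m * m) / (2 * real p)))"
proof -
  assume Im0: "Im gauss_sum = 0"
  obtain k where k: "p = 4 * k + 1" by (rule p_eq)
  define q where "q = 2 * k"
  have pq: "p = 2 * q + 1" by (simp add: k q_def)
  define c where "c m = cos (pi * real (m * m) / (2 * real p))" for m
  have "zeta ^ ((p - r) * (p - r)) = zeta ^ (r * r)" if "r \<le> p" for r
  proof -
    have "[int (p - r) = - int r] (mod int p)" using that by (simp add: of_nat_diff cong_iff_dvd_diff)
    from cong_mult[OF this this] have "[int ((p - r) * (p - r)) = int (r * r)] (mod int p)" by simp
    then have "[(p - r) * (p - r) = r * r] (mod p)" by (simp only: cong_int_iff)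
    then show ?thesis by (metis cong_def zeta_mod)
  qed
  then have S: "gauss_sum = 1 + 2 * (\<Sum>r=1..q. zeta ^ (r * r))"
    unfolding zeta_square_sum using sum_symmetric_odd[of q "\<lambda>m. zeta ^ (m * m)"] by (simp add: pq)
  have Reg: "Re gauss_sum = 1 + 2 * (\<Sum>r=1..q. cos (2 * pi * real (r * r) / real p))"
    unfolding S by (simp add: zeta_power)
  have "Im gauss_sum = 2 * (\<Sum>r=1..q. sin (2 * pi * real (r * r) / real p))"
    unfolding S by (simp add: zeta_power)
  then have sin0: "(\<Sum>r=1..q. sin (2 * pi * real (r * r) / real p)) = 0" using Im0 by simp
  have even: "c (2 * r) = cos (2 * pi * real (r * r) / real p)" for r
    by (simp add: c_def mult_ac)
  \<comment> \<open>Here \<open>m = p - 2 r\<close> has the phase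
    \<open>pi p / 2 + 2 pi r^2 / p - 2 pi r\<close>. As \<open>p = 4 k + 1\<close>, the shift is a
    quarter turn modulo full turns, so odd \<open>m\<close> produce sines whose sum is half of
    \<open>Im gauss_sum\<close>, hence \<open>0\<close> up to sign.\<close>
  have odd: "c (2 * (q - r) + 1) = - sin (2 * pi * real (r * r) / real p)" if "r \<le> q" for r
  proof -
    have m: "real (2 * (q - r) + 1) = real p - 2 * real r" using that by (simp add: pq of_nat_diff)
    have "pi * real ((2 * (q - r) + 1) * (2 * (q - r) + 1)) / (2 * real p) = pi * (real p - 2 * real r)^2 / (2 * real p)"
      by (simp only: of_nat_mult m power2_eq_square)
    also have "\<dots> = pi / 2 * real p + (2 * pi * real (r * r) / real p) - 2 * pi * real r"
      using p_pos by (simp add: field_simps power2_eq_square)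
    also have "pi / 2 * real p = pi / 2 + 2 * pi * real k" by (simp add: k algebra_simps)
    finally have "c (2 * (q - r) + 1) = cos (pi / 2 + 2 * pi * real k + (2 * pi * real (r * r) / real p) - 2 * pi * real r)"
      by (simp only: c_def)
    also have "\<dots> = cos (pi / 2 + 2 * pi * real_of_int (int k - int r) + (2 * pi * real (r * r) / real p))"
      by (simp add: algebra_simps)
    also have "\<dots> = - sin (2 * pi * real (r * r) / real p)"
      by (simp only: cos_add sin_add cos_int_2pin sin_int_2pin cos_pi_half sin_pi_half) simp
    finally show ?thesis .
  qed
  have "(\<Sum>m=1..p. c m) = (\<Sum>r=1..q. c (2 * r)) + (\<Sum>r\<le>q. c (2 * r + 1))"
    unfolding pq by (rule sum_split_parity)
  also have "(\<Sum>r\<le>q. c (2 * r + 1)) = (\<Sum>r\<le>q. c (2 * (q - r) + 1))"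
    by (rule sum.reindex_bij_witness[of _ "\<lambda>r. q - r" "\<lambda>r. q - r"]) auto
  also have "\<dots> = (\<Sum>r\<le>q. - sin (2 * pi * real (r * r) / real p))"
    by (intro sum.cong odd) auto
  also have "\<dots> = - (\<Sum>r=1..q. sin (2 * pi * real (r * r) / real p))"
  proof -
    have "{..q} = insert 0 {1..q}" by auto
    then show ?thesis by (simp add: sum_negf)
  qed
  finally have "(\<Sum>m=1..p. c m) = (\<Sum>r=1..q. cos (2 * pi * real (r * r) / real p))"
    by (simp only: even sin0 minus_zero add_0_right)
  then show ?thesis unfolding Reg by (simp only: c_def)
qed

text \<open>Each cosine is a difference \<open>G (Suc m) - G m\<close> of sines divided by
  \<open>2 sin (pi m / (2 p))\<close>. The divisors increase with \<open>m\<close>, so summation by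
  parts bounds the sum by \<open>1 / sin (pi N / (2 p)) <= p / N\<close>, and
  \<open>N > sqrt p\<close>.\<close>

lemma cos_tail:
  assumes N: "0 < N" "real p < real N ^ 2"
  shows "\<bar>\<Sum>m=N..<Suc p. cos (pi * real (m * m) / (2 * real p))\<bar> \<le> sqrt (real p)"
proof (cases "N \<le> p")
  case False
  then show ?thesis by simp
next
  case True
  define G where "G m = sin (pi * (real m * real m - real m) / (2 * real p))" for m
  \<comment> \<open>Clamping the index to \<open>[N, p]\<close> makes \<open>b\<close> positive and
    decreasing for all indices, as \<open>abel_tail_bound\<close> asks.\<close>
  define b where "b i = 1 / (2 * sin (pi * real (min (max i N) p) / (2 * real p)))" for i
  have spos: "0 < sin (pi * real i / (2 * real p))" if "0 < i" "i \<le> p" for i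
    using that p_pos by (intro sin_gt_zero) (auto simp: field_simps intro: less_le_trans)
  have bpos: "0 < sin (pi * real (min (max i N) p) / (2 * real p))" for i
    using N p_pos by (intro spos) auto
  have summand: "cos (pi * real (m * m) / (2 * real p)) = (G (Suc m) - G m) * b m" if m: "N \<le> m" "m \<le> p" for m
  proof -
    let ?A = "pi * real (m * m) / (2 * real p)" and ?B = "pi * real m / (2 * real p)"
    have "pi * (real (Suc m) * real (Suc m) - real (Suc m)) / (2 * real p) = ?A + ?B"
      "pi * (real m * real m - real m) / (2 * real p) = ?A - ?B"
      by (simp_all add: algebra_simps add_divide_distrib diff_divide_distrib)
    then have "G (Suc m) - G m = 2 * cos ?A * sin ?B"
      by (simp only: G_def sin_add sin_diff)
    moreover have "b m = 1 / (2 * sin ?B)" using m by (simp add: b_def)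
    moreover have "sin ?B \<noteq> 0" using spos[of m] m N by simp
    ultimately show ?thesis by simp
  qed
  have "(\<Sum>m=N..<Suc p. cos (pi * real (m * m) / (2 * real p))) = (\<Sum>m=N..<Suc p. (G (Suc m) - G m) * b m)"
    by (intro sum.cong summand) auto
  also have "\<bar>\<dots>\<bar> \<le> 2 * b N"
  proof (rule abel_tail_bound)
    fix k assume "N \<le> k"
    then have "(\<Sum>i=N..<k. G (Suc i) - G i) = G k - G N" by (rule sum_Suc_diff')
    also have "\<bar>\<dots>\<bar> \<le> 1 + 1"
      by (rule order_trans[OF abs_triangle_ineq4]) (intro add_mono, auto simp: G_def)
    finally show "\<bar>\<Sum>i=N..<k. G (Suc i) - G i\<bar> \<le> 2" by simp
  next
    fix i j :: nat assume ij: "i \<le> j"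
    have "sin (pi * real (min (max i N) p) / (2 * real p)) \<le> sin (pi * real (min (max j N) p) / (2 * real p))"
    proof (rule sin_monotone_2pi_le)
      have h: "pi * real (min (max n N) p) / (2 * real p) \<le> pi / 2" for n
        using p_pos by (simp add: field_simps)
      show "pi * real (min (max j N) p) / (2 * real p) \<le> pi / 2" by (rule h)
      have "min (max i N) p \<le> min (max j N) p" using ij by auto
      then show "pi * real (min (max i N) p) / (2 * real p) \<le> pi * real (min (max j N) p) / (2 * real p)"
        by (intro divide_right_mono mult_left_mono) auto
      show "- (pi / 2) \<le> pi * real (min (max i N) p) / (2 * real p)"
        by (rule order_trans[of _ 0]) auto
    qed
    then show "b j \<le> b i" unfolding b_def using bpos by (intro divide_left_mono mult_pos_pos) auto
  next
    show "0 \<le> b i" for i using bpos[of i] by (simp add: b_def)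
  qed
  also have "2 * b N = 1 / sin (pi * (real N / real p) / 2)" using True by (simp add: b_def mult_ac)
  also have "\<dots> \<le> 1 / (real N / real p)"
  proof (rule divide_left_mono)
    show "real N / real p \<le> sin (pi * (real N / real p) / 2)"
      using True p_pos by (intro sin_half_pi_ge) auto
    show "0 < sin (pi * (real N / real p) / 2) * (real N / real p)"
      using spos[of N] True N p_pos by (intro mult_pos_pos) (auto simp: mult_ac)
  qed simp
  also have "\<dots> = real p / real N" by simp
  also have "\<dots> \<le> real p / sqrt (real p)"
  proof (rule divide_left_mono)
    show "sqrt (real p) \<le> real N" using N by (intro real_le_lsqrt) auto
  qed (use p_pos N in auto)
  also have "\<dots> = sqrt (real p)" by (simp add: real_div_sqrt)
  finally show ?thesis .
qed

text \<open>The square being \<open>p\<close>, only the value \<open>- sqrt p\<close> has to be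
  excluded. Terms with \<open>m <= sqrt p\<close> are bounded below by means of
  \<open>cos_half_pi_ge\<close>, the others by \<open>cos_tail\<close>, and together they give
  \<open>Re gauss_sum > - sqrt p\<close>.\<close>

lemma gauss_sum_eq: "gauss_sum = of_real (sqrt (real p))"
proof -
  have sq: "of_real (sqrt (real p)) * of_real (sqrt (real p)) = (of_nat p :: complex)"
    by (metis of_real_mult of_real_of_nat_eq real_sqrt_mult_self abs_of_nat)
  have "(gauss_sum - of_real (sqrt (real p))) * (gauss_sum + of_real (sqrt (real p)))
      = gauss_sum^2 - of_real (sqrt (real p)) * of_real (sqrt (real p))"
    by (simp add: algebra_simps power2_eq_square)
  also have "\<dots> = 0" by (simp add: gauss_sum_square sq)
  finally have cases: "gauss_sum = of_real (sqrt (real p)) \<or> gauss_sum = - of_real (sqrt (real p))"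
    by (simp add: eq_neg_iff_add_eq_0)
  then have "Im gauss_sum = 0" by auto
  from Re_gauss_sum[OF this]
  have Reg: "Re gauss_sum = 1 + 2 * (\<Sum>m=1..p. cos (pi * real (m * m) / (2 * real p)))" .
  define s where "s = sqrt (real p)"
  have s: "s * s = real p" "0 < s" using p_pos by (simp_all add: s_def)
  define K where "K = nat \<lfloor>s\<rfloor>"
  have K: "real K \<le> s" "s < real K + 1" using s by (auto simp: K_def)
  define X where "X = real K * (real K + 1) * (2 * real K + 1) / (6 * real p)"
  have "3 \<le> s"
    unfolding s_def by (rule real_le_rsqrt) (use p_ge_13 in simp)
  then have K3: "3 \<le> K" by (simp add: K_def le_nat_iff le_floor_iff)
  have "s * s < (real K + 1) * (real K + 1)" using K s by (intro mult_strict_mono) auto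
  then have "real p < real ((K + 1) * (K + 1))" using s by (simp add: algebra_simps)
  then have pu: "p < (K + 1) * (K + 1)" by (simp only: of_nat_less_iff)
  have "real K * real K \<le> s * s" using K s by (intro mult_mono) auto
  then have pl: "real K * real K \<le> real p" using s by simp
  have pl': "K * K \<le> p" using pl by (simp only: of_nat_mult[symmetric] of_nat_le_iff)
  have Kp: "K \<le> p" using pl' K3 by (metis le_square order_trans)
  have "(\<Sum>m=1..p. cos (pi * real (m * m) / (2 * real p))) =
      (\<Sum>m=1..<Suc K. cos (pi * real (m * m) / (2 * real p))) + (\<Sum>m=Suc K..<Suc p. cos (pi * real (m * m) / (2 * real p)))"
    using Kp by (subst sum.atLeastLessThan_concat) (auto simp: atLeastLessThanSuc_atLeastAtMost)
  moreover have "\<bar>\<Sum>m=Suc K..<Suc p. cos (pi * real (m * m) / (2 * real p))\<bar> \<le> s"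
    unfolding s_def
  proof (rule cos_tail)
    show "real p < real (Suc K) ^ 2" using \<open>real p < real ((K + 1) * (K + 1))\<close> by (simp add: power2_eq_square algebra_simps)
  qed simp
  moreover have "(\<Sum>m=1..<Suc K. 1 - real (m * m) / real p) \<le> (\<Sum>m=1..<Suc K. cos (pi * real (m * m) / (2 * real p)))"
  proof (rule sum_mono)
    fix m assume m: "m \<in> {1..<Suc K}"
    then have "m * m \<le> K * K" by (intro mult_mono) auto
    then have "m * m \<le> p" using pl' by linarith
    then have "real (m * m) / real p \<le> 1" using p_pos by (simp del: of_nat_mult)
    from cos_half_pi_ge[OF _ this] show "1 - real (m * m) / real p \<le> cos (pi * real (m * m) / (2 * real p))"
      by (simp add: mult_ac)
  qed
  moreover have "(\<Sum>m=1..<Suc n. 1 - real (m * m) / real p) = real n - real n * (real n + 1) * (2 * real n + 1) / (6 * real p)" for n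
  proof (induction n)
    case (Suc n)
    have "(\<Sum>m=1..<Suc (Suc n). 1 - real (m * m) / real p) =
        (\<Sum>m=1..<Suc n. 1 - real (m * m) / real p) + (1 - (real n + 1) * (real n + 1) / real p)" by (simp add: algebra_simps)
    also have "\<dots> = real (Suc n) - real (Suc n) * (real (Suc n) + 1) * (2 * real (Suc n) + 1) / (6 * real p)"
      unfolding Suc.IH using p_pos by (simp add: field_simps)
    finally show ?case .
  qed simp
  ultimately have lower: "Re gauss_sum \<ge> 1 + 2 * (real K - X) - 2 * s"
    using Reg by (simp add: abs_le_iff X_def)
  have "X \<le> real K * (real K + 1) * (2 * real K + 1) / (6 * (real K * real K))"
    unfolding X_def using pl K3 p_pos by (intro divide_left_mono mult_left_mono mult_pos_pos mult_nonneg_nonneg) auto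
  also have "\<dots> = (2 * real K + 3 + 1 / real K) / 6" using K3 by (simp add: field_simps)
  finally have f: "X \<le> (2 * real K + 3 + 1 / real K) / 6" .
  \<comment> \<open>With \<open>2 X <= (2 K + 3 + 1 / K) / 3\<close> this makes
    \<open>1 + 2 (K - X) - 2 s > - s\<close>. For \<open>K >= 4\<close> it follows from
    \<open>s < K + 1\<close>; for \<open>K = 3\<close> the right side is \<open>35/9\<close>, and
    \<open>p < 16\<close> is used.\<close>
  have "s < 4 * real K / 3 - 1 / (3 * real K)"
  proof (cases "K = 3")
    case True
    have "s < 35 / 9"
    proof (rule ccontr)
      assume "\<not> s < 35 / 9"
      then have "35 / 9 * (35 / 9) \<le> s * s" by (intro mult_mono) auto
      then have "15 < real p" using s by simp
      then show False using pu True p_mod_4 by (auto simp: cong_def)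
    qed
    then show ?thesis using True by simp
  next
    case False
    then have K4: "4 \<le> real K" using K3 by simp
    then have "1 / (3 * real K) \<le> 1 / 12" by (intro divide_left_mono) auto
    then show ?thesis using K(2) K4 by linarith
  qed
  then have "- s < Re gauss_sum" using lower f by (simp add: field_simps)
  then show ?thesis using cases s by (auto simp: s_def)
qed

text \<open>This is where the sign of the Gauss sum enters.\<close>
lemma chi_fourier: "of_int (chi a) = (\<Sum>h<p. of_int (chi h) * zeta ^ (h * a)) / of_real (sqrt (real p))"
  using gauss_sum_twist[of a] p_pos by (simp add: gauss_sum_eq mult.commute)

end

section \<open>The generating function\<close>

lemma sum_mset_count:
  fixes \<pi> :: "nat multiset"
  assumes "finite A" "set_mset \<pi> \<subseteq> A"
  shows "\<Sum>\<^sub># \<pi> = (\<Sum>a\<in>A. count \<pi> a * a)"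
  using assms
proof (induction \<pi>)
  case (add x \<pi>)
  have "(\<Sum>a\<in>A. count (add_mset x \<pi>) a * a) = (\<Sum>a\<in>A. count \<pi> a * a + (if a = x then x else 0))"
    by (rule sum.cong) auto
  also have "\<dots> = (\<Sum>a\<in>A. count \<pi> a * a) + x"
    using add.prems by (simp add: sum.distrib)
  finally show ?case using add by simp
qed simp

lemma partitions_parts: "\<pi> \<in> partitions n \<Longrightarrow> set_mset \<pi> \<subseteq> {1..n}"
proof
  fix a assume pi: "\<pi> \<in> partitions n" and a: "a \<in># \<pi>"
  then have "a \<noteq> 0" unfolding partitions_def by (metis (mono_tags) mem_Collect_eq)
  moreover have "a \<le> \<Sum>\<^sub># \<pi>" using a by (auto dest!: multi_member_split)
  ultimately show "a \<in> {1..n}" using pi by (auto simp: partitions_def)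
qed

text \<open>Removing \<open>k\<close> copies of \<open>a\<close> is a bijection onto the partitions
  of \<open>n - a * k\<close> and splits off the weight \<open>f a ^ k\<close>. The condition
  \<open>0 < a\<close> keeps \<open>0\<close> from being inserted as a part by the inverse
  map.\<close>

lemma signed_partition_shift:
  assumes a: "0 < a"
  shows "(\<Sum>\<pi> | \<pi> \<in> partitions n \<and> k \<le> count \<pi> a. \<Prod>b\<in>#\<pi>. f b) =
    (if a * k \<le> n then f a ^ k * signed_partition_number (n - a * k) f else 0)"
proof (cases "a * k \<le> n")
  case False
  have "count \<pi> a < k" if pi: "\<pi> \<in> partitions n" for \<pi>
  proof (rule ccontr)
    assume "\<not> count \<pi> a < k"
    then have "replicate_mset k a \<subseteq># \<pi>" by (simp add: count_le_replicate_mset_subset_eq[symmetric])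
    then obtain \<rho> where "\<pi> = replicate_mset k a + \<rho>" by (auto simp: mset_subset_eq_exists_conv)
    then show False using pi False by (simp add: partitions_def mult.commute)
  qed
  then have none: "{\<pi>. \<pi> \<in> partitions n \<and> k \<le> count \<pi> a} = {}" by force
  show ?thesis unfolding none using False by simp
next
  case True
  have "(\<Sum>\<pi> | \<pi> \<in> partitions n \<and> k \<le> count \<pi> a. \<Prod>b\<in>#\<pi>. f b) =
      (\<Sum>\<rho>\<in>partitions (n - a * k). f a ^ k * (\<Prod>b\<in>#\<rho>. f b))"
  proof (rule sum.reindex_bij_witness[of _ "\<lambda>\<rho>. \<rho> + replicate_mset k a" "\<lambda>\<pi>. \<pi> - replicate_mset k a"])
    fix \<pi> assume "\<pi> \<in> {\<pi>. \<pi> \<in> partitions n \<and> k \<le> count \<pi> a}"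
    then have pi: "\<pi> \<in> partitions n" and "replicate_mset k a \<subseteq># \<pi>"
      by (simp_all add: count_le_replicate_mset_subset_eq[symmetric])
    then obtain \<rho> where r: "\<pi> = replicate_mset k a + \<rho>" by (auto simp: mset_subset_eq_exists_conv)
    then show "\<pi> - replicate_mset k a + replicate_mset k a = \<pi>" by simp
    show "\<pi> - replicate_mset k a \<in> partitions (n - a * k)"
      using pi r by (auto simp: partitions_def mult.commute)
    show "f a ^ k * (\<Prod>b\<in>#\<pi> - replicate_mset k a. f b) = (\<Prod>b\<in>#\<pi>. f b)"
      using r by simp
  next
    fix \<rho> assume "\<rho> \<in> partitions (n - a * k)"
    then show "\<rho> + replicate_mset k a \<in> {\<pi>. \<pi> \<in> partitions n \<and> k \<le> count \<pi> a}"
      using a True by (auto simp: partitions_def mult.commute)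
  qed simp
  then show ?thesis using True by (simp add: signed_partition_number_def sum_distrib_left)
qed

text \<open>The coefficients of \<open>z H'(z) / H(z)\<close> for the product \<open>H\<close> of
  the factors \<open>1 / (1 - f(a) z^a)\<close>.\<close>

definition log_coeff :: "(nat \<Rightarrow> int) \<Rightarrow> nat \<Rightarrow> int" where
  "log_coeff f n = (\<Sum>a | a dvd n. int a * f a ^ (n div a))"

text \<open>Count the total of all parts with multiplicity, weighted by \<open>f\<close>, in two ways: a part \<open>a\<close> of multiplicity
  at least \<open>k\<close> can be split off \<open>k\<close> times.\<close>
lemma signed_partition_recurrence:
  "int n * signed_partition_number n f = (\<Sum>j=1..n. log_coeff f j * signed_partition_number (n - j) f)"
proof -
  let ?P = "\<lambda>m. signed_partition_number m f"
  have "int n * ?P n = (\<Sum>\<pi>\<in>partitions n. int (\<Sum>\<^sub># \<pi>) * (\<Prod>b\<in>#\<pi>. f b))"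
    by (simp add: signed_partition_number_def sum_distrib_left partitions_def)
  also have "\<dots> = (\<Sum>\<pi>\<in>partitions n. \<Sum>a=1..n. \<Sum>k=1..n. if k \<le> count \<pi> a then int a * (\<Prod>b\<in>#\<pi>. f b) else 0)"
  proof (rule sum.cong)
    fix \<pi> assume pi: "\<pi> \<in> partitions n"
    have s: "\<Sum>\<^sub># \<pi> = (\<Sum>a=1..n. count \<pi> a * a)"
      by (rule sum_mset_count) (use partitions_parts[OF pi] in auto)
    have le: "count \<pi> a \<le> n" for a
      using size_le_sum_mset[of \<pi>] pi by (auto simp: partitions_def intro: order_trans[OF count_le_size])
    have "(\<Sum>k=1..n. if k \<le> count \<pi> a then int a * (\<Prod>b\<in>#\<pi>. f b) else 0) =
        int (count \<pi> a * a) * (\<Prod>b\<in>#\<pi>. f b)" for a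
    proof -
      have "{k \<in> {1..n}. k \<le> count \<pi> a} = {1..count \<pi> a}" using le[of a] by auto
      then show ?thesis by (simp add: sum.If_cases Int_def)
    qed
    then show "int (\<Sum>\<^sub># \<pi>) * (\<Prod>b\<in>#\<pi>. f b) =
        (\<Sum>a=1..n. \<Sum>k=1..n. if k \<le> count \<pi> a then int a * (\<Prod>b\<in>#\<pi>. f b) else 0)"
      unfolding s by (simp add: sum_distrib_right)
  qed simp
  also have "\<dots> = (\<Sum>a=1..n. \<Sum>k=1..n. \<Sum>\<pi>\<in>partitions n. if k \<le> count \<pi> a then int a * (\<Prod>b\<in>#\<pi>. f b) else 0)"
    by (subst sum.swap, rule sum.cong[OF refl], rule sum.swap)
  also have "\<dots> = (\<Sum>a=1..n. \<Sum>k=1..n. if a * k \<le> n then int a * (f a ^ k * ?P (n - a * k)) else 0)"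
  proof (intro sum.cong refl)
    fix a k assume "a \<in> {1..n}"
    then have a: "0 < a" by simp
    have "(\<Sum>\<pi>\<in>partitions n. if k \<le> count \<pi> a then int a * (\<Prod>b\<in>#\<pi>. f b) else 0) =
        int a * (\<Sum>\<pi> | \<pi> \<in> partitions n \<and> k \<le> count \<pi> a. \<Prod>b\<in>#\<pi>. f b)"
      by (simp add: sum.If_cases finite_partitions sum_distrib_left Int_def)
    then show "(\<Sum>\<pi>\<in>partitions n. if k \<le> count \<pi> a then int a * (\<Prod>b\<in>#\<pi>. f b) else 0) =
        (if a * k \<le> n then int a * (f a ^ k * ?P (n - a * k)) else 0)"
      by (simp add: signed_partition_shift[OF a])
  qed
  also have "\<dots> = (\<Sum>(a, k) \<in> {(a, k). 1 \<le> a \<and> 1 \<le> k \<and> a * k \<le> n}. int a * (f a ^ k * ?P (n - a * k)))"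
  proof -
    have sub: "{(a, k). 1 \<le> a \<and> 1 \<le> k \<and> a * k \<le> n} \<subseteq> {1..n} \<times> {1..n}"
    proof clarify
      fix a k :: nat assume h: "1 \<le> a" "1 \<le> k" "a * k \<le> n"
      have "a \<le> a * k" "k \<le> a * k"
        using mult_le_mono[of a a "Suc 0" k] mult_le_mono[of "Suc 0" a k k] h by simp_all
      then show "a \<in> {1..n} \<and> k \<in> {1..n}" 
        unfolding atLeastAtMost_iff using h by linarith
    qed
    show ?thesis
      unfolding sum.cartesian_product
      by (rule sum.mono_neutral_cong_right) (use sub in auto)
  qed
  also have "\<dots> = (\<Sum>(j, a) \<in> (SIGMA j:{1..n}. {a. a dvd j}). int a * f a ^ (j div a) * ?P (n - j))"
    by (rule sum.reindex_bij_witness[of _ "\<lambda>(j, a). (a, j div a)" "\<lambda>(a, k). (a * k, a)"])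
       (auto simp: Suc_le_eq div_greater_zero_iff dvd_imp_le)
  also have "\<dots> = (\<Sum>j=1..n. \<Sum>a | a dvd j. int a * f a ^ (j div a) * ?P (n - j))"
    by (rule sum.Sigma[symmetric]) auto
  also have "\<dots> = (\<Sum>j=1..n. log_coeff f j * ?P (n - j))"
    by (simp add: log_coeff_def sum_distrib_right)
  finally show ?thesis .
qed

lemma signed_partition_0: "signed_partition_number 0 f = 1"
proof -
  have "partitions 0 = {{#}}"
  proof (intro equalityI subsetI)
    fix \<pi> assume "\<pi> \<in> partitions 0"
    then have "set_mset \<pi> \<subseteq> {1..0}" by (rule partitions_parts)
    then show "\<pi> \<in> {{#}}" by simp
  qed (simp add: partitions_def)
  then show ?thesis by (simp add: signed_partition_number_def)
qed

text \<open>The equation determines the coefficient at \<open>Suc m\<close> from the earlier ones.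
  Uniqueness identifies the partition series with the exponential of \<open>log_fps\<close> without
  manipulating infinite products.\<close>

lemma fps_linear_ode_unique:
  fixes F K L :: "'a::field_char_0 fps"
  assumes F: "fps_deriv F = L * F" and K: "fps_deriv K = L * K" and init: "fps_nth F 0 = fps_nth K 0"
  shows "F = K"
proof (rule fps_ext)
  show "fps_nth F n = fps_nth K n" for n
  proof (induction n rule: less_induct)
    case (less n)
    show ?case
    proof (cases n)
      case (Suc m)
      have "of_nat (Suc m) * fps_nth G (Suc m) = (\<Sum>i=0..m. fps_nth L i * fps_nth G (m - i))"
        if "fps_deriv G = L * G" for G
        using arg_cong[OF that, of "\<lambda>H. fps_nth H m"] by (simp add: fps_mult_nth del: of_nat_Suc)
      note * = this[OF F] this[OF K]
      have "(\<Sum>i=0..m. fps_nth L i * fps_nth F (m - i)) = (\<Sum>i=0..m. fps_nth L i * fps_nth K (m - i))"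
        by (intro sum.cong refl arg_cong2[where f = "(*)"] less.IH) (simp add: Suc)
      then have "of_nat (Suc m) * fps_nth F (Suc m) = of_nat (Suc m) * fps_nth K (Suc m)"
        unfolding * .
      then show ?thesis unfolding Suc by (subst (asm) mult_left_cancel) (simp_all del: of_nat_Suc)
    qed (use init in simp)
  qed
qed

definition log_fps :: "(nat \<Rightarrow> int) \<Rightarrow> complex fps" where
  "log_fps f = Abs_fps (\<lambda>n. of_int (log_coeff f n) / of_nat n)"

text \<open>Starting from the logarithm avoids infinite products and branch choices; that this
  function generates the signed partition numbers is \<open>gen_fun_coeff\<close>.\<close>

definition gen_fun :: "(nat \<Rightarrow> int) \<Rightarrow> complex \<Rightarrow> complex" where
  "gen_fun f z = exp (eval_fps (log_fps f) z)"

lemma partition_fps_ode: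
  fixes f :: "nat \<Rightarrow> int"
  defines "F \<equiv> Abs_fps (\<lambda>n. of_int (signed_partition_number n f) :: complex)"
  shows "fps_deriv F = fps_deriv (log_fps f) * F"
proof (rule fps_ext)
  fix n
  have "of_nat (Suc n) * fps_nth F (Suc n) = (of_int (int (Suc n) * signed_partition_number (Suc n) f) :: complex)"
    by (simp add: F_def)
  also have "\<dots> = (\<Sum>j=1..Suc n. of_int (log_coeff f j) * fps_nth F (Suc n - j))"
    unfolding signed_partition_recurrence by (simp add: F_def)
  also have "\<dots> = (\<Sum>j=0..n. of_int (log_coeff f (Suc j)) * fps_nth F (n - j))"
    by (rule sum.reindex_bij_witness[of _ Suc "\<lambda>j. j - 1"]) auto
  finally show "fps_nth (fps_deriv F) n = fps_nth (fps_deriv (log_fps f) * F) n"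
    by (simp add: fps_mult_nth log_fps_def del: of_nat_Suc)
qed

text \<open>A summable majorant for the double series over \<open>k\<close> and \<open>a\<close>; it
  permits regrouping by the product \<open>k a\<close> and, later, exchanging the two
  summations.\<close>

lemma summable_geometric_products:
  fixes r :: real
  assumes r: "0 \<le> r" "r < 1"
  shows "(\<lambda>(k, a). (r ^ Suc k) ^ Suc a) summable_on UNIV"
    and "\<And>k. summable (\<lambda>a. (r ^ Suc k) ^ Suc a)"
proof -
  have rk: "r ^ Suc k < 1" for k
    using r power_decreasing[of 1 "Suc k" r] by (simp del: power_Suc)
  have geo: "((\<lambda>a. (r ^ Suc k) ^ Suc a) has_sum (r ^ Suc k / (1 - r ^ Suc k))) UNIV" for k
  proof (rule norm_summable_imp_has_sum)
    have "(\<lambda>a. (r ^ Suc k) * (r ^ Suc k) ^ a) sums (r ^ Suc k * (1 / (1 - r ^ Suc k)))"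
      by (intro sums_mult geometric_sums) (use rk[of k] r in simp)
    then show "(\<lambda>a. (r ^ Suc k) ^ Suc a) sums (r ^ Suc k / (1 - r ^ Suc k))" by simp
    then show "summable (\<lambda>a. norm ((r ^ Suc k) ^ Suc a))" using r by (simp add: sums_iff)
  qed
  have "(\<lambda>(k, a). (r ^ Suc k) ^ Suc a) summable_on (UNIV \<times> UNIV)"
  proof (rule summable_on_SigmaI)
    show "((\<lambda>a. case (k, a) of (k, a) \<Rightarrow> (r ^ Suc k) ^ Suc a) has_sum (r ^ Suc k / (1 - r ^ Suc k))) UNIV" for k
      using geo by simp
    have "summable (\<lambda>k. r ^ Suc k / (1 - r ^ Suc k))"
    proof (rule summable_comparison_test')
      show "summable (\<lambda>k. r / (1 - r) * r ^ k)" by (intro summable_mult summable_geometric) (use r in simp)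
      fix k :: nat
      have "r ^ Suc k \<le> r" using r power_decreasing[of 1 "Suc k" r] by simp
      then have "r ^ Suc k / (1 - r ^ Suc k) \<le> r ^ Suc k / (1 - r)"
        using r rk[of k] by (intro divide_left_mono) auto
      then show "norm (r ^ Suc k / (1 - r ^ Suc k)) \<le> r / (1 - r) * r ^ k"
        using r rk[of k] by simp
    qed
    then show "(\<lambda>k. r ^ Suc k / (1 - r ^ Suc k)) summable_on UNIV"
      using r rk by (subst summable_on_UNIV_nonneg_real_iff) (auto simp: less_imp_le simp del: power_Suc)
  qed (use r in auto)
  then show "(\<lambda>(k, a). (r ^ Suc k) ^ Suc a) summable_on UNIV" by simp
  show "summable (\<lambda>a. (r ^ Suc k) ^ Suc a)" for k
    using geo[of k] has_sum_imp_sums sums_summable by blast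
qed

text \<open>Both sides sum \<open>f(a)^k z^(k a) / k\<close> over all \<open>k, a >= 1\<close>:
  grouped by \<open>n = k a\<close> on the left, where \<open>a / n = 1 / k\<close>, and by
  \<open>k\<close> on the right.\<close>

lemma log_series:
  fixes f :: "nat \<Rightarrow> int" and z :: complex
  assumes f: "\<And>n. \<bar>f n\<bar> \<le> 1" and z: "norm z < 1"
  shows "(\<lambda>n. of_int (log_coeff f n) / of_nat n * z ^ n) sums
      (\<Sum>k. (\<Sum>a. of_int (f (Suc a)) ^ Suc k * (z ^ Suc k) ^ Suc a) / of_nat (Suc k))"
    and "summable (\<lambda>k. (\<Sum>a. of_int (f (Suc a)) ^ Suc k * (z ^ Suc k) ^ Suc a) / of_nat (Suc k))"
proof -
  define r where "r = norm z"
  have r: "0 \<le> r" "r < 1" using z by (auto simp: r_def)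
  define \<phi> :: "nat \<times> nat \<Rightarrow> complex" where
    "\<phi> = (\<lambda>(k, a). of_int (f (Suc a)) ^ Suc k * (z ^ Suc k) ^ Suc a / of_nat (Suc k))"
  note rs = summable_geometric_products(1)[OF r] and geos = summable_geometric_products(2)[OF r]
  have fp: "\<bar>real_of_int (f m)\<bar> ^ k \<le> 1" for m k
  proof -
    have "\<bar>real_of_int (f m)\<bar> \<le> 1" using f[of m] by linarith
    then show ?thesis by (simp add: power_le_one)
  qed
  have "(\<lambda>x. norm (\<phi> x)) summable_on UNIV"
  proof (rule Infinite_Sum.abs_summable_on_comparison_test'[OF rs])
    fix x :: "nat \<times> nat"
    obtain k a where x: "x = (k, a)" by force
    have "norm (\<phi> x) = \<bar>real_of_int (f (Suc a))\<bar> ^ Suc k * (r ^ Suc k) ^ Suc a / real (Suc k)"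
      unfolding x \<phi>_def by (simp add: norm_mult norm_divide norm_power r_def del: power_Suc of_nat_Suc)
    also have "\<dots> \<le> 1 * (r ^ Suc k) ^ Suc a / 1"
      using r fp by (intro frac_le mult_right_mono) (auto simp del: power_Suc)
    finally show "norm (\<phi> x) \<le> (case x of (k, a) \<Rightarrow> (r ^ Suc k) ^ Suc a)" by (simp add: x)
  qed
  then have phis: "\<phi> summable_on UNIV" by (rule Infinite_Sum.abs_summable_summable)
  then obtain S where S: "(\<phi> has_sum S) UNIV" by (auto simp: summable_on_def)
  have inner: "((\<lambda>a. \<phi> (k, a)) has_sum (\<Sum>a. of_int (f (Suc a)) ^ Suc k * (z ^ Suc k) ^ Suc a) / of_nat (Suc k)) UNIV" for k
  proof -
    have s: "summable (\<lambda>a. norm (of_int (f (Suc a)) ^ Suc k * (z ^ Suc k) ^ Suc a))"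
    proof (rule summable_comparison_test')
      show "summable (\<lambda>a. (r ^ Suc k) ^ Suc a)" by (rule geos)
      show "norm (norm (of_int (f (Suc a)) ^ Suc k * (z ^ Suc k) ^ Suc a)) \<le> (r ^ Suc k) ^ Suc a" for a
        using mult_right_mono[OF fp[of "Suc a" "Suc k"], of "(r ^ Suc k) ^ Suc a"] r
        by (simp add: norm_mult norm_power r_def del: power_Suc)
    qed
    show ?thesis
    proof (rule norm_summable_imp_has_sum)
      show "(\<lambda>a. \<phi> (k, a)) sums ((\<Sum>a. of_int (f (Suc a)) ^ Suc k * (z ^ Suc k) ^ Suc a) / of_nat (Suc k))"
        unfolding \<phi>_def prod.case by (intro sums_divide summable_sums summable_norm_cancel[OF s])
      show "summable (\<lambda>a. norm (\<phi> (k, a)))"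
        unfolding \<phi>_def prod.case norm_divide by (intro summable_divide s)
    qed
  qed
  have "(\<phi> has_sum S) (Sigma UNIV (\<lambda>_. UNIV))" using S by simp
  from has_sum_Sigma'[OF this inner]
  have 1: "(\<lambda>k. (\<Sum>a. of_int (f (Suc a)) ^ Suc k * (z ^ Suc k) ^ Suc a) / of_nat (Suc k)) sums S"
    by (intro has_sum_imp_sums) simp
  then show "summable (\<lambda>k. (\<Sum>a. of_int (f (Suc a)) ^ Suc k * (z ^ Suc k) ^ Suc a) / of_nat (Suc k))"
    by (rule sums_summable)
  \<comment> \<open>The same family indexed by \<open>n\<close> and a divisor \<open>a\<close> of
    \<open>Suc n\<close>; the shifts by one in the bijection come from counting \<open>k\<close> and
    \<open>a\<close> from \<open>0\<close>.\<close>
  define \<psi> :: "nat \<times> nat \<Rightarrow> complex" where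
    "\<psi> = (\<lambda>(n, a). of_int (f a) ^ (Suc n div a) * z ^ Suc n / of_nat (Suc n div a))"
  have "(\<phi> has_sum S) UNIV = (\<psi> has_sum S) (SIGMA n:UNIV. {a. a dvd Suc n})"
  proof (rule has_sum_reindex_bij_witness[of _ "\<lambda>(n, a). (Suc n div a - 1, a - 1)" "\<lambda>(k, a). (Suc k * Suc a - 1, Suc a)"])
    fix b assume "b \<in> (SIGMA n:UNIV. {a. a dvd Suc n})"
    then obtain n a where b: "b = (n, a)" "a dvd Suc n" by auto
    then obtain c where c: "Suc n = a * c" by blast
    then have "a > 0" "c > 0" by (metis gr0I mult_0 nat.distinct(1), metis gr0I mult_0_right nat.distinct(1))
    then show "(case (case b of (n, a) \<Rightarrow> (Suc n div a - 1, a - 1)) of (k, a) \<Rightarrow> (Suc k * Suc a - 1, Suc a)) = b"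
      using b c by (simp del: mult_Suc mult_Suc_right add: mult.commute)
  next
    fix x :: "nat \<times> nat"
    obtain k a where x: "x = (k, a)" by force
    have n: "Suc (Suc k * Suc a - 1) = Suc k * Suc a" by simp
    have d: "Suc k * Suc a div Suc a = Suc k" by (simp del: mult_Suc mult_Suc_right)
    show "\<psi> (case x of (k, a) \<Rightarrow> (Suc k * Suc a - 1, Suc a)) = \<phi> x"
      unfolding x \<psi>_def \<phi>_def prod.case n d by (simp only: power_mult)
    show "(case (case x of (k, a) \<Rightarrow> (Suc k * Suc a - 1, Suc a)) of (n, a) \<Rightarrow> (Suc n div a - 1, a - 1)) = x"
      unfolding x prod.case n d by simp
    show "(case x of (k, a) \<Rightarrow> (Suc k * Suc a - 1, Suc a)) \<in> (SIGMA n:UNIV. {a. a dvd Suc n})"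
      by (simp only: x prod.case mem_Sigma_iff UNIV_I mem_Collect_eq n dvd_triv_right simp_thms)
  qed simp_all
  then have chs: "(\<psi> has_sum S) (SIGMA n:UNIV. {a. a dvd Suc n})" using S by simp
  have "((\<lambda>a. \<psi> (n, a)) has_sum (of_int (log_coeff f (Suc n)) / of_nat (Suc n) * z ^ Suc n)) {a. a dvd Suc n}" for n
  proof -
    have fin: "finite {a. a dvd Suc n}" by simp
    have "(\<Sum>a | a dvd Suc n. \<psi> (n, a)) = (\<Sum>a | a dvd Suc n. of_nat a * of_int (f a) ^ (Suc n div a) / of_nat (Suc n) * z ^ Suc n)"
    proof (rule sum.cong)
      fix a assume "a \<in> {a. a dvd Suc n}"
      then obtain c where c: "Suc n = a * c" by blast
      then have ac: "a > 0" "c > 0" by (metis gr0I mult_0 nat.distinct(1), metis gr0I mult_0_right nat.distinct(1))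
      then have "(of_nat a / of_nat (Suc n) :: complex) = 1 / of_nat c" unfolding c by simp
      moreover have "Suc n div a = c" using c ac by simp
      ultimately show "\<psi> (n, a) = of_nat a * of_int (f a) ^ (Suc n div a) / of_nat (Suc n) * z ^ Suc n"
        unfolding \<psi>_def by (simp add: divide_inverse mult_ac del: of_nat_Suc power_Suc)
    qed simp
    also have "\<dots> = of_int (log_coeff f (Suc n)) / of_nat (Suc n) * z ^ Suc n"
      by (simp add: log_coeff_def sum_distrib_right sum_divide_distrib)
    finally show ?thesis using has_sum_finite[OF fin, of "\<lambda>a. \<psi> (n, a)"] by simp
  qed
  from has_sum_Sigma'[OF chs this]
  have "(\<lambda>n. of_int (log_coeff f (Suc n)) / of_nat (Suc n) * z ^ Suc n) sums S"
    by (rule has_sum_imp_sums)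
  then have "(\<lambda>n. of_int (log_coeff f n) / of_nat n * z ^ n) sums S"
    by (subst (asm) sums_Suc_iff) simp
  with 1 show "(\<lambda>n. of_int (log_coeff f n) / of_nat n * z ^ n) sums
      (\<Sum>k. (\<Sum>a. of_int (f (Suc a)) ^ Suc k * (z ^ Suc k) ^ Suc a) / of_nat (Suc k))"
    by (simp only: sums_iff)
qed

lemma log_fps_conv_radius:
  assumes f: "\<And>n. \<bar>f n\<bar> \<le> 1"
  shows "1 \<le> fps_conv_radius (log_fps f)"
  unfolding fps_conv_radius_def log_fps_def
proof (rule conv_radius_geI_ex')
  fix r :: real assume "0 < r" "ereal r < 1"
  then have "norm (of_real r :: complex) < 1" by simp
  from sums_summable[OF log_series(1)[of f, OF f this]]
  show "summable (\<lambda>n. fps_nth (Abs_fps (\<lambda>n. of_int (log_coeff f n) / of_nat n)) n * of_real r ^ n :: complex)" by simp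
qed

lemma eval_log_fps:
  assumes f: "\<And>n. \<bar>f n\<bar> \<le> 1" and z: "norm z < 1"
  shows "eval_fps (log_fps f) z = (\<Sum>k. (\<Sum>a. of_int (f (Suc a)) ^ Suc k * (z ^ Suc k) ^ Suc a) / of_nat (Suc k))"
  using log_series(1)[of f, OF f z] by (simp add: eval_fps_def log_fps_def sums_iff)

lemma gen_fun_holomorphic:
  assumes f: "\<And>n. \<bar>f n\<bar> \<le> 1"
  shows "gen_fun f holomorphic_on ball 0 1"
proof -
  have "eval_fps (log_fps f) holomorphic_on ball 0 1"
  proof (rule holomorphic_on_eval_fps)
    show "ball 0 1 \<subseteq> eball 0 (fps_conv_radius (log_fps f))"
      using log_fps_conv_radius[of f, OF f] by (auto simp: in_eball_iff intro: less_le_trans[of _ 1] simp flip: ereal_less(3))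
  qed
  then show ?thesis unfolding gen_fun_def by (rule holomorphic_on_exp'[unfolded o_def])
qed

text \<open>The Taylor series of \<open>gen_fun f\<close> and the partition series solve the same
  equation, \<open>F\<close> having the derivative \<open>fps_deriv (log_fps f) * F\<close>, and
  both have constant term \<open>1\<close>.\<close>

lemma gen_fun_coeff:
  assumes f: "\<And>n. \<bar>f n\<bar> \<le> 1"
  shows "(deriv ^^ n) (gen_fun f) 0 / fact n = of_int (signed_partition_number n f)"
proof -
  define K where "K = fps_expansion (gen_fun f) 0"
  have R: "0 < fps_conv_radius (log_fps f)" using log_fps_conv_radius[of f, OF f] by (auto intro: less_le_trans[of _ 1])
  have L: "eval_fps (log_fps f) has_fps_expansion log_fps f" using R by (rule eval_fps_has_fps_expansion)
  have K: "gen_fun f has_fps_expansion K"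
    unfolding K_def by (rule has_fps_expansion_fps_expansion[OF _ _ gen_fun_holomorphic[of f, OF f]]) auto
  have hol: "eval_fps (log_fps f) holomorphic_on eball 0 (fps_conv_radius (log_fps f))"
    by (rule holomorphic_on_eval_fps) simp
  have ev: "\<forall>\<^sub>F z in nhds 0. deriv (gen_fun f) z = deriv (eval_fps (log_fps f)) z * gen_fun f z"
  proof -
    have "\<forall>\<^sub>F z in nhds 0. z \<in> eball 0 (fps_conv_radius (log_fps f))"
      by (intro eventually_nhds_in_open) (use R in \<open>auto simp: in_eball_iff zero_ereal_def\<close>)
    then show ?thesis
    proof eventually_elim
      case (elim z)
      have "(eval_fps (log_fps f) has_field_derivative deriv (eval_fps (log_fps f)) z) (at z)"
        using holomorphic_derivI[OF hol open_eball elim] .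
      from DERIV_fun_exp[OF this] have "(gen_fun f has_field_derivative gen_fun f z * deriv (eval_fps (log_fps f)) z) (at z)"
        unfolding gen_fun_def .
      then show ?case by (simp add: DERIV_imp_deriv mult.commute)
    qed
  qed
  have "deriv (gen_fun f) has_fps_expansion fps_deriv K" using K by (rule has_fps_expansion_deriv)
  moreover have "(\<lambda>z. deriv (eval_fps (log_fps f)) z * gen_fun f z) has_fps_expansion fps_deriv (log_fps f) * K"
    by (intro has_fps_expansion_mult has_fps_expansion_deriv L K)
  ultimately have ode: "fps_deriv K = fps_deriv (log_fps f) * K"
    using fps_expansion_unique_complex has_fps_expansion_cong[OF ev refl] by blast
  have "fps_nth K 0 = gen_fun f 0" using has_fps_expansion_imp_0_eq_fps_nth_0[OF K] by simp
  also have "\<dots> = 1" by (simp add: gen_fun_def eval_fps_at_0 log_fps_def)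
  finally have K0: "fps_nth K 0 = 1" .
  have "Abs_fps (\<lambda>n. of_int (signed_partition_number n f)) = K"
    by (rule fps_linear_ode_unique[OF partition_fps_ode ode]) (simp add: K0 signed_partition_0)
  then have "fps_nth K n = of_int (signed_partition_number n f)" by (metis fps_nth_Abs_fps)
  then show ?thesis by (simp add: K_def fps_expansion_def)
qed

text \<open>Cauchy's formula on \<open>|z| = exp (- x)\<close>, folded by the half turn
  \<open>y -> y + pi\<close>: \<open>z\<close> and \<open>- z\<close> are treated together, so only
  \<open>|y| <= pi / 2\<close> remains and the points \<open>1\<close> and \<open>- 1\<close> are
  both approached at \<open>y = 0\<close>. The factor \<open>(-1) ^ n\<close> stems from the power
  \<open>z ^ n\<close> in the denominator.\<close>

lemma circle_coefficient_integral:
  fixes H :: "complex \<Rightarrow> complex"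
  assumes H: "H holomorphic_on ball 0 1" and x: "0 < x"
  shows "integral {- (pi/2)..pi/2} (\<lambda>y. (H (exp (- Complex x (- y))) + (-1) ^ n * H (- exp (- Complex x (- y))))
      * exp (of_nat n * Complex x (- y))) = 2 * pi * ((deriv ^^ n) H 0 / fact n)"
proof -
  define r where "r = exp (- x)"
  have r: "0 < r" "r < 1" using x by (auto simp: r_def)
  define u where "u y = of_real r * exp (\<i> * of_real y)" for y
  have nu: "norm (u y) = r" for y using r by (simp add: u_def norm_mult)
  have u0: "u y \<noteq> 0" for y using nu[of y] r by auto
  define F where "F y = H (u y) / u y ^ n" for y
  have cont: "continuous_on A F" for A
  proof -
    have "continuous_on (ball 0 1) H" using H by (rule holomorphic_on_imp_continuous_on)
    moreover have "continuous_on A u" unfolding u_def by (intro continuous_intros)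
    ultimately have "continuous_on A (\<lambda>y. H (u y))"
      using r nu by (intro continuous_on_compose2[of "ball 0 1" H A u]) auto
    then show ?thesis unfolding F_def
      by (intro continuous_on_divide continuous_on_power) (use u0 \<open>continuous_on A u\<close> in auto)
  qed
  have "((\<lambda>v. H v / (v - 0) ^ Suc n) has_contour_integral (2 * pi * \<i> / fact n * (deriv ^^ n) H 0)) (circlepath 0 r)"
  proof (rule Cauchy_has_contour_integral_higher_derivative_circlepath)
    have "cball 0 r \<subseteq> ball (0::complex) 1" using r by auto
    then show "continuous_on (cball 0 r) H"
      using H holomorphic_on_imp_continuous_on continuous_on_subset by blast
    show "H holomorphic_on ball 0 r" using H by (rule holomorphic_on_subset) (use r in auto)
  qed (use r in simp)
  then have "((\<lambda>t. H (circlepath 0 r t) / (circlepath 0 r t) ^ Suc n * (2 * pi * \<i> * r * exp (2 * of_real pi * \<i> * t)))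
      has_integral (2 * pi * \<i> / fact n * (deriv ^^ n) H 0)) {0..1}"
    unfolding has_contour_integral_def by (rule has_integral_eq[rotated]) (simp add: vector_derivative_circlepath01)
  then have "((\<lambda>t. 2 * pi * \<i> * F (2 * pi * t)) has_integral (2 * pi * \<i> / fact n * (deriv ^^ n) H 0)) {0..1}"
  proof (rule has_integral_eq[rotated])
    fix t :: real
    have c: "circlepath 0 r t = u (2 * pi * t)" by (simp add: circlepath u_def mult_ac)
    have e: "2 * pi * \<i> * r * exp (2 * of_real pi * \<i> * t) = 2 * pi * \<i> * u (2 * pi * t)" by (simp add: u_def mult_ac)
    then show "H (circlepath 0 r t) / (circlepath 0 r t) ^ Suc n * (2 * pi * \<i> * r * exp (2 * of_real pi * \<i> * t))
        = 2 * pi * \<i> * F (2 * pi * t)"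
      unfolding c e F_def using u0[of "2 * pi * t"] by simp
  qed
  from has_integral_mult_right[OF this, of "1 / \<i>"]
  have A: "((\<lambda>t. (2 * pi) *\<^sub>R F (2 * pi * t)) has_integral (2 * pi * ((deriv ^^ n) H 0 / fact n))) {0..1}"
    by (simp add: scaleR_conv_of_real mult_ac)
  have B: "((\<lambda>t. (2 * pi) *\<^sub>R F (2 * pi * t)) has_integral (integral {2 * pi * 0..2 * pi * 1} F)) {0..1}"
  proof (rule has_integral_substitution[where c = 0 and d = "2 * pi"])
    show "continuous_on {0..2 * pi} F" by (rule cont)
    show "((\<lambda>t. 2 * pi * t) has_field_derivative 2 * pi) (at t within {0..1})" for t
      by (auto intro!: derivative_eq_intros)
  qed (auto simp: mult_le_cancel_left1)
  have I: "integral {0..2 * pi} F = 2 * pi * ((deriv ^^ n) H 0 / fact n)"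
    using has_integral_unique[OF B A] by simp
  have int: "F integrable_on {a..b}" for a b using cont by (rule integrable_continuous_interval)
  have shift: "integral {a + c..b + c} F = integral {a..b} (\<lambda>y. F (y + c))" for a b c
    using integral_shift[OF cont, where a = a and b = b and c = c] by (simp add: o_def)
  \<comment> \<open>\<open>Q\<close> has period \<open>pi\<close>, so its interval of integration
    may be moved from \<open>[0, pi]\<close> to \<open>[- pi/2, pi/2]\<close>.\<close>
  define Q where "Q y = F y + F (y + pi)" for y
  have contp: "continuous_on A (\<lambda>y. F (y + pi))" for A
    by (rule continuous_on_compose2[OF cont[of UNIV]]) (auto intro!: continuous_intros)
  have contQ: "continuous_on A Q" for A
    unfolding Q_def by (intro continuous_on_add cont contp)
  have intQ: "Q integrable_on {a..b}" for a b using contQ by (rule integrable_continuous_interval)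
  have upi: "u (y + pi) = - u y" for y by (simp add: u_def distrib_left exp_add)
  have Qper: "Q (y + pi) = Q y" for y
    unfolding Q_def F_def upi by simp
  have "integral {0..2 * pi} F = integral {0..pi} F + integral {0 + pi..pi + pi} F"
    using Henstock_Kurzweil_Integration.integral_combine[OF _ _ int, of 0 pi "2 * pi"] by simp
  also have "\<dots> = integral {0..pi} Q"
    unfolding shift Q_def
    by (rule Henstock_Kurzweil_Integration.integral_add[symmetric]) (intro int integrable_continuous_interval contp)+
  also have "\<dots> = integral {0..pi/2} Q + integral {- (pi/2) + pi..0 + pi} Q"
    using Henstock_Kurzweil_Integration.integral_combine[OF _ _ intQ, of 0 "pi/2" "pi"] by simp
  also have "integral {- (pi/2) + pi..0 + pi} Q = integral {- (pi/2)..0} (\<lambda>y. Q (y + pi))"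
    using integral_shift[OF contQ, where a = "- (pi/2)" and b = 0 and c = pi] by (simp add: o_def)
  also have "integral {0..pi/2} Q + \<dots> = integral {- (pi/2)..pi/2} Q"
    using Henstock_Kurzweil_Integration.integral_combine[OF _ _ intQ, of "- (pi/2)" 0 "pi/2"] by (simp add: Qper add.commute)
  also have "\<dots> = integral {- (pi/2)..pi/2} (\<lambda>y. (H (exp (- Complex x (- y))) + (-1) ^ n * H (- exp (- Complex x (- y))))
      * exp (of_nat n * Complex x (- y)))"
  proof (rule Henstock_Kurzweil_Integration.integral_cong)
    fix y :: real
    have "- Complex x (- y) = of_real (- x) + \<i> * of_real y" by (simp add: complex_eq_iff)
    then have uy: "exp (- Complex x (- y)) = u y"
      by (simp only: exp_add u_def r_def exp_of_real)
    have "exp (of_nat n * Complex x (- y)) = 1 / u y ^ n"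
      unfolding uy[symmetric] by (simp add: exp_of_nat_mult exp_minus power_inverse field_simps)
    moreover have "Q y = (H (u y) + (-1) ^ n * H (- u y)) * (1 / u y ^ n)"
      unfolding Q_def F_def upi using power_minus[of "u y" n]
      by (cases "even n") (auto simp: distrib_right add_divide_distrib diff_divide_distrib)
    ultimately show "Q y = (H (exp (- Complex x (- y))) + (-1) ^ n * H (- exp (- Complex x (- y)))) * exp (of_nat n * Complex x (- y))"
      by (simp add: uy)
  qed
  finally show ?thesis using I by simp
qed

section \<open>The value \<open>L(1, chi)\<close>\<close>

text \<open>The factors \<open>(m + y) (m + 1 - y)\<close> for \<open>m < M\<close> multiply to
  \<open>y\<close> times the product of \<open>k^2 - y^2\<close> for \<open>k <= M\<close>, divided
  by \<open>M + y\<close>: a finite form of the reflection formula for the Gamma function.\<close>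

lemma log_sum_reflection:
  fixes y :: real
  assumes y: "0 < y" "y < 1"
  shows "(\<Sum>m<M. ln (real m + y) + ln (real m + 1 - y)) =
    ln (pi * y * (\<Prod>k=1..M. 1 - y^2 / (real k)^2)) - ln (real M + y) + 2 * (\<Sum>k=1..M. ln (real k)) - ln pi"
proof (induction M)
  case 0
  then show ?case using y by (simp add: ln_mult)
next
  case (Suc M)
  have f: "0 < 1 - y^2 / (real k)^2" if "1 \<le> k" for k
  proof -
    have "y < real k" using that y by simp
    then have "y^2 < (real k)^2" using y by (intro power_strict_mono) auto
    then show ?thesis using that by simp
  qed
  have pos: "0 < pi * y * (\<Prod>k=1..M. 1 - y^2 / (real k)^2)"
    using y f by (intro mult_pos_pos prod_pos) auto
  have fac: "1 - y^2 / (real (Suc M))^2 = (real M + 1 - y) * (real (Suc M) + y) / (real (Suc M))^2"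
  proof -
    have "1 - y^2 / a^2 = (a - y) * (a + y) / a^2" if "0 < a" for a
      using that by (simp add: field_simps power2_eq_square)
    from this[of "real (Suc M)"] show ?thesis by (simp add: algebra_simps)
  qed
  have "ln (1 - y^2 / (real (Suc M))^2) = ln (real M + 1 - y) + ln (real (Suc M) + y) - 2 * ln (real (Suc M))"
    unfolding fac using y by (subst ln_div) (auto simp: ln_mult ln_realpow)
  moreover have "ln (pi * y * (\<Prod>k=1..Suc M. 1 - y^2 / (real k)^2)) =
      ln (pi * y * (\<Prod>k=1..M. 1 - y^2 / (real k)^2)) + ln (1 - y^2 / (real (Suc M))^2)"
  proof -
    have "ln (pi * y * (\<Prod>k=1..M. 1 - y^2 / (real k)^2) * (1 - y^2 / (real (Suc M))^2)) =
      ln (pi * y * (\<Prod>k=1..M. 1 - y^2 / (real k)^2)) + ln (1 - y^2 / (real (Suc M))^2)"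
      by (rule ln_mult_pos[OF pos f]) simp
    then show ?thesis by (simp add: mult.assoc del: of_nat_Suc)
  qed
  ultimately show ?case using Suc.IH by simp
qed

text \<open>The subtracted normalisation does not depend on \<open>y\<close>, so it drops out of
  sums weighted by \<open>chi\<close>.\<close>

lemma log_sum_reflection_limit:
  fixes y :: real
  assumes y: "0 < y" "y < 1"
  shows "(\<lambda>M. (\<Sum>m<M. ln (real m + y) + ln (real m + 1 - y)) - (2 * (\<Sum>k=1..M. ln (real k)) - ln (real M) - ln pi))
      \<longlonglongrightarrow> ln (sin (pi * y))"
proof -
  have s: "0 < sin (pi * y)" using y by (intro sin_gt_zero) auto
  have A: "(\<lambda>M. ln (pi * y * (\<Prod>k=1..M. 1 - y^2 / (real k)^2)) - (ln (real M + y) - ln (real M))) \<longlonglongrightarrow> ln (sin (pi * y)) - 0"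
  proof (intro tendsto_diff tendsto_ln)
    show "(\<lambda>M. pi * y * (\<Prod>k=1..M. 1 - y^2 / (real k)^2)) \<longlonglongrightarrow> sin (pi * y)"
      by (rule sin_product_formula_real)
    show "(\<lambda>M. ln (real M + y) - ln (real M)) \<longlonglongrightarrow> 0" by real_asymp
  qed (use s in auto)
  have eq: "(\<Sum>m<M. ln (real m + y) + ln (real m + 1 - y)) - (2 * (\<Sum>k=1..M. ln (real k)) - ln (real M) - ln pi)
      = ln (pi * y * (\<Prod>k=1..M. 1 - y^2 / (real k)^2)) - (ln (real M + y) - ln (real M))" for M
    unfolding log_sum_reflection[OF y] by simp
  show ?thesis unfolding eq using A by simp
qed

text \<open>For \<open>u > 0\<close> the gap between \<open>- ln (1 - exp (- u))\<close> and
  \<open>- ln u\<close>. Unlike these it stays regular as \<open>u\<close> tends to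
  \<open>0\<close>, with derivative \<open>- rpsi u\<close>.\<close>

definition log_defect :: "real \<Rightarrow> real" where
  "log_defect u = - ln ((1 - exp (- u)) / u)"

lemma log_defect_deriv:
  assumes "0 < u"
  shows "(log_defect has_real_derivative - rpsi u) (at u)"
proof -
  have e: "0 < 1 - exp (- u)" using assms by simp
  have "(log_defect has_real_derivative - (inverse ((1 - exp (- u)) / u) * ((exp (- u) * u - (1 - exp (- u))) / (u * u)))) (at u)"
    unfolding log_defect_def using assms e
    by (auto intro!: derivative_eq_intros)
  moreover have "- (inverse ((1 - exp (- u)) / u) * ((exp (- u) * u - (1 - exp (- u))) / (u * u))) = - rpsi u"
  proof -
    have "inverse ((1 - exp (- u)) / u) * ((exp (- u) * u - (1 - exp (- u))) / (u * u)) = exp (- u) / (1 - exp (- u)) - 1 / u"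
      using assms e by (simp add: field_simps)
    also have "exp (- u) / (1 - exp (- u)) = 1 / (exp u - 1)"
      using assms e by (simp add: exp_minus field_simps)
    finally show ?thesis by (simp add: rpsi_def)
  qed
  ultimately show ?thesis by simp
qed

lemma rpsi_ge_half:
  assumes "0 < u"
  shows "- 1/2 \<le> rpsi u"
proof (rule tendsto_upperbound[OF rpsi_tendsto])
  show "\<forall>\<^sub>F w in at_right 0. rpsi w \<le> rpsi u"
    using assms by (auto simp: eventually_at_right_field intro!: exI[of _ u] rpsi_mono)
qed simp

lemma log_defect_mvt:
  assumes "0 < a" "a < b"
  obtains \<xi> where "a < \<xi>" "\<xi> < b" "log_defect a = log_defect b + (b - a) * rpsi \<xi>"
proof -
  have "\<exists>z>a. z < b \<and> log_defect b - log_defect a = (b - a) * (- rpsi z)"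
    by (rule MVT2) (use assms in \<open>auto intro!: log_defect_deriv\<close>)
  then obtain z where "a < z" "z < b" "log_defect b - log_defect a = (b - a) * (- rpsi z)" by blast
  then show ?thesis by (intro that[of z]) auto
qed

context prime_1_mod_4
begin

lemma sum_chi_complex: "(\<Sum>a<p. of_int (chi a)) = (0::'a::ring_1)"
  using sum_chi by (simp flip: of_int_sum)

lemma sum_reflect:
  fixes f :: "nat \<Rightarrow> real"
  shows "(\<Sum>r<p. of_int (chi r) * f r) = (\<Sum>r=1..<p. of_int (chi r) * f r)"
    and "(\<Sum>r=1..<p. of_int (chi r) * f (p - r)) = (\<Sum>r=1..<p. of_int (chi r) * f r)"
proof -
  have "{..<p} = insert 0 {1..<p}" using p_pos by auto
  then show "(\<Sum>r<p. of_int (chi r) * f r) = (\<Sum>r=1..<p. of_int (chi r) * f r)" by (simp add: chi_0)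
  show "(\<Sum>r=1..<p. of_int (chi r) * f (p - r)) = (\<Sum>r=1..<p. of_int (chi r) * f r)"
    by (rule sum.reindex_bij_witness[of _ "\<lambda>r. p - r" "\<lambda>r. p - r"]) (auto simp: chi_minus)
qed

lemma sum_chi_nonzero: "(\<Sum>r=1..<p. real_of_int (chi r)) = 0"
  using sum_reflect(1)[of "\<lambda>_. 1"] sum_chi_complex[where 'a = real] by simp

text \<open>The reflection \<open>r -> p - r\<close> sends the moment to its negative, up to
  \<open>p\<close> times the vanishing sum of \<open>chi\<close>.\<close>

lemma sum_chi_moment: "(\<Sum>r=1..<p. real_of_int (chi r) * real r) = 0"
proof -
  have "(\<Sum>r=1..<p. real_of_int (chi r) * real r) = (\<Sum>r=1..<p. real_of_int (chi r) * real (p - r))"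
    using sum_reflect(2)[of real] by simp
  also have "\<dots> = (\<Sum>r=1..<p. real_of_int (chi r) * real p - real_of_int (chi r) * real r)"
    by (intro sum.cong) (auto simp: of_nat_diff algebra_simps)
  also have "\<dots> = real p * (\<Sum>r=1..<p. real_of_int (chi r)) - (\<Sum>r=1..<p. real_of_int (chi r) * real r)"
    by (simp add: sum_subtractf sum_distrib_left mult.commute)
  finally show ?thesis by (simp add: sum_chi_nonzero[unfolded One_nat_def])
qed

text \<open>Up to the factor \<open>- sqrt p\<close> the classical closed form of
  \<open>L(1, chi)\<close> for an even character, as \<open>L_value\<close> shows.\<close>

definition log_sine_sum :: real where
  "log_sine_sum = (\<Sum>r=1..<p. real_of_int (chi r) * ln (sin (pi * real r / real p)))"

text \<open>Formally the value is \<open>L'(0, chi)\<close>, the sum of \<open>- chi(a) ln a\<close>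
  taken over whole periods; together with \<open>L_value\<close> this replaces the functional
  equation. Averaging over \<open>r\<close> and \<open>p - r\<close> produces the pairs of
  \<open>log_sum_reflection_limit\<close>.\<close>

lemma chi_log_sum_limit:
  "(\<lambda>m. - (\<Sum>r=1..<p. real_of_int (chi r) * ln (real m * real p + real r))) sums (- log_sine_sum / 2)"
proof -
  define S where "S M = (\<Sum>m<M. - (\<Sum>r=1..<p. real_of_int (chi r) * ln (real m * real p + real r)))" for M
  define g where "g M r = (\<Sum>m<M. ln (real m + real r / real p) + ln (real m + 1 - real r / real p))" for M r
  have lnp: "ln (real m * real p + real r) = ln (real p) + ln (real m + real r / real p)" if "r \<in> {1..<p}" for m r
  proof -
    have "real m * real p + real r = real p * (real m + real r / real p)" using p_pos by (simp add: field_simps)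
    moreover have "0 < real m + real r / real p" using that by (auto intro: add_nonneg_pos)
    ultimately show ?thesis using p_pos by (simp add: ln_mult)
  qed
  have "S M = - (\<Sum>r=1..<p. real_of_int (chi r) * g M r) / 2" for M
  proof -
    have b: "(\<Sum>r=1..<p. real_of_int (chi r) * ln (real m * real p + real r)) =
        (\<Sum>r=1..<p. real_of_int (chi r) * (ln (real m + real r / real p) + ln (real m + 1 - real r / real p))) / 2" for m
    proof -
      let ?f = "\<lambda>r. ln (real m + real r / real p)"
      have "(\<Sum>r=1..<p. real_of_int (chi r) * ln (real m * real p + real r)) = (\<Sum>r=1..<p. real_of_int (chi r) * ln (real p) + real_of_int (chi r) * ?f r)"
        by (intro sum.cong) (simp_all add: lnp distrib_left)
      also have "\<dots> = (\<Sum>r=1..<p. real_of_int (chi r) * ?f r)"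
        by (simp add: sum.distrib sum_chi_nonzero[unfolded One_nat_def] flip: sum_distrib_right)
      finally have 1: "(\<Sum>r=1..<p. real_of_int (chi r) * ln (real m * real p + real r)) = (\<Sum>r=1..<p. real_of_int (chi r) * ?f r)" .
      have "(\<Sum>r=1..<p. real_of_int (chi r) * ?f r) = (\<Sum>r=1..<p. real_of_int (chi r) * ?f (p - r))"
        using sum_reflect(2)[of ?f] by simp
      also have "\<dots> = (\<Sum>r=1..<p. real_of_int (chi r) * ln (real m + 1 - real r / real p))"
        using p_pos by (intro sum.cong) (auto simp: of_nat_diff diff_divide_distrib add_diff_eq)
      finally show ?thesis unfolding 1 by (simp add: distrib_left sum.distrib)
    qed
    show ?thesis
      unfolding S_def b g_def sum_distrib_left
      by (subst sum.swap) (simp add: sum_negf sum_divide_distrib)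
  qed
  also have "(\<Sum>r=1..<p. real_of_int (chi r) * g M r) =
      (\<Sum>r=1..<p. real_of_int (chi r) * (g M r - (2 * (\<Sum>k=1..M. ln (real k)) - ln (real M) - ln pi)))" for M
    by (simp only: right_diff_distrib sum_subtractf sum_distrib_right[symmetric] sum_chi_nonzero)
  finally have S: "S M = - (\<Sum>r=1..<p. real_of_int (chi r) * (g M r - (2 * (\<Sum>k=1..M. ln (real k)) - ln (real M) - ln pi))) / 2" for M .
  have "(\<lambda>M. - (\<Sum>r=1..<p. real_of_int (chi r) * (g M r - (2 * (\<Sum>k=1..M. ln (real k)) - ln (real M) - ln pi))) / 2)
      \<longlonglongrightarrow> - (\<Sum>r=1..<p. real_of_int (chi r) * ln (sin (pi * (real r / real p)))) / 2"
    unfolding g_def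
    by (intro tendsto_intros log_sum_reflection_limit) auto
  then show ?thesis unfolding sums_def S_def[symmetric] S log_sine_sum_def by simp
qed

text \<open>Expanded about the right end \<open>b\<close> of the block, the parts of
  \<open>log_defect\<close> that are constant and linear in \<open>r\<close> are annihilated by the
  zeroth and first moments of \<open>chi\<close>. What remains is controlled by the oscillation of
  the monotone function \<open>rpsi\<close> over the block, which telescopes in
  \<open>m\<close>.\<close>

lemma chi_defect_block:
  assumes x: "0 < x"
  shows "\<bar>\<Sum>r=1..<p. real_of_int (chi r) * log_defect ((real m * real p + real r) * x)\<bar> \<le>
    real p * real p * x * (rpsi (real (Suc m) * real p * x) - (if m = 0 then - 1/2 else rpsi (real m * real p * x)))"
proof -
  define b where "b = real (Suc m) * real p * x"
  \<comment> \<open>\<open>-1/2\<close> is the limit of \<open>rpsi\<close> at \<open>0\<close>; the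
    literal value \<open>rpsi 0\<close> is \<open>0\<close>, because division by zero yields
    \<open>0\<close>.\<close>
  define \<beta> where "\<beta> = (if m = 0 then - 1/2 else rpsi (real m * real p * x))"
  define u where "u r = (real m * real p + real r) * x" for r
  have bu: "b - u r = (real p - real r) * x" for r by (simp add: b_def u_def algebra_simps)
  have "\<exists>\<xi>. u r < \<xi> \<and> \<xi> < b \<and> log_defect (u r) = log_defect b + (b - u r) * rpsi \<xi>" if r: "r \<in> {1..<p}" for r
  proof -
    have "0 < u r" using r x by (auto simp: u_def intro!: mult_pos_pos add_nonneg_pos)
    moreover have "0 < (real p - real r) * x" using r x by simp
    then have "u r < b" unfolding bu[symmetric] by simp
    ultimately show ?thesis using log_defect_mvt by metis
  qed
  then obtain \<xi> where xi: "\<And>r. r \<in> {1..<p} \<Longrightarrow> u r < \<xi> r \<and> \<xi> r < b \<and> log_defect (u r) = log_defect b + (b - u r) * rpsi (\<xi> r)"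
    by metis
  have "(\<Sum>r=1..<p. real_of_int (chi r) * log_defect (u r)) =
      (\<Sum>r=1..<p. real_of_int (chi r) * log_defect b + (real_of_int (chi r) * real p * x * rpsi b - real_of_int (chi r) * real r * (x * rpsi b))
        + real_of_int (chi r) * ((b - u r) * (rpsi (\<xi> r) - rpsi b)))"
  proof (rule sum.cong)
    fix r assume r: "r \<in> {1..<p}"
    show "real_of_int (chi r) * log_defect (u r) = real_of_int (chi r) * log_defect b + (real_of_int (chi r) * real p * x * rpsi b - real_of_int (chi r) * real r * (x * rpsi b))
        + real_of_int (chi r) * ((b - u r) * (rpsi (\<xi> r) - rpsi b))"
    proof -
      have e: "log_defect (u r) = log_defect b + (b - u r) * rpsi (\<xi> r)" using xi[OF r] by blast
      show ?thesis unfolding e unfolding bu by (simp add: algebra_simps)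
    qed
  qed simp
  also have "\<dots> = (\<Sum>r=1..<p. real_of_int (chi r) * ((b - u r) * (rpsi (\<xi> r) - rpsi b)))"
    by (simp only: sum.distrib sum_subtractf sum_distrib_right[symmetric] sum_chi_nonzero sum_chi_moment)
  also have "\<bar>\<dots>\<bar> \<le> (\<Sum>r=1..<p. real p * x * (rpsi b - \<beta>))"
  proof (rule order_trans[OF sum_abs], rule sum_mono)
    fix r assume r: "r \<in> {1..<p}"
    have ur: "real m * real p * x \<le> u r" "0 < u r"
      using r x by (auto simp: u_def intro!: mult_right_mono mult_pos_pos add_nonneg_pos)
    have lo: "\<beta> \<le> rpsi (\<xi> r)"
    proof (cases "m = 0")
      case True
      then show ?thesis using rpsi_ge_half[of "\<xi> r"] xi[OF r] ur by (simp add: \<beta>_def)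
    next
      case False
      then have "rpsi (real m * real p * x) \<le> rpsi (\<xi> r)"
        using xi[OF r] ur x p_pos by (intro rpsi_mono) auto
      then show ?thesis using False by (simp add: \<beta>_def)
    qed
    have hi: "rpsi (\<xi> r) \<le> rpsi b" using xi[OF r] ur by (intro rpsi_mono) auto
    have "\<bar>real_of_int (chi r)\<bar> \<le> 1" using abs_chi_le[of r] by linarith
    then have "\<bar>real_of_int (chi r)\<bar> * (\<bar>b - u r\<bar> * \<bar>rpsi (\<xi> r) - rpsi b\<bar>) \<le> 1 * (real p * x * (rpsi b - \<beta>))"
    proof (intro mult_mono)
      have "(real p - real r) * x \<le> real p * x" using x by (intro mult_right_mono) auto
      then show "\<bar>b - u r\<bar> \<le> real p * x" unfolding bu using r x by (simp add: abs_mult)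
      show "\<bar>rpsi (\<xi> r) - rpsi b\<bar> \<le> rpsi b - \<beta>" using lo hi by simp
    qed (use x lo hi in auto)
    then show "\<bar>real_of_int (chi r) * ((b - u r) * (rpsi (\<xi> r) - rpsi b))\<bar> \<le> real p * x * (rpsi b - \<beta>)"
      by (simp add: abs_mult)
  qed
  also have "\<dots> = real (p - 1) * (real p * x * (rpsi b - \<beta>))" by simp
  also have "\<dots> \<le> real p * (real p * x * (rpsi b - \<beta>))"
  proof (intro mult_right_mono mult_nonneg_nonneg)
    have "\<beta> \<le> rpsi b"
    proof (cases "m = 0")
      case True
      then show ?thesis using rpsi_ge_half[of b] x p_pos by (simp add: \<beta>_def b_def)
    next
      case False
      then show ?thesis using x p_pos by (auto simp: \<beta>_def b_def intro!: rpsi_mono mult_right_mono)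
    qed
    then show "0 \<le> rpsi b - \<beta>" by simp
  qed (use x in auto)
  finally show ?thesis by (simp add: u_def b_def \<beta>_def mult_ac)
qed

text \<open>Summing over whole periods, \<open>- ln (1 - exp (- u))\<close> is compared with \<open>- ln u\<close>; the difference is
  smooth enough for the vanishing zeroth and first moments of \<open>chi\<close> to make it negligible.\<close>
lemma chi_log_series_limit:
  assumes U: "\<And>x. 0 < x \<Longrightarrow> (\<lambda>a. real_of_int (chi a) * (- ln (1 - exp (- (real a * x))))) sums U x"
  shows "(U \<longlongrightarrow> - log_sine_sum / 2) (at_right 0)"
proof -
  have bound: "\<bar>U x - (- log_sine_sum / 2)\<bar> \<le> real p * real p * x" if x: "0 < x" for x
  proof -
    define D where "D m = - (\<Sum>r=1..<p. real_of_int (chi r) * ln (real m * real p + real r))" for m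
    define R where "R m = (\<Sum>r=1..<p. real_of_int (chi r) * log_defect ((real m * real p + real r) * x))" for m
    define \<beta> where "\<beta> m = (if m = 0 then - 1/2 else rpsi (real m * real p * x))" for m
    have "(\<lambda>m. \<Sum>a=m*p..<m*p+p. real_of_int (chi a) * (- ln (1 - exp (- (real a * x))))) sums U x"
      by (rule sums_group[OF U[OF x] p_pos])
    moreover have "(\<Sum>a=m*p..<m*p+p. real_of_int (chi a) * (- ln (1 - exp (- (real a * x))))) = D m + R m" for m
    proof -
      have "(\<Sum>a=m*p..<m*p+p. real_of_int (chi a) * (- ln (1 - exp (- (real a * x))))) =
          (\<Sum>r<p. real_of_int (chi r) * (- ln (1 - exp (- ((real m * real p + real r) * x)))))"
      proof (rule sum.reindex_bij_witness[of _ "\<lambda>r. m * p + r" "\<lambda>a. a - m * p"])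
        fix a assume a: "a \<in> {m*p..<m*p+p}"
        have "chi (a - m * p) = chi a" using a by (intro chi_cong) (auto simp: cong_def mod_mult_self2_is_0 le_imp_diff_is_add elim!: less_eqE)
        then show "real_of_int (chi (a - m * p)) * (- ln (1 - exp (- ((real m * real p + real (a - m * p)) * x))))
          = real_of_int (chi a) * (- ln (1 - exp (- (real a * x))))" using a by (simp add: of_nat_diff)
      qed auto
      also have "\<dots> = (\<Sum>r=1..<p. real_of_int (chi r) * (- ln (1 - exp (- ((real m * real p + real r) * x)))))"
        by (rule sum_reflect)
      also have "\<dots> = (\<Sum>r=1..<p. - (real_of_int (chi r) * ln (real m * real p + real r))
           + real_of_int (chi r) * log_defect ((real m * real p + real r) * x) - real_of_int (chi r) * ln x)"
      proof (rule sum.cong)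
        fix r assume r: "r \<in> {1..<p}"
        have v: "0 < real m * real p + real r" using r by (auto intro: add_nonneg_pos)
        have vx: "0 < (real m * real p + real r) * x" using v x by simp
        have "log_defect ((real m * real p + real r) * x) =
            - ln (1 - exp (- ((real m * real p + real r) * x))) + (ln (real m * real p + real r) + ln x)"
          unfolding log_defect_def using v vx x by (subst ln_div) (simp_all add: ln_mult)
        then have e: "- ln (1 - exp (- ((real m * real p + real r) * x))) =
            log_defect ((real m * real p + real r) * x) - (ln (real m * real p + real r) + ln x)" by simp
        show "real_of_int (chi r) * (- ln (1 - exp (- ((real m * real p + real r) * x)))) =
          - (real_of_int (chi r) * ln (real m * real p + real r))
           + real_of_int (chi r) * log_defect ((real m * real p + real r) * x) - real_of_int (chi r) * ln x"
          unfolding e by (simp add: algebra_simps)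
      qed simp
      also have "\<dots> = D m + R m"
        by (simp only: sum.distrib sum_subtractf sum_negf sum_distrib_right[symmetric] sum_chi_nonzero D_def R_def mult_zero_left diff_zero)
      finally show ?thesis .
    qed
    ultimately have "(\<lambda>m. D m + R m) sums U x" by simp
    moreover have "D sums (- log_sine_sum / 2)" unfolding D_def by (rule chi_log_sum_limit)
    ultimately have "(\<lambda>m. D m + R m - D m) sums (U x - (- log_sine_sum / 2))" by (rule sums_diff)
    then have Rs: "R sums (U x - (- log_sine_sum / 2))" by simp
    show ?thesis
    proof (rule tendsto_upperbound)
      show "(\<lambda>n. \<bar>\<Sum>m<n. R m\<bar>) \<longlonglongrightarrow> \<bar>U x - (- log_sine_sum / 2)\<bar>"
        using Rs by (intro tendsto_intros) (simp add: sums_def)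
      have "\<bar>\<Sum>m<n. R m\<bar> \<le> real p * real p * x" for n
      proof -
        \<comment> \<open>The differences of \<open>\<beta>\<close> telescope from
          \<open>-1/2\<close> to at most \<open>0\<close>, so all blocks together contribute
          \<open>O(x)\<close>.\<close>
        have "\<bar>\<Sum>m<n. R m\<bar> \<le> (\<Sum>m<n. real p * real p * x * (\<beta> (Suc m) - \<beta> m))"
        proof (rule order_trans[OF sum_abs], rule sum_mono)
          show "\<bar>R m\<bar> \<le> real p * real p * x * (\<beta> (Suc m) - \<beta> m)" for m
            using chi_defect_block[OF x, of m] by (simp add: R_def \<beta>_def)
        qed
        also have "\<dots> = real p * real p * x * (\<beta> n - \<beta> 0)"
          by (simp only: sum_distrib_left[symmetric] sum_lessThan_telescope)
        also have "\<dots> \<le> real p * real p * x * 1"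
          using x p_pos rpsi_nonpos[of "real n * real p * x"] by (intro mult_left_mono) (auto simp: \<beta>_def)
        finally show ?thesis by simp
      qed
      then show "\<forall>\<^sub>F n in sequentially. \<bar>\<Sum>m<n. R m\<bar> \<le> real p * real p * x" by simp
    qed simp
  qed
  show ?thesis
  proof (rule Lim_transform2)
    show "((\<lambda>x. - log_sine_sum / 2) \<longlongrightarrow> - log_sine_sum / 2) (at_right 0)" by simp
    show "((\<lambda>x. - log_sine_sum / 2 - U x) \<longlongrightarrow> 0) (at_right 0)"
    proof (rule Lim_null_comparison)
      show "\<forall>\<^sub>F x in at_right 0. norm (- log_sine_sum / 2 - U x) \<le> real p * real p * x"
        using eventually_at_right_less[of "0::real"]
        by eventually_elim (use bound in \<open>auto simp: abs_minus_commute\<close>)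
      show "((\<lambda>x. real p * real p * x) \<longlongrightarrow> 0) (at_right 0)" by (auto intro!: tendsto_eq_intros)
    qed
  qed
qed


section \<open>Convergence and closed form of \<open>L(1, chi)\<close>\<close>

lemma sum_chi_lessThan_mod: "(\<Sum>i<n. chi i) = (\<Sum>i<n mod p. chi i)"
proof -
  have blocks: "(\<Sum>i<q * p. chi i) = 0" for q
  proof -
    have "(\<Sum>i<q * p. chi i) = (\<Sum>m<q. \<Sum>i=m*p..<m*p+p. chi i)" by (rule sum.nat_group[symmetric])
    also have "\<dots> = (\<Sum>m<q. 0)"
    proof (rule sum.cong)
      fix m
      have "(\<Sum>i=m*p..<m*p+p. chi i) = (\<Sum>i<p. chi i)"
      proof (rule sum.reindex_bij_witness[of _ "\<lambda>r. m * p + r" "\<lambda>a. a - m * p"])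
        fix a assume "a \<in> {m*p..<m*p+p}"
        then obtain r where "a = m * p + r" by (auto dest: le_Suc_ex)
        then show "chi (a - m * p) = chi a" by (intro chi_cong) (simp add: cong_def)
      qed auto
      then show "(\<Sum>i=m*p..<m*p+p. chi i) = 0" by (simp add: sum_chi)
    qed simp
    finally show ?thesis by simp
  qed
  define q r where "q = n div p" and "r = n mod p"
  have n: "n = q * p + r" by (simp add: q_def r_def)
  have "(\<Sum>i<q * p + r. chi i) = (\<Sum>i<q * p. chi i) + (\<Sum>i=q*p..<q*p+r. chi i)"
    using sum.atLeastLessThan_concat[of 0 "q * p" "q * p + r" chi] by (simp add: atLeast0LessThan)
  also have "(\<Sum>i=q*p..<q*p+r. chi i) = (\<Sum>i<r. chi i)"
  proof (rule sum.reindex_bij_witness[of _ "\<lambda>r. q * p + r" "\<lambda>a. a - q * p"])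
    fix a assume "a \<in> {q*p..<q*p+r}"
    then obtain s where "a = q * p + s" by (auto dest: le_Suc_ex)
    then show "chi (a - q * p) = chi a" by (intro chi_cong) (simp add: cong_def)
  qed auto
  finally have "(\<Sum>i<q * p + r. chi i) = (\<Sum>i<r. chi i)" by (simp add: blocks)
  then have "(\<Sum>i<n. chi i) = (\<Sum>i<r. chi i)" by (simp only: n[symmetric])
  then show ?thesis by (simp only: r_def)
qed

lemma sum_chi_bounded: "\<bar>\<Sum>i<n. chi i\<bar> \<le> int p"
proof -
  have "\<bar>\<Sum>i<n mod p. chi i\<bar> \<le> (\<Sum>i<n mod p. 1)"
    by (rule order_trans[OF sum_abs]) (intro sum_mono abs_chi_le)
  also have "\<dots> \<le> int p" using p_pos by (simp add: less_imp_le)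
  finally show ?thesis by (simp add: sum_chi_lessThan_mod[of n])
qed

text \<open>Dirichlet's test: sums of \<open>chi\<close> over initial segments are bounded by
  \<open>p\<close>, those over arbitrary intervals by \<open>2 p\<close>, and \<open>1 / n\<close>
  decreases to \<open>0\<close>.\<close>

lemma summable_chi_over_n: "summable (\<lambda>n. real_of_int (chi (Suc n)) / real (Suc n))"
  unfolding summable_Cauchy
proof (intro allI impI)
  fix e :: real assume e: "0 < e"
  obtain N :: nat where N: "2 * real p / e < real N" using reals_Archimedean2 by blast
  show "\<exists>N. \<forall>m\<ge>N. \<forall>n. norm (sum (\<lambda>n. real_of_int (chi (Suc n)) / real (Suc n)) {m..<n}) < e"
  proof (intro exI[of _ N] allI impI)
    fix m n assume m: "N \<le> m"
    have "\<bar>\<Sum>i=m..<n. real_of_int (chi (Suc i)) * (1 / real (Suc i))\<bar> \<le> 2 * real p * (1 / real (Suc m))"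
    proof (rule abel_tail_bound)
      fix k assume mk: "m \<le> k"
      have "(\<Sum>i=m..<k. chi (Suc i)) = (\<Sum>i=Suc m..<Suc k. chi i)"
        by (rule sum.shift_bounds_Suc_ivl[symmetric])
      also have "\<dots> = (\<Sum>i<Suc k. chi i) - (\<Sum>i<Suc m. chi i)"
        using sum_diff_nat_ivl[of 0 "Suc m" "Suc k" chi] mk by (simp only: atLeast0LessThan)
      finally have "\<bar>\<Sum>i=m..<k. chi (Suc i)\<bar> \<le> 2 * int p"
        using sum_chi_bounded[of "Suc k"] sum_chi_bounded[of "Suc m"] by linarith
      then have "real_of_int \<bar>\<Sum>i=m..<k. chi (Suc i)\<bar> \<le> real_of_int (2 * int p)" by (simp only: of_int_le_iff)
      then show "\<bar>\<Sum>i=m..<k. real_of_int (chi (Suc i))\<bar> \<le> 2 * real p" by simp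
    qed (auto intro!: divide_left_mono)
    also have "\<dots> < e"
    proof -
      have "2 * real p < e * real N" using N e by (simp add: field_simps)
      also have "e * real N \<le> e * real (Suc m)" using m e by (intro mult_left_mono) auto
      finally show ?thesis by (simp add: field_simps)
    qed
    finally show "norm (sum (\<lambda>n. real_of_int (chi (Suc n)) / real (Suc n)) {m..<n}) < e" by simp
  qed
qed

lemma norm_one_minus_zeta: "h < p \<Longrightarrow> norm (1 - zeta ^ h) = 2 * sin (pi * real h / real p)"
proof -
  assume h: "h < p"
  define x where "x = pi * real h / real p"
  have "2 * pi * real h / real p = 2 * x" by (simp add: x_def)
  then have z: "zeta ^ h = cis (2 * x)" by (simp only: zeta_power)
  have s: "0 \<le> sin x" unfolding x_def using h by (intro sin_ge_zero) (auto simp: field_simps)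
  have "(norm (1 - zeta ^ h))^2 = (1 - cos (2 * x))^2 + (sin (2 * x))^2"
    by (simp add: z cmod_power2)
  also have "\<dots> = 1 + ((sin (2 * x))^2 + (cos (2 * x))^2) - 2 * cos (2 * x)" by (simp add: power2_eq_square algebra_simps)
  also have "\<dots> = 2 - 2 * cos (2 * x)" by (simp only: sin_cos_squared_add)
  also have "\<dots> = (2 * sin x)^2" by (simp add: cos_double_sin power_mult_distrib)
  finally show ?thesis using s unfolding x_def[symmetric]
    by (metis mult_nonneg_nonneg norm_ge_zero power2_eq_iff_nonneg zero_le_numeral)
qed

lemma sine_pos: "1 \<le> h \<Longrightarrow> h < p \<Longrightarrow> 0 < sin (pi * real h / real p)"
  by (intro sin_gt_zero) (auto simp: field_simps)

text \<open>Abel summation gives \<open>L(1, chi)\<close> as the limit of \<open>P x\<close>. For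
  \<open>x > 0\<close> the Fourier expansion of \<open>chi\<close> and the logarithm series turn the
  damped sum into finitely many logarithms of \<open>1 - zeta^h exp (- x)\<close>. Their real parts
  tend to \<open>ln 2 + ln (sin (pi h / p))\<close>, and \<open>ln 2\<close> drops out because
  \<open>chi\<close> has sum \<open>0\<close>.\<close>

lemma L_value: "dirichlet_L 1 (legendre_char p) = - log_sine_sum / sqrt (real p)"
proof -
  define a where "a n = real_of_int (chi (Suc n)) / real (Suc n)" for n
  define s where "s = (\<Sum>n. a n)"
  have a: "a sums s" using summable_chi_over_n by (simp add: s_def a_def[abs_def] summable_sums)
  have L: "dirichlet_L 1 (legendre_char p) = s"
    unfolding dirichlet_L_def s_def a_def by (intro suminf_cong) simp
  define P where "P x = - (\<Sum>h=1..<p. real_of_int (chi h) * ln (norm (1 - zeta ^ h * of_real (exp (- x))))) / sqrt (real p)" for x :: real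
  have sums: "(\<lambda>m. a m * exp (- (real (Suc m) * x))) sums P x" if x: "0 < x" for x
  proof -
    define w where "w = (of_real (exp (- x)) :: complex)"
    have nw: "norm (zeta ^ h * w) < 1" for h using x by (simp add: norm_mult norm_zeta w_def)
    have ln: "(\<lambda>n. (zeta ^ h * w) ^ n / of_nat n) sums (- ln (1 - zeta ^ h * w))" for h
    proof -
      have "(\<lambda>n. - ((- (- (zeta ^ h * w))) ^ n) / of_nat n) sums ln (1 + - (zeta ^ h * w))"
        by (rule Ln_series') (use nw in simp)
      from sums_minus[OF this] show ?thesis by simp
    qed
    have "(\<lambda>n. (\<Sum>h<p. of_int (chi h) * ((zeta ^ h * w) ^ n / of_nat n)) / of_real (sqrt (real p))) sums
        ((\<Sum>h<p. of_int (chi h) * (- ln (1 - zeta ^ h * w))) / of_real (sqrt (real p)))"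
      by (intro sums_divide sums_sum sums_mult ln)
    moreover have "(\<Sum>h<p. of_int (chi h) * ((zeta ^ h * w) ^ n / of_nat n)) / of_real (sqrt (real p))
        = of_real (real_of_int (chi n) / real n * exp (- (real n * x)))" for n
    proof -
      have "w ^ n = of_real (exp (- (real n * x)))"
        by (simp add: w_def exp_of_nat_mult[symmetric] flip: of_real_power)
      then have "(\<Sum>h<p. of_int (chi h) * ((zeta ^ h * w) ^ n / of_nat n)) =
        (\<Sum>h<p. of_int (chi h) * zeta ^ (h * n)) * of_real (exp (- (real n * x)) / real n)"
        unfolding sum_distrib_right
        by (intro sum.cong) (simp_all add: power_mult_distrib power_mult mult_ac)
      then have "(\<Sum>h<p. of_int (chi h) * ((zeta ^ h * w) ^ n / of_nat n)) / of_real (sqrt (real p)) =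
        (\<Sum>h<p. of_int (chi h) * zeta ^ (h * n)) / of_real (sqrt (real p)) * of_real (exp (- (real n * x)) / real n)"
        by simp
      also have "\<dots> = of_real (real_of_int (chi n) / real n * exp (- (real n * x)))"
        unfolding chi_fourier[symmetric] by simp
      finally show ?thesis .
    qed
    ultimately have "(\<lambda>n. complex_of_real (real_of_int (chi n) / real n * exp (- (real n * x)))) sums
        ((\<Sum>h<p. of_int (chi h) * (- ln (1 - zeta ^ h * w))) / of_real (sqrt (real p)))" by simp
    from sums_Re[OF this]
    have "(\<lambda>n. real_of_int (chi n) / real n * exp (- (real n * x))) sums
        (Re (\<Sum>h<p. of_int (chi h) * (- ln (1 - zeta ^ h * w))) / sqrt (real p))" by simp
    also have "Re (\<Sum>h<p. of_int (chi h) * (- ln (1 - zeta ^ h * w))) = (\<Sum>h<p. real_of_int (chi h) * (- ln (norm (1 - zeta ^ h * w))))"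
    proof (simp only: Re_sum, rule sum.cong)
      fix h
      have "1 - zeta ^ h * w \<noteq> 0" using nw[of h] by auto
      then show "Re (of_int (chi h) * (- ln (1 - zeta ^ h * w))) = real_of_int (chi h) * (- ln (norm (1 - zeta ^ h * w)))"
        by simp
    qed simp
    also have "\<dots> = (\<Sum>h=1..<p. real_of_int (chi h) * (- ln (norm (1 - zeta ^ h * w))))" by (rule sum_reflect)
    also have "\<dots> / sqrt (real p) = P x" by (simp add: P_def w_def sum_negf)
    finally have "(\<lambda>n. real_of_int (chi n) / real n * exp (- (real n * x))) sums P x" .
    then have "(\<lambda>n. real_of_int (chi (Suc n)) / real (Suc n) * exp (- (real (Suc n) * x))) sums P x"
      by (subst sums_Suc_iff) (simp add: chi_0)
    then show ?thesis by (simp only: a_def)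
  qed
  have "((\<lambda>x. \<Sum>m. a m * exp (- (real (Suc m) * x))) \<longlongrightarrow> 1 * s) (at_right 0)"
  proof (rule abel_regular[OF a, where v = "\<lambda>u. exp (- u)"])
    show "((\<lambda>u. exp (- u)) \<longlongrightarrow> (1::real)) (at_right 0)" by (auto intro!: tendsto_eq_intros)
    show "summable (\<lambda>m. a m * exp (- (real (Suc m) * x)))" if "0 < x" for x
      using sums[OF that] by (rule sums_summable)
  qed auto
  moreover have "\<forall>\<^sub>F x in at_right 0. (\<Sum>m. a m * exp (- (real (Suc m) * x))) = P x"
    using eventually_at_right_less[of "0::real"] by eventually_elim (use sums in \<open>simp add: sums_iff\<close>)
  ultimately have lim1: "(P \<longlongrightarrow> s) (at_right 0)" by (auto intro: Lim_transform_eventually)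
  have pos: "0 < norm (1 - zeta ^ h)" if "h \<in> {1..<p}" for h
    using that sine_pos[of h] norm_one_minus_zeta[of h] by simp
  have "(P \<longlongrightarrow> - (\<Sum>h=1..<p. real_of_int (chi h) * ln (norm (1 - zeta ^ h * of_real (exp (- 0))))) / sqrt (real p)) (at_right 0)"
    unfolding P_def
  proof (intro tendsto_intros)
    fix h assume h: "h \<in> {1..<p}"
    show "norm (1 - zeta ^ h * complex_of_real (exp (- 0))) \<noteq> 0" using pos[OF h] by simp
  qed (use p_pos in auto)
  then have "s = - (\<Sum>h=1..<p. real_of_int (chi h) * ln (norm (1 - zeta ^ h))) / sqrt (real p)"
    using tendsto_unique[OF _ lim1] by simp
  also have "(\<Sum>h=1..<p. real_of_int (chi h) * ln (norm (1 - zeta ^ h))) =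
      (\<Sum>h=1..<p. real_of_int (chi h) * ln 2 + real_of_int (chi h) * ln (sin (pi * real h / real p)))"
  proof (rule sum.cong)
    fix h assume h: "h \<in> {1..<p}"
    have "ln (norm (1 - zeta ^ h)) = ln 2 + ln (sin (pi * real h / real p))"
      using h sine_pos[of h] norm_one_minus_zeta[of h] by (simp add: ln_mult_pos)
    then show "real_of_int (chi h) * ln (norm (1 - zeta ^ h)) = real_of_int (chi h) * ln 2 + real_of_int (chi h) * ln (sin (pi * real h / real p))"
      by (simp only: distrib_left)
  qed simp
  also have "\<dots> = log_sine_sum"
    by (simp only: sum.distrib sum_distrib_right[symmetric] sum_chi_nonzero log_sine_sum_def mult_zero_left add_0_left)
  finally show ?thesis using L by simp
qed

end

section \<open>The logarithm of the generating function near \<open>1\<close> and \<open>- 1\<close>\<close>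

lemma of_nat_mult_sector: "t \<in> sector \<Longrightarrow> of_nat n * t \<in> sector"
  using sector_scale[of t "real n"] by simp

lemma sums_interleave:
  fixes f g :: "nat \<Rightarrow> 'a::real_normed_vector"
  assumes "f sums x" "g sums y"
  shows "(\<lambda>n. if even n then f (n div 2) else g ((n - 1) div 2)) sums (y + x)"
proof -
  have "(\<lambda>n. if even n then f (n div 2) else 0) sums x"
    by (subst sums_mono_reindex[of "\<lambda>j. 2 * j", symmetric]) (use assms in \<open>auto simp: strict_mono_def\<close>)
  moreover have "(\<lambda>n. if even n then 0 else g ((n - 1) div 2)) sums y"
    by (subst sums_mono_reindex[of "\<lambda>j. 2 * j + 1", symmetric])
       (use assms in \<open>auto simp: strict_mono_def elim!: oddE\<close>)
  ultimately have "(\<lambda>n. (if even n then f (n div 2) else 0) + (if even n then 0 else g ((n - 1) div 2))) sums (x + y)"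
    by (rule sums_add)
  also have "(\<lambda>n. (if even n then f (n div 2) else 0) + (if even n then 0 else g ((n - 1) div 2))) =
      (\<lambda>n. if even n then f (n div 2) else g ((n - 1) div 2))" by auto
  finally show ?thesis by (simp add: add.commute)
qed

context prime_1_mod_4
begin

definition G0 :: "complex \<Rightarrow> complex" where
  "G0 w = 1 / (1 - w) - 1 / (1 - w ^ p)"

definition G1 :: "complex \<Rightarrow> complex" where
  "G1 w = (\<Sum>a. of_int (chi (Suc a)) * w ^ Suc a)"

abbreviation Lam :: "complex \<Rightarrow> complex" where
  "Lam \<equiv> eval_fps (log_fps chi)"

lemma bounded_power_series:
  assumes c: "\<And>a. norm (c a) \<le> 1" and w: "norm w < 1"
  shows "summable (\<lambda>a. c a * w ^ Suc a :: complex)"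
    and "norm (\<Sum>a. c a * w ^ Suc a) \<le> norm w / (1 - norm w)"
proof -
  have g: "(\<lambda>a. norm w * norm w ^ a) sums (norm w * (1 / (1 - norm w)))"
    by (intro sums_mult geometric_sums) (use w in simp)
  have le: "norm (c a * w ^ Suc a) \<le> norm w * norm w ^ a" for a
    using mult_right_mono[OF c[of a], of "norm w ^ Suc a"] by (simp add: norm_mult norm_power)
  have s: "summable (\<lambda>a. norm (c a * w ^ Suc a))"
    by (rule summable_comparison_test'[OF sums_summable[OF g]]) (use le in simp)
  then show "summable (\<lambda>a. c a * w ^ Suc a)" by (rule summable_norm_cancel)
  have "norm (\<Sum>a. c a * w ^ Suc a) \<le> (\<Sum>a. norm (c a * w ^ Suc a))" by (rule summable_norm[OF s])
  also have "\<dots> \<le> (\<Sum>a. norm w * norm w ^ a)" by (rule suminf_le[OF le s sums_summable[OF g]])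
  also have "\<dots> = norm w / (1 - norm w)" using g by (simp add: sums_iff)
  finally show "norm (\<Sum>a. c a * w ^ Suc a) \<le> norm w / (1 - norm w)" .
qed

lemma norm_chi_le: "norm (of_int (chi a) :: complex) \<le> 1"
  using abs_chi_le[of a] by simp

lemma G1_sums: "norm w < 1 \<Longrightarrow> (\<lambda>a. of_int (chi (Suc a)) * w ^ Suc a) sums G1 w"
  unfolding G1_def by (intro summable_sums bounded_power_series norm_chi_le)

lemma G1_sums_0: "norm w < 1 \<Longrightarrow> (\<lambda>a. of_int (chi a) * w ^ a) sums G1 w"
  using sums_Suc_iff[of "\<lambda>a. of_int (chi a) * w ^ a" "G1 w"] G1_sums[of w] by (simp add: chi_0)

lemma G1_le: "norm w < 1 \<Longrightarrow> norm (G1 w) \<le> norm w / (1 - norm w)"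
  unfolding G1_def by (intro bounded_power_series norm_chi_le)

lemma G0_sums:
  assumes w: "norm w < 1"
  shows "(\<lambda>a. of_int (chi (Suc a)) ^ (2 * Suc k) * w ^ Suc a) sums G0 w"
proof -
  have nwp: "norm (w ^ p) < 1" using w p_pos by (simp add: norm_power power_less_one_iff)
  have 1: "(\<lambda>a. w ^ a) sums (1 / (1 - w))" using geometric_sums[OF w] by simp
  have 2: "(\<lambda>a. (w ^ p) ^ a) sums (1 / (1 - w ^ p))" using geometric_sums[OF nwp] by simp
  have "(\<lambda>n. if p dvd n then w ^ n else 0) sums (1 / (1 - w ^ p))"
  proof (subst sums_mono_reindex[of "\<lambda>j. p * j", symmetric])
    show "strict_mono (\<lambda>j. p * j)" using p_pos by (simp add: strict_mono_def)
    show "(\<lambda>n. if p dvd p * n then w ^ (p * n) else 0) sums (1 / (1 - w ^ p))"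
      using 2 by (simp add: power_mult)
  qed auto
  from sums_diff[OF 1 this] have "(\<lambda>n. if p dvd n then 0 else w ^ n) sums G0 w"
    unfolding G0_def by (rule back_subst[of "\<lambda>f. f sums _"]) auto
  moreover have "of_int (chi n) ^ (2 * Suc k) * w ^ n = (if p dvd n then 0 else w ^ n)" for n
  proof -
    have "chi n ^ (2 * Suc k) = (if p dvd n then 0 else 1)"
      by (simp only: power_mult power2_eq_square chi_square) simp
    then have "(of_int (chi n) :: complex) ^ (2 * Suc k) = (if p dvd n then 0 else 1)"
      by (metis of_int_power of_int_0 of_int_1)
    then show ?thesis by simp
  qed
  ultimately have "(\<lambda>n. of_int (chi n) ^ (2 * Suc k) * w ^ n) sums G0 w" by simp
  then show ?thesis by (subst sums_Suc_iff) (simp add: chi_0)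
qed

lemma G0_le:
  assumes w: "norm w < 1"
  shows "norm (G0 w) \<le> norm w / (1 - norm w)"
proof -
  have c: "norm (of_int (chi (Suc a)) ^ (2 * Suc 0) :: complex) \<le> 1" for a
    unfolding norm_power by (intro power_le_one norm_chi_le) simp
  show ?thesis using bounded_power_series(2)[of "\<lambda>a. of_int (chi (Suc a)) ^ (2 * Suc 0)", OF c w] G0_sums[OF w, of 0] by (simp add: sums_iff)
qed

lemma G1_partial_fractions:
  assumes w: "norm w < 1"
  shows "G1 w = (\<Sum>h=1..<p. of_int (chi h) / (1 - zeta ^ h * w)) / of_real (sqrt (real p))"
proof -
  have "(\<lambda>a. (\<Sum>h<p. of_int (chi h) * (zeta ^ h * w) ^ a) / of_real (sqrt (real p))) sums
      ((\<Sum>h<p. of_int (chi h) * (1 / (1 - zeta ^ h * w))) / of_real (sqrt (real p)))"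
    by (intro sums_divide sums_sum sums_mult geometric_sums) (use w in \<open>simp add: norm_mult norm_zeta\<close>)
  moreover have "(\<Sum>h<p. of_int (chi h) * (zeta ^ h * w) ^ a) / of_real (sqrt (real p)) = of_int (chi a) * w ^ a" for a
  proof -
    have "(\<Sum>h<p. of_int (chi h) * (zeta ^ h * w) ^ a) = (\<Sum>h<p. of_int (chi h) * zeta ^ (h * a)) * w ^ a"
      unfolding sum_distrib_right by (intro sum.cong) (simp_all add: power_mult_distrib power_mult mult_ac)
    then show ?thesis by (simp add: chi_fourier[of a])
  qed
  ultimately have "(\<lambda>a. of_int (chi a) * w ^ a) sums ((\<Sum>h<p. of_int (chi h) * (1 / (1 - zeta ^ h * w))) / of_real (sqrt (real p)))"
    by simp
  then have "G1 w = (\<Sum>h<p. of_int (chi h) * (1 / (1 - zeta ^ h * w))) / of_real (sqrt (real p))"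
    using G1_sums_0[OF w] sums_unique2 by blast
  also have "{..<p} = insert 0 {1..<p}" using p_pos by auto
  finally show ?thesis by (simp add: chi_0)
qed

lemma odd_even_summable:
  assumes z: "norm z < 1"
  shows "summable (\<lambda>j. norm (G0 (z ^ (2 * Suc j)) / of_nat (2 * Suc j)))"
    and "summable (\<lambda>j. norm (G1 (z ^ (2 * j + 1)) / of_nat (2 * j + 1)))"
proof -
  define r where "r = norm z"
  have r: "0 \<le> r" "r < 1" using z by (auto simp: r_def)
  have rk: "norm (z ^ k) \<le> r" "norm (z ^ k) < 1" if "1 \<le> k" for k
    using power_decreasing[of 1 k r] that r by (auto simp: norm_power r_def[symmetric])
  have gen: "norm (G (z ^ k)) / real k \<le> r ^ k / (1 - r)"
    if "1 \<le> k" "\<And>w. norm w < 1 \<Longrightarrow> norm (G w) \<le> norm w / (1 - norm w)" for k and G :: "complex \<Rightarrow> complex"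
  proof -
    have "norm (G (z ^ k)) / real k \<le> norm (G (z ^ k)) / 1" using that by (intro divide_left_mono) auto
    also have "\<dots> \<le> norm (z ^ k) / (1 - norm (z ^ k))" using that(2) rk[OF that(1)] by simp
    also have "\<dots> \<le> norm (z ^ k) / (1 - r)" using rk[OF that(1)] r by (intro divide_left_mono) auto
    finally show ?thesis by (simp add: norm_power r_def)
  qed
  have geo: "summable (\<lambda>j. r ^ j / (1 - r))" by (intro summable_divide summable_geometric) (use r in simp)
  have pw: "r ^ k / (1 - r) \<le> r ^ j / (1 - r)" if "j \<le> k" for j k
    using that r by (intro divide_right_mono power_decreasing) auto
  show "summable (\<lambda>j. norm (G0 (z ^ (2 * Suc j)) / of_nat (2 * Suc j)))"
  proof (rule summable_comparison_test'[OF geo])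
    fix j :: nat
    have jk: "j \<le> 2 * Suc j" by simp
    show "norm (norm (G0 (z ^ (2 * Suc j)) / of_nat (2 * Suc j))) \<le> r ^ j / (1 - r)"
      using gen[of "2 * Suc j" G0] G0_le pw[OF jk]
      by (simp add: norm_divide del: of_nat_mult of_nat_Suc mult_Suc_right of_nat_add)
  qed
  show "summable (\<lambda>j. norm (G1 (z ^ (2 * j + 1)) / of_nat (2 * j + 1)))"
  proof (rule summable_comparison_test'[OF geo])
    fix j :: nat
    have jk: "j \<le> 2 * j + 1" by simp
    show "norm (norm (G1 (z ^ (2 * j + 1)) / of_nat (2 * j + 1))) \<le> r ^ j / (1 - r)"
      using gen[of "2 * j + 1" G1] G1_le pw[OF jk]
      by (simp add: norm_divide del: of_nat_mult of_nat_Suc mult_Suc_right of_nat_add)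
  qed
qed

lemma Lam_split:
  assumes z: "norm z < 1"
  shows "Lam z = (\<Sum>j. G0 (z ^ (2 * Suc j)) / of_nat (2 * Suc j)) + (\<Sum>j. G1 (z ^ (2 * j + 1)) / of_nat (2 * j + 1))"
proof -
  have nz: "norm (z ^ Suc k) < 1" for k
    using z power_decreasing[of 1 "Suc k" "norm z"] by (simp add: norm_power del: power_Suc)
  \<comment> \<open>Index \<open>n\<close> stands for \<open>k = n + 1\<close>, so even
    \<open>n\<close> carries the odd exponents and hence \<open>G1\<close>.\<close>
  have "(\<lambda>n. if even n then G1 (z ^ (2 * (n div 2) + 1)) / of_nat (2 * (n div 2) + 1)
        else G0 (z ^ (2 * Suc ((n - 1) div 2))) / of_nat (2 * Suc ((n - 1) div 2))) sums
      ((\<Sum>j. G0 (z ^ (2 * Suc j)) / of_nat (2 * Suc j)) + (\<Sum>j. G1 (z ^ (2 * j + 1)) / of_nat (2 * j + 1)))"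
    by (rule sums_interleave[where f = "\<lambda>j. G1 (z ^ (2 * j + 1)) / of_nat (2 * j + 1)"
          and g = "\<lambda>j. G0 (z ^ (2 * Suc j)) / of_nat (2 * Suc j)"]) (rule summable_sums[OF summable_norm_cancel[OF odd_even_summable(2)[OF z]]],
      rule summable_sums[OF summable_norm_cancel[OF odd_even_summable(1)[OF z]]])
  moreover have "(if even n then G1 (z ^ (2 * (n div 2) + 1)) / of_nat (2 * (n div 2) + 1)
        else G0 (z ^ (2 * Suc ((n - 1) div 2))) / of_nat (2 * Suc ((n - 1) div 2))) =
      (\<Sum>a. of_int (chi (Suc a)) ^ Suc n * (z ^ Suc n) ^ Suc a) / of_nat (Suc n)" for n
  proof (cases "even n")
    case True
    then have n: "2 * (n div 2) + 1 = Suc n" by simp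
    have "chi (Suc a) ^ Suc n = chi (Suc a)" for a
      using chi_values[of "Suc a"] True by auto
    then have "of_int (chi (Suc a)) ^ Suc n = (of_int (chi (Suc a)) :: complex)" for a
      by (metis of_int_power)
    then show ?thesis using True by (simp only: n G1_def if_True)
  next
    case False
    then have n: "2 * Suc ((n - 1) div 2) = Suc n" by (auto elim!: oddE)
    then obtain k where k: "Suc n = 2 * Suc k" by metis
    have "(\<Sum>a. of_int (chi (Suc a)) ^ Suc n * (z ^ Suc n) ^ Suc a) = G0 (z ^ Suc n)"
      using G0_sums[OF nz[of n], of k] unfolding k[symmetric] by (simp add: sums_iff)
    then show ?thesis using False by (simp only: n if_False)
  qed
  ultimately have "(\<lambda>n. (\<Sum>a. of_int (chi (Suc a)) ^ Suc n * (z ^ Suc n) ^ Suc a) / of_nat (Suc n)) sums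
      ((\<Sum>j. G0 (z ^ (2 * Suc j)) / of_nat (2 * Suc j)) + (\<Sum>j. G1 (z ^ (2 * j + 1)) / of_nat (2 * j + 1)))"
    by simp
  then show ?thesis using eval_log_fps[of chi, OF abs_chi_le z] by (simp add: sums_iff)
qed

text \<open>In the sum of the series at \<open>w\<close> and \<open>- w\<close> only even exponents
  \<open>2 m\<close> survive, and \<open>chi\<close> is multiplicative. This carries the expansion
  at \<open>1\<close> over to \<open>- 1\<close>.\<close>

lemma G1_minus:
  assumes w: "norm w < 1"
  shows "G1 (- w) = - G1 w + 2 * of_int (chi 2) * G1 (w^2)"
proof -
  have w2: "norm (w^2) < 1" using w by (simp add: norm_power power_less_one_iff)
  have "(\<lambda>a. of_int (chi a) * w ^ a + of_int (chi a) * (- w) ^ a) sums (G1 w + G1 (- w))"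
    by (intro sums_add G1_sums_0) (use w in auto)
  moreover have "(\<lambda>n. if even n then 2 * of_int (chi 2) * (of_int (chi (n div 2)) * (w^2) ^ (n div 2)) else 0)
      sums (0 + 2 * of_int (chi 2) * G1 (w^2))"
    by (rule sums_interleave[where f = "\<lambda>m. 2 * of_int (chi 2) * (of_int (chi m) * (w^2) ^ m)" and g = "\<lambda>_. 0"]) (auto intro!: sums_mult G1_sums_0 w2)
  moreover have "(if even n then 2 * of_int (chi 2) * (of_int (chi (n div 2)) * (w^2) ^ (n div 2)) else 0) =
      of_int (chi n) * w ^ n + of_int (chi n) * (- w) ^ n" for n
  proof (cases "even n")
    case True
    then obtain m where m: "n = 2 * m" by blast
    show ?thesis by (simp add: m chi_mult power_mult)
  qed simp
  ultimately have "G1 w + G1 (- w) = 2 * of_int (chi 2) * G1 (w^2)"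
    using sums_unique2 by fastforce
  then show ?thesis by (simp add: algebra_simps)
qed

text \<open>Equal to \<open>G1 (exp (- t))\<close> in the right half plane; the partial fractions
  continue it across \<open>t = 0\<close>, where the power series no longer converges.\<close>

definition g1 :: "complex \<Rightarrow> complex" where
  "g1 t = (\<Sum>h=1..<p. of_int (chi h) / (1 - zeta ^ h * exp (- t))) / of_real (sqrt (real p))"

lemma g1_eq: "0 < Re t \<Longrightarrow> g1 t = G1 (exp (- t))"
  by (simp add: g1_def G1_partial_fractions)

text \<open>The zeros \<open>t = 2 pi i (h / p + n)\<close> have distance at least
  \<open>2 pi / p\<close> from \<open>0\<close>, while \<open>wide_sector (2 / real p)\<close> meets
  the imaginary axis only below height \<open>2 / p\<close>.\<close>

lemma one_minus_zeta_exp_nonzero: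
  assumes t: "t \<in> wide_sector (2 / real p)" and h: "1 \<le> h" "h < p"
  shows "1 - zeta ^ h * exp (- t) \<noteq> 0"
proof
  assume "1 - zeta ^ h * exp (- t) = 0"
  then have e: "zeta ^ h * exp (- t) = 1" by simp
  then have "norm (zeta ^ h * exp (- t)) = 1" by simp
  then have Re: "Re t = 0" by (simp add: norm_mult norm_zeta)
  then have Im: "\<bar>Im t\<bar> < 2 / real p" using t by (simp add: wide_sector_def)
  have "exp (- t) = cis (- Im t)" using Re by (simp add: exp_eq_polar)
  then have "cis (2 * pi * real h / real p - Im t) = 1" using e by (simp add: zeta_power cis_mult)
  then have "cos (2 * pi * real h / real p - Im t) = 1" by (metis cis.sel(1) one_complex.sel(1))
  then obtain n :: int where n: "2 * pi * real h / real p - Im t = of_int n * 2 * pi"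
    using cos_one_2pi_int by blast
  have hp: "real h / real p \<ge> 1 / real p" "real h / real p \<le> 1 - 1 / real p"
    using h p_pos by (auto simp: field_simps)
  have "2 / real p < 2 * pi * (1 / real p)" using pi_gt3 p_pos by (simp add: field_simps)
  moreover have "2 * pi * (1 / real p) \<le> 2 * pi * (real h / real p)" "2 * pi * (real h / real p) \<le> 2 * pi * (1 - 1 / real p)"
    using hp by (intro mult_left_mono; simp)+
  ultimately have "0 < 2 * pi * real h / real p - Im t" "2 * pi * real h / real p - Im t < 2 * pi"
    using Im by (auto simp: algebra_simps abs_less_iff)
  then have "0 < 2 * pi * of_int n" "2 * pi * of_int n < 2 * pi * 1" unfolding n by (auto simp: mult_ac)
  then have "0 < real_of_int n" "real_of_int n < 1" by (simp_all add: zero_less_mult_iff)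
  then show False by simp
qed

text \<open>Pairing \<open>h\<close> with \<open>p - h\<close> and using
  \<open>1 / (1 - u) + 1 / (1 - 1 / u) = 1\<close>, the evenness of \<open>chi\<close> reduces twice
  the sum to the sum of \<open>chi\<close>. In other terms, \<open>L(0, chi) = 0\<close> for an even
  character.\<close>

lemma g1_0: "g1 0 = 0"
proof -
  have pair: "1 / (1 - zeta ^ h) + 1 / (1 - zeta ^ (p - h)) = 1" if h: "h \<in> {1..<p}" for h
  proof -
    have "zeta ^ h * zeta ^ (p - h) = 1" using h zeta_power_p by (simp flip: power_add)
    moreover have "zeta ^ h \<noteq> 0" using norm_zeta[of h] by (metis norm_zero zero_neq_one)
    ultimately have z: "zeta ^ (p - h) = 1 / zeta ^ h" by (simp add: field_simps)
    have "1 - zeta ^ h \<noteq> 0" using h zeta_eq_1_iff[of h] by (auto dest: dvd_imp_le)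
    then have v: "zeta ^ h - 1 \<noteq> 0" by simp
    have "1 - 1 / zeta ^ h = (zeta ^ h - 1) / zeta ^ h" using \<open>zeta ^ h \<noteq> 0\<close> by (simp add: diff_divide_distrib)
    then have "1 / (1 - 1 / zeta ^ h) = zeta ^ h / (zeta ^ h - 1)" by simp
    moreover have "1 / (1 - zeta ^ h) = - (1 / (zeta ^ h - 1))" by (metis minus_diff_eq minus_divide_right)
    moreover have "zeta ^ h / (zeta ^ h - 1) - 1 / (zeta ^ h - 1) = 1"
      using v by (simp flip: diff_divide_distrib)
    ultimately show ?thesis unfolding z by simp
  qed
  let ?S = "\<Sum>h=1..<p. of_int (chi h) / (1 - zeta ^ h)"
  have "?S = (\<Sum>h=1..<p. of_int (chi h) / (1 - zeta ^ (p - h)))"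
    by (rule sum.reindex_bij_witness[of _ "\<lambda>r. p - r" "\<lambda>r. p - r"]) (auto simp: chi_minus)
  then have "?S + ?S = (\<Sum>h=1..<p. of_int (chi h) * (1 / (1 - zeta ^ h) + 1 / (1 - zeta ^ (p - h))))"
    by (simp add: sum.distrib distrib_left)
  also have "\<dots> = (\<Sum>h=1..<p. of_int (chi h))" using pair by (intro sum.cong) auto
  also have "\<dots> = of_int (\<Sum>h=1..<p. chi h)" by simp
  also have "(\<Sum>h=1..<p. chi h) = 0"
  proof -
    have "real_of_int (\<Sum>h=1..<p. chi h) = 0" using sum_chi_nonzero by simp
    then show ?thesis by (simp only: of_int_eq_0_iff)
  qed
  finally show ?thesis by (simp add: g1_def)
qed

lemma g1_holomorphic: "g1 holomorphic_on wide_sector (2 / real p)"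
  unfolding g1_def by (intro holomorphic_intros one_minus_zeta_exp_nonzero) (use p_pos in auto)

lemma g1_bound:
  obtains C where "\<And>t. t \<in> wide_sector (1 / real p) \<Longrightarrow> norm (g1 t) * (1 + norm t) \<le> C"
proof (rule wide_sector_bound[of g1 "1 / real p" 2])
  show "g1 holomorphic_on wide_sector (2 * (1 / real p))" using g1_holomorphic by simp
  fix t :: complex assume t: "1 \<le> Re t"
  define w where "w = exp (- t)"
  have e: "1 + Re t \<le> exp (Re t)" by (rule exp_ge_add_one_self)
  have "norm w = exp (- Re t)" by (simp add: w_def)
  then have nw: "norm w = 1 / exp (Re t)" by (simp add: exp_minus inverse_eq_divide)
  have "norm w \<le> 1 / (1 + Re t)" unfolding nw using e t by (intro divide_left_mono) auto
  also have "\<dots> \<le> 1 / 2" using t by (intro divide_left_mono) auto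
  finally have w2: "norm w \<le> 1 / 2" .
  have "Re t \<le> exp (Re t)" using e by linarith
  then have w1: "norm w \<le> 1 / Re t" unfolding nw using t by (intro divide_left_mono) auto
  have "norm (G1 w) \<le> norm w / (1 - norm w)" using w2 by (intro G1_le) simp
  also have "\<dots> \<le> (1 / Re t) / (1 / 2)" using w1 w2 t by (intro frac_le) auto
  finally show "norm (g1 t) \<le> 2 / Re t" using t by (simp add: g1_eq w_def)
qed (use p_ge_13 in auto)

lemma g1_sector_bound:
  obtains C where "\<And>t. t \<in> sector \<Longrightarrow> norm (g1 t) * (1 + norm t) \<le> C"
proof -
  obtain C where "\<And>t. t \<in> wide_sector (1 / real p) \<Longrightarrow> norm (g1 t) * (1 + norm t) \<le> C"
    using g1_bound by blast
  then show ?thesis using that sector_subset_wide[of "1 / real p"] p_pos by (meson divide_pos_pos of_nat_0_less_iff subsetD zero_less_one)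
qed

end

lemma log_series_real:
  assumes "0 < r" "r < (1::real)"
  shows "(\<lambda>j. r ^ Suc j / real (Suc j)) sums (- ln (1 - r))"
proof -
  have "(\<lambda>n. - ((- (- of_real r)) ^ n) / of_nat n) sums ln (1 + - (of_real r :: complex))"
    by (rule Ln_series') (use assms in simp)
  from sums_minus[OF this] have "(\<lambda>n. (of_real r) ^ n / of_nat n) sums - ln (1 - of_real r :: complex)" by simp
  moreover have "ln (1 - of_real r :: complex) = of_real (ln (1 - r))"
    using assms Ln_of_real[of "1 - r"] by simp
  ultimately have "(\<lambda>n. (of_real r) ^ n / of_nat n) sums (of_real (- ln (1 - r)) :: complex)" by simp
  from sums_Re[OF this] have "(\<lambda>n. r ^ n / real n) sums (- ln (1 - r))"
    by (simp flip: of_real_power)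
  then show ?thesis by (subst sums_Suc_iff) simp
qed

context prime_1_mod_4
begin

text \<open>The double series of \<open>chi(a) exp (- k a x) / k\<close> is summed in both orders:
  over \<open>a\<close> first it is the dilation sum of \<open>g1\<close>, over \<open>k\<close>
  first the logarithmic series handled by \<open>chi_log_series_limit\<close>.\<close>

lemma g1_dilation_real:
  assumes x: "0 < x"
  defines "U \<equiv> Re (dilation_sum g1 (of_real x))"
  shows "dilation_sum g1 (of_real x) = of_real U"
    and "(\<lambda>a. real_of_int (chi a) * (- ln (1 - exp (- (real a * x))))) sums U"
proof -
  define r where "r = exp (- x)"
  have r: "0 < r" "r < 1" using x by (auto simp: r_def)
  define \<theta> :: "nat \<times> nat \<Rightarrow> complex" where
    "\<theta> = (\<lambda>(k, a). of_int (chi (Suc a)) * of_real ((r ^ Suc k) ^ Suc a) / of_nat (Suc k))"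
  have n1: "norm (\<theta> (k, a)) \<le> (r ^ Suc k) ^ Suc a" for k a
  proof -
    have "norm (\<theta> (k, a)) = norm (of_int (chi (Suc a)) :: complex) * (r ^ Suc k) ^ Suc a / real (Suc k)"
      using r unfolding \<theta>_def prod.case norm_divide norm_mult norm_of_real norm_of_nat by simp
    also have "\<dots> \<le> 1 * (r ^ Suc k) ^ Suc a / 1"
      using r norm_chi_le[of "Suc a"] by (intro frac_le mult_right_mono) auto
    finally show ?thesis by simp
  qed
  have abs: "(\<lambda>x. norm (\<theta> x)) summable_on UNIV"
    by (rule Infinite_Sum.abs_summable_on_comparison_test'[OF summable_geometric_products(1)[of r]])
       (use r n1 in auto)
  then have "\<theta> summable_on UNIV" by (rule Infinite_Sum.abs_summable_summable)
  then obtain S where S: "(\<theta> has_sum S) UNIV" by (auto simp: summable_on_def)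
  have rk: "norm (of_real (r ^ Suc k) :: complex) < 1" for k
  proof -
    have "\<bar>r ^ Suc k\<bar> < 1" using r power_decreasing[of 1 "Suc k" r] by (simp del: power_Suc)
    then show ?thesis by (simp only: norm_of_real)
  qed
  have inner1: "((\<lambda>a. \<theta> (k, a)) has_sum (G1 (of_real (r ^ Suc k)) / of_nat (Suc k))) UNIV" for k
  proof (rule norm_summable_imp_has_sum)
    show "(\<lambda>a. \<theta> (k, a)) sums (G1 (of_real (r ^ Suc k)) / of_nat (Suc k))"
      unfolding \<theta>_def prod.case of_real_power[of "r ^ Suc k"] by (intro sums_divide G1_sums rk)
    show "summable (\<lambda>a. norm (\<theta> (k, a)))"
      by (rule summable_comparison_test'[OF summable_geometric_products(2)[of r k]]) (use r n1 in auto)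
  qed
  have "(\<theta> has_sum S) (Sigma UNIV (\<lambda>_. UNIV))" using S by simp
  from has_sum_Sigma'[OF this inner1]
  have "(\<lambda>k. G1 (of_real (r ^ Suc k)) / of_nat (Suc k)) sums S" by (rule has_sum_imp_sums)
  moreover have "G1 (of_real (r ^ Suc k)) = g1 (of_nat (Suc k) * of_real x)" for k
  proof -
    have "exp (- (of_nat (Suc k) * of_real x)) = (of_real (r ^ Suc k) :: complex)"
    proof -
      have "r ^ Suc k = exp (real (Suc k) * (- x))" unfolding r_def by (rule exp_of_nat_mult[symmetric])
      then show ?thesis by (simp flip: exp_of_real)
    qed
    then show ?thesis using x by (subst g1_eq) auto
  qed
  ultimately have DS: "dilation_sum g1 (of_real x) = S"
    by (simp add: dilation_sum_def sums_iff del: of_nat_Suc)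
  have "((\<lambda>(a, k). \<theta> (k, a)) has_sum S) UNIV"
    using S by (subst has_sum_reindex_bij_witness[of _ prod.swap prod.swap _ \<theta> _ S S]) auto
  then have sw: "((\<lambda>(a, k). \<theta> (k, a)) has_sum S) (Sigma UNIV (\<lambda>_. UNIV))" by simp
  have inner2: "((\<lambda>k. case (a, k) of (a, k) \<Rightarrow> \<theta> (k, a)) has_sum
      of_real (real_of_int (chi (Suc a)) * (- ln (1 - exp (- (real (Suc a) * x)))))) UNIV" for a
  proof (rule norm_summable_imp_has_sum)
    define q where "q = exp (- (real (Suc a) * x))"
    have q: "0 < q" "q < 1" using x by (auto simp: q_def)
    have rq: "(r ^ Suc k) ^ Suc a = q ^ Suc k" for k
    proof -
      have "q = r ^ Suc a" unfolding r_def q_def using exp_of_nat_mult[of "Suc a" "- x"] by simp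
      then show ?thesis by (simp only: power_mult[symmetric] mult.commute)
    qed
    have "(\<lambda>k. (of_real q) ^ Suc k / of_nat (Suc k)) sums (of_real (- ln (1 - q)) :: complex)"
      using sums_of_real[OF log_series_real[OF q], where 'a = complex] by (simp del: of_nat_Suc power_Suc)
    then have "(\<lambda>k. of_int (chi (Suc a)) * ((of_real q) ^ Suc k / of_nat (Suc k))) sums
        (of_int (chi (Suc a)) * of_real (- ln (1 - q)) :: complex)" by (rule sums_mult)
    then show "(\<lambda>k. case (a, k) of (a, k) \<Rightarrow> \<theta> (k, a)) sums
        of_real (real_of_int (chi (Suc a)) * (- ln (1 - exp (- (real (Suc a) * x)))))"
      unfolding \<theta>_def prod.case rq q_def[symmetric] by (simp del: of_nat_Suc power_Suc)
    show "summable (\<lambda>k. norm (case (a, k) of (a, k) \<Rightarrow> \<theta> (k, a)))"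
    proof (rule summable_comparison_test')
      show "summable (\<lambda>k. q * q ^ k)" by (intro summable_mult summable_geometric) (use q in simp)
      show "norm (norm (case (a, k) of (a, k) \<Rightarrow> \<theta> (k, a))) \<le> q * q ^ k" for k
        using n1[of k a] unfolding rq by simp
    qed
  qed
  from has_sum_Sigma'[OF sw inner2]
  have "(\<lambda>a. of_real (real_of_int (chi (Suc a)) * (- ln (1 - exp (- (real (Suc a) * x)))))) sums S"
    by (rule has_sum_imp_sums)
  from sums_Re[OF this] sums_Im[OF this]
  have re: "(\<lambda>a. real_of_int (chi (Suc a)) * (- ln (1 - exp (- (real (Suc a) * x))))) sums Re S"
    and im: "(\<lambda>a::nat. 0) sums Im S" by (simp_all only: Re_complex_of_real Im_complex_of_real)
  have "Im S = 0" using im sums_unique2 sums_zero by blast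
  then show "dilation_sum g1 (of_real x) = of_real U" by (simp add: U_def DS complex_eq_iff)
  show "(\<lambda>a. real_of_int (chi a) * (- ln (1 - exp (- (real a * x))))) sums U"
    using re by (subst (asm) sums_Suc_iff) (simp add: chi_0 U_def DS)
qed

abbreviation L1 :: real where
  "L1 \<equiv> dirichlet_L 1 (legendre_char p)"

lemma log_sine_sum_eq: "- log_sine_sum / 2 = sqrt (real p) * L1 / 2"
  using p_pos by (simp add: L_value)

lemma odd_part_asymptotics:
  obtains K where "0 \<le> K" "\<And>t. t \<in> sector \<Longrightarrow> t \<noteq> 0 \<Longrightarrow>
    norm (dilation_sum g1 t - of_real (sqrt (real p) * L1 / 2)) \<le> K * (norm t + 1) * norm t"
proof -
  have "((\<lambda>x. Re (dilation_sum g1 (of_real x))) \<longlongrightarrow> sqrt (real p) * L1 / 2) (at_right 0)"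
    unfolding log_sine_sum_eq[symmetric]
    by (rule chi_log_series_limit) (rule g1_dilation_real)
  then have "((\<lambda>x. of_real (Re (dilation_sum g1 (of_real x)))) \<longlongrightarrow> (of_real (sqrt (real p) * L1 / 2) :: complex)) (at_right 0)"
    by (rule tendsto_of_real)
  moreover have "\<forall>\<^sub>F x in at_right 0. of_real (Re (dilation_sum g1 (of_real x))) = dilation_sum g1 (of_real x)"
    using eventually_at_right_less[of "0::real"]
    by eventually_elim (simp add: g1_dilation_real(1)[symmetric])
  ultimately have lim: "((\<lambda>x. dilation_sum g1 (of_real x)) \<longlongrightarrow> of_real (sqrt (real p) * L1 / 2)) (at_right 0)"
    by (rule Lim_transform_eventually)
  have hol: "g1 holomorphic_on wide_sector (1 / real p)"
  proof (rule holomorphic_on_subset[OF g1_holomorphic])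
    have "1 / real p \<le> 2 / real p" by (intro divide_right_mono) auto
    then show "wide_sector (1 / real p) \<subseteq> wide_sector (2 / real p)" unfolding wide_sector_def by force
  qed
  obtain C where C: "\<And>t. t \<in> wide_sector (1 / real p) \<Longrightarrow> norm (g1 t) * (1 + norm t) \<le> C"
    using g1_bound by blast
  have "0 < 1 / real p" using p_pos by simp
  from dilation_sum_limit[OF hol this g1_0 C lim] show ?thesis using that by blast
qed

lemma g1_odd_multiple:
  assumes t: "0 < Re t"
  shows "g1 (of_nat (2 * j + 1) * t) = G1 (exp (- t) ^ (2 * j + 1))"
proof -
  have "0 < Re (of_nat (2 * j + 1) * t)" using t by (simp add: add_pos_nonneg)
  then have "g1 (of_nat (2 * j + 1) * t) = G1 (exp (- (of_nat (2 * j + 1) * t)))" by (rule g1_eq)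
  also have "exp (- (of_nat (2 * j + 1) * t)) = exp (- t) ^ (2 * j + 1)"
    using exp_of_nat_mult[of "2 * j + 1" "- t"] by simp
  finally show ?thesis .
qed

definition odd_sum :: "complex \<Rightarrow> complex" where
  "odd_sum t = (\<Sum>j. g1 (of_nat (2 * j + 1) * t) / of_nat (2 * j + 1))"

lemma odd_sum_summable:
  assumes t: "0 < Re t"
  shows "summable (\<lambda>j. g1 (of_nat (2 * j + 1) * t) / of_nat (2 * j + 1))"
proof -
  show ?thesis
    unfolding g1_odd_multiple[OF t] using summable_norm_cancel[OF odd_even_summable(2)[of "exp (- t)"]] t by simp
qed

text \<open>The even multiples of \<open>t\<close> in the dilation sum make up half of the dilation
  sum at \<open>2 * t\<close>. If \<open>l\<close> is the limit of the full sum,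
  \<open>odd_sum\<close> therefore tends to \<open>l / 2\<close>.\<close>

lemma odd_sum_eq:
  assumes t: "t \<in> sector" "t \<noteq> 0"
  shows "odd_sum t = dilation_sum g1 t - dilation_sum g1 (2 * t) / 2"
proof -
  obtain C where C: "\<And>t. t \<in> sector \<Longrightarrow> norm (g1 t) * (1 + norm t) \<le> C" using g1_sector_bound by blast
  have t2: "2 * t \<in> sector" "2 * t \<noteq> 0" using of_nat_mult_sector[OF t(1), of 2] t by auto
  have 1: "(\<lambda>j. g1 (of_nat (2 * j + 1) * t) / of_nat (2 * j + 1)) sums odd_sum t"
    unfolding odd_sum_def by (intro summable_sums odd_sum_summable sector_Re_pos t)
  have "(\<lambda>j. g1 (of_nat (Suc j) * (2 * t)) / of_nat (Suc j)) sums dilation_sum g1 (2 * t)"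
    unfolding dilation_sum_def by (rule summable_sums[OF summable_norm_cancel[OF dilation_sum_summable[OF C t2]]])
  from sums_divide[OF this, of 2]
  have "(\<lambda>j. g1 (of_nat (Suc j) * (2 * t)) / of_nat (Suc j) / 2) sums (dilation_sum g1 (2 * t) / 2)" .
  from sums_interleave[OF 1 this]
  have "(\<lambda>n. if even n then g1 (of_nat (2 * (n div 2) + 1) * t) / of_nat (2 * (n div 2) + 1)
      else g1 (of_nat (Suc ((n - 1) div 2)) * (2 * t)) / of_nat (Suc ((n - 1) div 2)) / 2)
    sums (dilation_sum g1 (2 * t) / 2 + odd_sum t)" .
  moreover have "(if even n then g1 (of_nat (2 * (n div 2) + 1) * t) / of_nat (2 * (n div 2) + 1)
      else g1 (of_nat (Suc ((n - 1) div 2)) * (2 * t)) / of_nat (Suc ((n - 1) div 2)) / 2) = g1 (of_nat (Suc n) * t) / of_nat (Suc n)" for n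
  proof (cases "even n")
    case True
    then have "2 * (n div 2) + 1 = Suc n" by simp
    then show ?thesis using True by (simp only: if_True)
  next
    case False
    define m where "m = Suc ((n - 1) div 2)"
    have m: "2 * m = Suc n" using False by (auto simp: m_def elim!: oddE)
    have "g1 (of_nat m * (2 * t)) / of_nat m / 2 = g1 (of_nat (2 * m) * t) / of_nat (2 * m)"
      by (simp add: mult_ac)
    then show ?thesis using False unfolding m m_def[symmetric] by (simp only: if_False)
  qed
  ultimately have "(\<lambda>n. g1 (of_nat (Suc n) * t) / of_nat (Suc n)) sums (dilation_sum g1 (2 * t) / 2 + odd_sum t)"
    by simp
  then show ?thesis by (simp add: dilation_sum_def sums_iff)
qed

definition saddle_const :: real where
  "saddle_const = pi^2 * (1 - 1 / real p) / 24"

text \<open>Even powers do not distinguish \<open>exp (- t)\<close> from \<open>- exp (- t)\<close>.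
  With \<open>s = 2 j t\<close>, the identity
  \<open>1 / (1 - exp (- s)) = 1 + 1 / (exp s - 1)\<close> lets the ones cancel in
  \<open>G0\<close>. The polar parts \<open>1 / s - 1 / (p s)\<close>, divided by
  \<open>2 j\<close>, sum to \<open>saddle_const / t\<close> through \<open>pi^2 / 6\<close>; the
  rest is a dilation sum.\<close>

lemma even_sum_eq:
  assumes t: "t \<in> sector" "t \<noteq> 0" and z: "z = exp (- t) \<or> z = - exp (- t)"
  shows "(\<Sum>j. G0 (z ^ (2 * Suc j)) / of_nat (2 * Suc j)) =
    dilation_sum (\<lambda>t. psi t - psi (of_nat p * t)) (2 * t) / 2 + of_real saddle_const / t"
proof -
  let ?h = "\<lambda>t. psi t - psi (of_nat p * t)"
  have t2: "2 * t \<in> sector" "2 * t \<noteq> 0" using of_nat_mult_sector[OF t(1), of 2] t by auto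
  have Re: "0 < Re t" by (rule sector_Re_pos[OF t])
  have p2: "2 \<le> p" using p_ge_13 by simp
  have "summable (\<lambda>j. norm ((psi (of_nat (Suc j) * (2 * t)) - psi (of_nat p * (of_nat (Suc j) * (2 * t)))) / of_nat (Suc j)))"
    by (rule even_part_asymptotics[OF p2]) (use t2 in blast)
  then have "(\<lambda>j. ?h (of_nat (Suc j) * (2 * t)) / of_nat (Suc j)) sums dilation_sum ?h (2 * t)"
    unfolding dilation_sum_def by (rule summable_sums[OF summable_norm_cancel])
  from sums_divide[OF this, of 2]
  have 1: "(\<lambda>j. ?h (of_nat (Suc j) * (2 * t)) / of_nat (Suc j) / 2) sums (dilation_sum ?h (2 * t) / 2)" .
  have "(\<lambda>j. 1 / (real (Suc j))^2) sums (pi^2 / 6)" using inverse_squares_sums by (simp add: algebra_simps)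
  from sums_of_real[OF this, where 'a = complex]
  have "(\<lambda>j. of_real (1 / (real (Suc j))^2)) sums (of_real (pi^2 / 6) :: complex)" .
  from sums_mult[OF this, of "of_real ((1 - 1 / real p) / 4) / t"]
  have 2: "(\<lambda>j. of_real ((1 - 1 / real p) / 4) / t * of_real (1 / (real (Suc j))^2)) sums (of_real ((1 - 1 / real p) / 4) / t * of_real (pi^2 / 6))" .
  have "of_real ((1 - 1 / real p) / 4) / t * of_real (pi^2 / 6) = of_real saddle_const / t"
    by (simp add: saddle_const_def)
  with sums_add[OF 1 2]
  have "(\<lambda>j. ?h (of_nat (Suc j) * (2 * t)) / of_nat (Suc j) / 2 + of_real ((1 - 1 / real p) / 4) / t * of_real (1 / (real (Suc j))^2))
    sums (dilation_sum ?h (2 * t) / 2 + of_real saddle_const / t)" by simp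
  moreover have "?h (of_nat (Suc j) * (2 * t)) / of_nat (Suc j) / 2 + of_real ((1 - 1 / real p) / 4) / t * of_real (1 / (real (Suc j))^2)
      = G0 (z ^ (2 * Suc j)) / of_nat (2 * Suc j)" for j
  proof -
    define m where "m = (of_nat (Suc j) :: complex)"
    have m0: "m \<noteq> 0" by (simp add: m_def del: of_nat_Suc)
    define s where "s = m * (2 * t)"
    have s0: "s \<noteq> 0" using m0 t by (simp add: s_def)
    have Res: "0 < Re s" using Re by (simp add: s_def m_def del: of_nat_Suc)
    have ps0: "of_nat p * s \<noteq> 0" using s0 p_pos by simp
    have "z ^ 2 = exp (- t) ^ 2" using z by auto
    also have "\<dots> = exp (- (2 * t))" using exp_of_nat_mult[of 2 "- t"] by simp
    finally have z2: "z ^ 2 = exp (- (2 * t))" .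
    have zs: "z ^ (2 * Suc j) = exp (- s)"
      unfolding power_mult z2 s_def m_def using exp_of_nat_mult[of "Suc j" "- (2 * t)"] by simp
    have zp: "exp (- s) ^ p = exp (- (of_nat p * s))" using exp_of_nat_mult[of p "- s"] by simp
    have f: "1 / (1 - exp (- u)) = 1 + 1 / (exp u - 1)" if "0 < Re u" for u :: complex
    proof -
      have "exp u \<noteq> 1" using that by (metis norm_exp_eq_Re norm_one exp_eq_one_iff less_irrefl)
      then show ?thesis by (simp add: exp_minus field_simps)
    qed
    have "0 < Re (of_nat p * s)" using Res p_pos by simp
    then have "G0 (z ^ (2 * Suc j)) = 1 / (exp s - 1) - 1 / (exp (of_nat p * s) - 1)"
      unfolding G0_def zs zp using f[OF Res] f[of "of_nat p * s"] by simp
    also have "\<dots> = ?h s + (1 / s - 1 / (of_nat p * s))" using s0 ps0 by (simp add: psi_def)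
    also have "1 / s - 1 / (of_nat p * s) = of_real (1 - 1 / real p) / s" using s0 p_pos by (simp add: field_simps)
    finally have G: "G0 (z ^ (2 * Suc j)) = ?h s + of_real (1 - 1 / real p) / s" .
    have "of_real (1 - 1 / real p) / s / (2 * m) = of_real ((1 - 1 / real p) / 4) / t * of_real (1 / (real (Suc j))^2)"
    proof -
      define c where "c = complex_of_real (1 - 1 / real p)"
      have 1: "of_real ((1 - 1 / real p) / 4) = c / 4" unfolding c_def by (metis of_real_divide of_real_numeral)
      have 2: "of_real (1 / (real (Suc j))^2) = 1 / m^2" by (simp add: m_def del: of_nat_Suc)
      have "c / s / (2 * m) = c / 4 / t * (1 / m^2)" by (simp add: s_def power2_eq_square mult_ac)
      then show ?thesis unfolding 1 2 c_def[symmetric] .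
    qed
    moreover have "of_nat (2 * Suc j) = 2 * m" by (simp add: m_def)
    ultimately show ?thesis unfolding G m_def[symmetric] s_def[symmetric]
      by (simp only: add_divide_distrib) (simp add: field_simps)
  qed
  ultimately show ?thesis by (simp add: sums_iff)
qed

lemma odd_part_plus:
  assumes t: "0 < Re t"
  shows "(\<Sum>j. G1 (exp (- t) ^ (2 * j + 1)) / of_nat (2 * j + 1)) = odd_sum t"
  unfolding odd_sum_def g1_odd_multiple[OF t] ..

lemma odd_part_minus:
  assumes t: "0 < Re t"
  shows "(\<Sum>j. G1 ((- exp (- t)) ^ (2 * j + 1)) / of_nat (2 * j + 1)) = - odd_sum t + 2 * of_int (chi 2) * odd_sum (2 * t)"
proof -
  have t2: "0 < Re (2 * t)" using t by simp
  have e: "G1 ((- exp (- t)) ^ (2 * j + 1)) / of_nat (2 * j + 1) =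
      - (g1 (of_nat (2 * j + 1) * t) / of_nat (2 * j + 1)) +
      2 * of_int (chi 2) * (g1 (of_nat (2 * j + 1) * (2 * t)) / of_nat (2 * j + 1))" for j
  proof -
    let ?m = "2 * j + 1"
    let ?w = "exp (- (of_nat ?m * t))"
    have R: "0 < Re (of_nat ?m * t)" "0 < Re (of_nat ?m * (2 * t))" using t by (simp_all add: add_pos_nonneg)
    then have nw: "norm ?w < 1" by (simp only: norm_exp_eq_Re) simp
    have "(- exp (- t)) ^ ?m = - (exp (- t) ^ ?m)" by simp
    also have "exp (- t) ^ ?m = ?w" using exp_of_nat_mult[of ?m "- t"] by simp
    finally have "G1 ((- exp (- t)) ^ ?m) = - G1 ?w + 2 * of_int (chi 2) * G1 (?w^2)"
      using G1_minus[OF nw] by simp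
    moreover have "?w ^ 2 = exp (- (of_nat ?m * (2 * t)))"
      using exp_of_nat_mult[of 2 "- (of_nat ?m * t)"] by (simp add: mult_ac)
    ultimately have "G1 ((- exp (- t)) ^ ?m) = - g1 (of_nat ?m * t) + 2 * of_int (chi 2) * g1 (of_nat ?m * (2 * t))"
      using g1_eq[OF R(1)] g1_eq[OF R(2)] by simp
    then show ?thesis by (simp only: add_divide_distrib minus_divide_left times_divide_eq_right)
  qed
  have "(\<lambda>j. G1 ((- exp (- t)) ^ (2 * j + 1)) / of_nat (2 * j + 1)) sums (- odd_sum t + 2 * of_int (chi 2) * odd_sum (2 * t))"
    unfolding e odd_sum_def
    by (intro sums_add sums_minus sums_mult summable_sums odd_sum_summable t t2)
  then show ?thesis by (simp add: sums_iff)
qed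

text \<open>The even part contributes \<open>- ln p / 4\<close> at both points. With
  \<open>l = sqrt p L(1, chi) / 2\<close>, the odd part tends to \<open>l / 2\<close> at
  \<open>1\<close> and, by \<open>odd_part_minus\<close>, to \<open>(2 chi(2) - 1) l / 2\<close> at
  \<open>- 1\<close>, that is, to \<open>l / 2\<close> or \<open>- 3 l / 2\<close>.\<close>

lemma Lam_asymptotics:
  obtains K where "0 \<le> K"
    "\<And>t. t \<in> sector \<Longrightarrow> t \<noteq> 0 \<Longrightarrow> norm t \<le> 1 \<Longrightarrow>
      norm (Lam (exp (- t)) - of_real saddle_const / t - of_real (- ln (real p) / 4 + sqrt (real p) * L1 / 4)) \<le> K * norm t"
    "\<And>t. t \<in> sector \<Longrightarrow> t \<noteq> 0 \<Longrightarrow> norm t \<le> 1 \<Longrightarrow>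
      norm (Lam (- exp (- t)) - of_real saddle_const / t
        - of_real (- ln (real p) / 4 + (2 * real_of_int (chi 2) - 1) * (sqrt (real p) * L1 / 4))) \<le> K * norm t"
proof -
  let ?h = "\<lambda>t. psi t - psi (of_nat p * t)"
  let ?l = "sqrt (real p) * L1 / 2"
  have p2: "2 \<le> p" using p_ge_13 by simp
  obtain K1 where K1: "0 \<le> K1" "\<And>t. t \<in> sector \<Longrightarrow> t \<noteq> 0 \<Longrightarrow>
    norm (dilation_sum ?h t - of_real (- ln (real p) / 2)) \<le> K1 * (norm t + 1) * norm t"
    by (rule even_part_asymptotics[OF p2]) blast
  obtain K2 where K2: "0 \<le> K2" "\<And>t. t \<in> sector \<Longrightarrow> t \<noteq> 0 \<Longrightarrow>
    norm (dilation_sum g1 t - of_real ?l) \<le> K2 * (norm t + 1) * norm t"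
    by (rule odd_part_asymptotics) blast
  \<comment> \<open>The range up to \<open>4\<close> is needed because the odd part at
    \<open>- 1\<close> involves \<open>odd_sum (2 * t)\<close>, and thus the dilation sum at
    \<open>4 t\<close>.\<close>
  have small: "K' * (norm t + 1) * norm t \<le> K' * 5 * norm t" if "norm t \<le> 4" "0 \<le> K'" for t :: complex and K'
    using that by (intro mult_right_mono mult_left_mono) auto
  have odd: "norm (odd_sum t - of_real (?l / 2)) \<le> 10 * K2 * norm t" if t: "t \<in> sector" "t \<noteq> 0" "norm t \<le> 2" for t
  proof -
    have t2: "2 * t \<in> sector" "2 * t \<noteq> 0" using of_nat_mult_sector[OF t(1), of 2] t by auto
    have "odd_sum t - of_real (?l / 2) = (dilation_sum g1 t - of_real ?l) - (dilation_sum g1 (2 * t) - of_real ?l) / 2"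
      by (simp add: odd_sum_eq[OF t(1,2)] field_simps)
    also have "norm \<dots> \<le> norm (dilation_sum g1 t - of_real ?l) + norm (dilation_sum g1 (2 * t) - of_real ?l) / 2"
      by (rule order_trans[OF norm_triangle_ineq4]) (simp add: norm_divide)
    also have "\<dots> \<le> K2 * 5 * norm t + (K2 * 5 * norm (2 * t)) / 2"
    proof (intro add_mono divide_right_mono)
      show "norm (dilation_sum g1 t - of_real ?l) \<le> K2 * 5 * norm t"
        using K2(2)[OF t(1,2)] small[of t K2] t K2(1) by linarith
      have "norm (2 * t) \<le> 4" using t by (simp add: norm_mult)
      then show "norm (dilation_sum g1 (2 * t) - of_real ?l) \<le> K2 * 5 * norm (2 * t)"
        using K2(2)[OF t2] small[of "2 * t" K2] K2(1) by linarith
    qed simp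
    finally show ?thesis by (simp add: norm_mult)
  qed
  have even: "norm (dilation_sum ?h (2 * t) / 2 - of_real (- ln (real p) / 4)) \<le> 5 * K1 * norm t"
    if t: "t \<in> sector" "t \<noteq> 0" "norm t \<le> 1" for t
  proof -
    have t2: "2 * t \<in> sector" "2 * t \<noteq> 0" using of_nat_mult_sector[OF t(1), of 2] t by auto
    have "dilation_sum ?h (2 * t) / 2 - of_real (- ln (real p) / 4) = (dilation_sum ?h (2 * t) - of_real (- ln (real p) / 2)) / 2"
      by (simp add: field_simps)
    also have "norm \<dots> = norm (dilation_sum ?h (2 * t) - of_real (- ln (real p) / 2)) / 2"
      by (simp only: norm_divide norm_numeral)
    also have "\<dots> \<le> (K1 * 5 * norm (2 * t)) / 2"
    proof (intro divide_right_mono)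
      have "norm (2 * t) \<le> 4" using t by (simp add: norm_mult)
      then show "norm (dilation_sum ?h (2 * t) - of_real (- ln (real p) / 2)) \<le> K1 * 5 * norm (2 * t)"
        using K1(2)[OF t2] small[of "2 * t" K1] K1(1) by linarith
    qed simp
    finally show ?thesis by (simp add: norm_mult)
  qed
  define K where "K = 5 * K1 + 50 * K2"
  show ?thesis
  proof (rule that[of K])
    show "0 \<le> K" using K1 K2 by (simp add: K_def)
    fix t assume t: "t \<in> sector" "t \<noteq> 0" "norm t \<le> 1"
    have Re: "0 < Re t" by (rule sector_Re_pos[OF t(1,2)])
    have t2: "2 * t \<in> sector" "2 * t \<noteq> 0" "norm (2 * t) \<le> 2"
      using of_nat_mult_sector[OF t(1), of 2] t by (auto simp: norm_mult)
    have nz: "norm (exp (- t)) < 1" "norm (- exp (- t)) < 1" using Re by simp_all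
    have n0: "0 \<le> norm t * K2" using K2 by simp
    have "Lam (exp (- t)) - of_real saddle_const / t - of_real (- ln (real p) / 4 + sqrt (real p) * L1 / 4) =
        (dilation_sum ?h (2 * t) / 2 - of_real (- ln (real p) / 4)) + (odd_sum t - of_real (?l / 2))"
      unfolding Lam_split[OF nz(1)] odd_part_plus[OF Re] even_sum_eq[OF t(1,2) disjI1[OF refl]] by simp
    also have "norm \<dots> \<le> 5 * K1 * norm t + 10 * K2 * norm t"
      by (rule norm_triangle_le, intro add_mono even odd) (use t in auto)
    also have "\<dots> \<le> K * norm t" using n0 by (simp add: K_def algebra_simps)
    finally show "norm (Lam (exp (- t)) - of_real saddle_const / t - of_real (- ln (real p) / 4 + sqrt (real p) * L1 / 4)) \<le> K * norm t" .
    have "Lam (- exp (- t)) - of_real saddle_const / t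
        - of_real (- ln (real p) / 4 + (2 * real_of_int (chi 2) - 1) * (sqrt (real p) * L1 / 4)) =
        (dilation_sum ?h (2 * t) / 2 - of_real (- ln (real p) / 4)) - (odd_sum t - of_real (?l / 2))
          + 2 * of_int (chi 2) * (odd_sum (2 * t) - of_real (?l / 2))"
      unfolding Lam_split[OF nz(2)] odd_part_minus[OF Re] even_sum_eq[OF t(1,2) disjI2[OF refl]]
      by (simp add: field_simps)
    also have "norm \<dots> \<le> (5 * K1 * norm t + 10 * K2 * norm t) + 2 * (10 * K2 * norm (2 * t))"
    proof (rule norm_triangle_le, rule add_mono)
      show "norm ((dilation_sum ?h (2 * t) / 2 - of_real (- ln (real p) / 4)) - (odd_sum t - of_real (?l / 2)))
          \<le> 5 * K1 * norm t + 10 * K2 * norm t"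
        by (rule order_trans[OF norm_triangle_ineq4], intro add_mono even odd) (use t in auto)
      have "norm (2 * of_int (chi 2) * (odd_sum (2 * t) - of_real (?l / 2))) =
          2 * norm (of_int (chi 2) :: complex) * norm (odd_sum (2 * t) - of_real (?l / 2))" by (simp only: norm_mult norm_numeral)
      also have "\<dots> \<le> 2 * 1 * (10 * K2 * norm (2 * t))"
        by (intro mult_mono norm_chi_le odd t2) auto
      finally show "norm (2 * of_int (chi 2) * (odd_sum (2 * t) - of_real (?l / 2))) \<le> 2 * (10 * K2 * norm (2 * t))" by simp
    qed
    also have "\<dots> \<le> K * norm t" by (simp add: K_def norm_mult algebra_simps)
    finally show "norm (Lam (- exp (- t)) - of_real saddle_const / t
        - of_real (- ln (real p) / 4 + (2 * real_of_int (chi 2) - 1) * (sqrt (real p) * L1 / 4))) \<le> K * norm t" .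
  qed
qed

end

section \<open>Minor arcs\<close>

text \<open>The map \<open>v -> 1 / (1 - v)\<close> takes the unit disc to the half plane
  \<open>Re > 1/2\<close>.\<close>

lemma Re_inverse_one_minus_ge:
  assumes "norm v < 1"
  shows "1/2 \<le> Re (1 / (1 - v))"
proof -
  have n2: "(norm (1 - v))^2 = 1 - 2 * Re v + (norm v)^2"
    by (simp only: cmod_power2) (simp add: power2_eq_square algebra_simps)
  have "(norm v)^2 \<le> 1" using assms by (simp add: power_le_one)
  then have le: "(norm (1 - v))^2 \<le> 2 * (1 - Re v)" using n2 by simp
  have "1 - v \<noteq> 0" using assms by auto
  then have pos: "0 < (norm (1 - v))^2" by simp
  have "Re (1 / (1 - v)) = (1 - Re v) / (norm (1 - v))^2"
    by (simp add: Re_divide cmod_power2)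
  also have "\<dots> \<ge> 1/2" using le pos by (simp add: field_simps)
  finally show ?thesis .
qed

text \<open>A bound proportional to \<open>norm v\<close> is needed so that the errors can be summed
  over the powers of \<open>z\<close>. For small \<open>v\<close> it comes from the triangle
  inequality; otherwise the lower bound \<open>- 1/2\<close> is already good enough.\<close>

lemma Re_geometric_ge:
  assumes "norm v < 1"
  shows "- 2 * norm v \<le> Re (v / (1 - v))"
proof (cases "norm v < 1/4")
  case True
  have "norm (v / (1 - v)) \<le> norm v / (1/2)"
    using norm_triangle_ineq2[of 1 v] True unfolding norm_divide by (intro frac_le) auto
  then show ?thesis using abs_Re_le_cmod[of "v / (1 - v)"] by simp
next
  case False
  have "1 - v \<noteq> 0" using assms by auto
  then have "v / (1 - v) = 1 / (1 - v) - 1" by (simp add: field_simps)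
  then have "Re (v / (1 - v)) = Re (1 / (1 - v)) - 1" by simp
  then show ?thesis using Re_inverse_one_minus_ge[OF assms] False by linarith
qed

lemma norm_geometric_le:
  assumes "norm w = exp (- u)" "0 < u"
  shows "norm w / (1 - norm w) \<le> 1 / u"
proof -
  have "norm w / (1 - norm w) = 1 / (exp u - 1)"
  proof -
    have "1 < exp u" using assms by simp
    moreover have "norm w = 1 / exp u" using assms by (simp add: exp_minus inverse_eq_divide)
    moreover have "norm w < 1" using assms by simp
    ultimately show ?thesis by (simp add: field_simps)
  qed
  also have "\<dots> \<le> 1 / u"
  proof (rule divide_left_mono)
    show "u \<le> exp u - 1" using exp_ge_add_one_self[of u] by linarith
    then show "0 < (exp u - 1) * u" using assms by (intro mult_pos_pos) auto
  qed simp
  finally show ?thesis .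
qed

lemma sums_odd_inverse_squares: "(\<lambda>j. 1 / (real (2 * j + 1))^2) sums (pi^2 / 8)"
proof -
  have all: "(\<lambda>n. 1 / (real (Suc n))^2) sums (pi^2 / 6)"
    using inverse_squares_sums by (simp add: algebra_simps)
  have so: "summable (\<lambda>j. 1 / (real (2 * j + 1))^2)"
    by (rule summable_comparison_test'[OF summable_inverse_Suc_square])
       (auto intro!: divide_left_mono power_mono)
  then have 1: "(\<lambda>j. 1 / (real (2 * j + 1))^2) sums (\<Sum>j. 1 / (real (2 * j + 1))^2)" by (rule summable_sums)
  have 2: "(\<lambda>j. 1 / (real (2 * Suc j))^2) sums (pi^2 / 6 / 4)"
  proof -
    have "1 / (real (2 * Suc j))^2 = 1 / (real (Suc j))^2 / 4" for j
      by (simp only: of_nat_mult power_mult_distrib) (simp del: of_nat_Suc)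
    then show ?thesis using sums_divide[OF all, of 4] by (simp only:)
  qed
  have "(if even n then 1 / (real (2 * (n div 2) + 1))^2 else 1 / (real (2 * Suc ((n - 1) div 2)))^2) = 1 / (real (Suc n))^2" for n
  proof (cases "even n")
    case True
    then have "2 * (n div 2) + 1 = Suc n" by simp
    then show ?thesis using True by (simp only: if_True)
  next
    case False
    then have "2 * Suc ((n - 1) div 2) = Suc n" by (auto elim!: oddE)
    then show ?thesis using False by (simp only: if_False)
  qed
  with sums_interleave[OF 1 2]
  have "(\<lambda>n. 1 / (real (Suc n))^2) sums (pi^2 / 6 / 4 + (\<Sum>j. 1 / (real (2 * j + 1))^2))" by simp
  from sums_unique2[OF this all] have "(\<Sum>j. 1 / (real (2 * j + 1))^2) = pi^2 / 8" by linarith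
  then show ?thesis using 1 by (simp only:)
qed

text \<open>Twelve terms of the series for \<open>pi^2 / 6\<close> and a telescoping tail bound
  \<open>1/12\<close>. The numerical inequalities of the minor arcs leave little room, so a crude
  bound such as \<open>pi < 4\<close> would not do.\<close>

lemma pi_square_le: "pi^2 \<le> 989/100"
proof -
  have all: "(\<lambda>n. 1 / (real (Suc n))^2) sums (pi^2 / 6)"
    using inverse_squares_sums by (simp add: algebra_simps)
  have "(\<Sum>n<12+k. 1 / (real (Suc n))^2) \<le> (\<Sum>n<12. 1 / (real (Suc n))^2) + 1/12 - 1 / real (12 + k)" for k
  proof (induction k)
    case (Suc k)
    have "1 / (real (Suc (12 + k)))^2 \<le> 1 / real (12 + k) - 1 / real (Suc (12 + k))"
    proof -
      have "1 / (m + 1)^2 \<le> 1 / m - 1 / (m + 1)" if "0 < m" for m :: real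
      proof -
        have "1 / (m + 1)^2 \<le> 1 / (m * (m + 1))"
          using that by (intro divide_left_mono) (auto simp: power2_eq_square)
        also have "\<dots> = 1 / m - 1 / (m + 1)" using that by (simp add: field_simps)
        finally show ?thesis .
      qed
      from this[of "real (12 + k)"] show ?thesis by (simp add: add_ac)
    qed
    then show ?case unfolding add_Suc_right sum.lessThan_Suc using Suc.IH by linarith
  qed simp
  then have "(\<Sum>n<12+k. 1 / (real (Suc n))^2) \<le> (\<Sum>n<12. 1 / (real (Suc n))^2) + 1/12" for k
    by (rule order_trans) simp
  then have le: "\<forall>n\<ge>12. (\<Sum>i<n. 1 / (real (Suc i))^2) \<le> (\<Sum>n<12. 1 / (real (Suc n))^2) + 1/12"
    by (metis le_Suc_ex)
  have "pi^2 / 6 \<le> (\<Sum>n<12. 1 / (real (Suc n))^2) + 1/12"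
    by (rule LIMSEQ_le_const2[OF all[unfolded sums_def]]) (use le in blast)
  also have "\<dots> \<le> 989/600" by (simp add: lessThan_nat_numeral lessThan_Suc)
  finally show ?thesis by simp
qed

text \<open>\<open>q\<close> records how the majorant \<open>b\<close> is changed in its first
  \<open>m\<close> terms; on the minor arcs the generic main part of order \<open>1 / x\<close> is
  there exchanged for a better bound.\<close>

lemma suminf_improved_bound:
  fixes e b q :: "nat \<Rightarrow> real"
  assumes e: "summable e" and b: "b sums s"
    and le: "\<And>j. e j \<le> b j" and imp: "\<And>j. j < m \<Longrightarrow> e j \<le> b j + q j"
  shows "suminf e \<le> s + (\<Sum>j<m. q j)"
proof -
  have "(\<lambda>j. if j \<in> {..<m} then q j else 0) sums (\<Sum>j<m. q j)" by (rule sums_If_finite_set) simp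
  from sums_add[OF b this] have "(\<lambda>j. b j + (if j \<in> {..<m} then q j else 0)) sums (s + (\<Sum>j<m. q j))" .
  moreover have "e j \<le> b j + (if j \<in> {..<m} then q j else 0)" for j using le imp by auto
  ultimately show ?thesis by (rule sums_le[OF _ summable_sums[OF e], rotated -1]) 
qed

context prime_1_mod_4
begin

section \<open>Separation of the roots of unity and bounds for \<open>G1\<close> and
  \<open>G0\<close>\<close>

definition zeta_gap :: real where
  "zeta_gap = Min ((\<lambda>h. norm (1 - zeta ^ h)) ` {1..<p})"

lemma zeta_gap_pos: "0 < zeta_gap"
proof -
  have "{1..<p} \<noteq> {}" using p_ge_13 by auto
  moreover have "0 < norm (1 - zeta ^ h)" if "h \<in> {1..<p}" for h
    using that zeta_eq_1_iff[of h] by (auto dest: dvd_imp_le)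
  ultimately show ?thesis unfolding zeta_gap_def by (subst Min_gr_iff) auto
qed

lemma zeta_gap_le:
  assumes "\<not> p dvd a"
  shows "zeta_gap \<le> norm (1 - zeta ^ a)"
proof -
  have "a mod p \<in> {1..<p}" using assms p_pos by (auto simp: Suc_le_eq dvd_eq_mod_eq_0)
  then have "zeta_gap \<le> norm (1 - zeta ^ (a mod p))" unfolding zeta_gap_def by (intro Min_le) auto
  then show ?thesis by (simp add: zeta_mod)
qed

text \<open>By rotation \<open>zeta_gap\<close> is the least distance between distinct
  \<open>p\<close>-th roots of unity, so \<open>w\<close> can be closer than half of it to at most
  one of them.\<close>

lemma zeta_gap_separated:
  assumes "h \<in> {1..<p}" "k \<in> {1..<p}" "h \<noteq> k" "norm (1 - zeta ^ k * w) < zeta_gap / 2"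
  shows "zeta_gap / 2 \<le> norm (1 - zeta ^ h * w)"
proof -
  have sep: "zeta_gap \<le> norm (zeta ^ a - zeta ^ b)" if "a < b" "b < p" for a b
  proof -
    have "\<not> p dvd b - a" using that by (auto dest: dvd_imp_le)
    then have "zeta_gap \<le> norm (1 - zeta ^ (b - a))" by (rule zeta_gap_le)
    also have "\<dots> = norm (zeta ^ a * (1 - zeta ^ (b - a)))" by (simp add: norm_mult norm_zeta)
    also have "zeta ^ a * (1 - zeta ^ (b - a)) = zeta ^ a - zeta ^ b"
      using that by (simp add: right_diff_distrib flip: power_add)
    finally show ?thesis .
  qed
  have shift: "norm (1 - zeta ^ h * w) = norm (zeta ^ (p - h) - w)" if "h \<in> {1..<p}" for h
  proof -
    have "norm (1 - zeta ^ h * w) = norm (zeta ^ (p - h) * (1 - zeta ^ h * w))" by (simp add: norm_mult norm_zeta)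
    also have "zeta ^ (p - h) * (1 - zeta ^ h * w) = zeta ^ (p - h) - (zeta ^ (p - h) * zeta ^ h) * w"
      by (simp add: algebra_simps)
    also have "zeta ^ (p - h) * zeta ^ h = 1" using that zeta_power_p by (simp flip: power_add)
    finally show ?thesis by simp
  qed
  have "zeta_gap \<le> norm (zeta ^ (p - h) - zeta ^ (p - k))"
  proof (cases "h < k")
    case True
    then have "p - k < p - h" "p - h < p" using assms by auto
    from sep[OF this] show ?thesis by (simp add: norm_minus_commute)
  next
    case False
    then have "p - h < p - k" "p - k < p" using assms by auto
    from sep[OF this] show ?thesis .
  qed
  also have "\<dots> \<le> norm (zeta ^ (p - h) - w) + norm (zeta ^ (p - k) - w)"
    using norm_triangle_ineq4[of "zeta ^ (p - h) - w" "zeta ^ (p - k) - w"] by simp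
  finally show ?thesis using assms shift[of h] shift[of k] by linarith
qed

text \<open>At most one summand can be large. The partial fractions of \<open>G1\<close> therefore
  cost one pole \<open>1 / (1 - norm w)\<close> and not \<open>p - 1\<close> of them, and the
  division by \<open>sqrt p\<close> is kept as a gain.\<close>

lemma sum_inverse_zeta_le:
  assumes w: "norm w < 1"
  shows "(\<Sum>h=1..<p. 1 / norm (1 - zeta ^ h * w)) \<le> 1 / (1 - norm w) + 2 * real p / zeta_gap"
proof -
  have low: "1 - norm w \<le> norm (1 - zeta ^ h * w)" for h
    using norm_triangle_ineq2[of 1 "zeta ^ h * w"] by (simp add: norm_mult norm_zeta)
  have far: "1 / norm (1 - zeta ^ h * w) \<le> 2 / zeta_gap" if "zeta_gap / 2 \<le> norm (1 - zeta ^ h * w)" for h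
  proof -
    have "1 / norm (1 - zeta ^ h * w) \<le> 1 / (zeta_gap / 2)"
      using that zeta_gap_pos by (intro divide_left_mono mult_pos_pos) auto
    then show ?thesis by simp
  qed
  have bound: "(\<Sum>h\<in>A. 1 / norm (1 - zeta ^ h * w)) \<le> 2 * real p / zeta_gap"
    if "A \<subseteq> {1..<p}" "\<And>h. h \<in> A \<Longrightarrow> zeta_gap / 2 \<le> norm (1 - zeta ^ h * w)" for A
  proof -
    have "(\<Sum>h\<in>A. 1 / norm (1 - zeta ^ h * w)) \<le> real (card A) * (2 / zeta_gap)"
      by (rule sum_bounded_above) (use far that in blast)
    also have "\<dots> \<le> real p * (2 / zeta_gap)"
      using zeta_gap_pos card_mono[OF _ that(1)] by (intro mult_right_mono) auto
    finally show ?thesis by (simp add: mult.commute)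
  qed
  show ?thesis
  proof (cases "\<exists>k\<in>{1..<p}. norm (1 - zeta ^ k * w) < zeta_gap / 2")
    case True
    then obtain k where k: "k \<in> {1..<p}" "norm (1 - zeta ^ k * w) < zeta_gap / 2" by blast
    have "(\<Sum>h=1..<p. 1 / norm (1 - zeta ^ h * w)) =
        1 / norm (1 - zeta ^ k * w) + (\<Sum>h\<in>{1..<p} - {k}. 1 / norm (1 - zeta ^ h * w))"
      using k by (intro sum.remove) auto
    also have "\<dots> \<le> 1 / (1 - norm w) + 2 * real p / zeta_gap"
    proof (rule add_mono)
      show "1 / norm (1 - zeta ^ k * w) \<le> 1 / (1 - norm w)"
        using low[of k] w by (intro divide_left_mono mult_pos_pos) auto
      show "(\<Sum>h\<in>{1..<p} - {k}. 1 / norm (1 - zeta ^ h * w)) \<le> 2 * real p / zeta_gap"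
        by (rule bound) (use zeta_gap_separated k in auto)
    qed
    finally show ?thesis .
  next
    case False
    then have "(\<Sum>h=1..<p. 1 / norm (1 - zeta ^ h * w)) \<le> 2 * real p / zeta_gap"
      by (intro bound) (auto simp: not_less)
    moreover have "0 \<le> 1 / (1 - norm w)" using w by simp
    ultimately show ?thesis by linarith
  qed
qed

text \<open>Since \<open>chi\<close> has sum \<open>0\<close>, each \<open>1 / (1 - v)\<close> may
  be replaced by \<open>v / (1 - v)\<close>. The factor \<open>norm w\<close> gained in this way
  makes the error terms for \<open>w = z ^ k\<close> decay geometrically in
  \<open>k\<close>.\<close>

lemma norm_G1_le_sum:
  assumes w: "norm w < 1"
  shows "norm (G1 w) \<le> norm w * (\<Sum>h=1..<p. 1 / norm (1 - zeta ^ h * w)) / sqrt (real p)"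
proof -
  have nz: "1 - zeta ^ h * w \<noteq> 0" for h
  proof
    assume "1 - zeta ^ h * w = 0"
    then have "norm (zeta ^ h * w) = 1" by simp
    then show False using w by (simp add: norm_mult norm_zeta)
  qed
  have "(\<Sum>h=1..<p. of_int (chi h) / (1 - zeta ^ h * w)) =
      (\<Sum>h=1..<p. of_int (chi h) + of_int (chi h) * (zeta ^ h * w) / (1 - zeta ^ h * w))"
    using nz by (intro sum.cong) (auto simp: field_simps)
  also have "\<dots> = (\<Sum>h=1..<p. of_int (chi h) * (zeta ^ h * w) / (1 - zeta ^ h * w))"
  proof -
    have "(\<Sum>h=1..<p. (of_int (chi h) :: complex)) = of_real (\<Sum>h=1..<p. real_of_int (chi h))" by simp
    then show ?thesis by (simp only: sum.distrib sum_chi_nonzero of_real_0 add_0_left)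
  qed
  finally have "norm (G1 w) = norm (\<Sum>h=1..<p. of_int (chi h) * (zeta ^ h * w) / (1 - zeta ^ h * w)) / sqrt (real p)"
    using G1_partial_fractions[OF w] by (simp only: norm_divide norm_of_real) simp
  also have "\<dots> \<le> (\<Sum>h=1..<p. norm w * (1 / norm (1 - zeta ^ h * w))) / sqrt (real p)"
  proof (intro divide_right_mono sum_norm_le)
    fix h
    have "norm (of_int (chi h) * (zeta ^ h * w) / (1 - zeta ^ h * w)) = norm (of_int (chi h) :: complex) * (norm w * (1 / norm (1 - zeta ^ h * w)))"
      by (simp add: norm_mult norm_divide norm_zeta)
    also have "\<dots> \<le> 1 * (norm w * (1 / norm (1 - zeta ^ h * w)))"
      by (intro mult_right_mono norm_chi_le) auto
    finally show "norm (of_int (chi h) * (zeta ^ h * w) / (1 - zeta ^ h * w)) \<le> norm w * (1 / norm (1 - zeta ^ h * w))" by simp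
  qed simp
  finally show ?thesis by (simp add: sum_distrib_left)
qed

lemma norm_G1_le:
  assumes w: "norm w = exp (- u)" "0 < u"
  shows "norm (G1 w) \<le> (1 / u + 2 * real p / zeta_gap * norm w) / sqrt (real p)"
proof -
  have w1: "norm w < 1" using w by simp
  have "norm w * (\<Sum>h=1..<p. 1 / norm (1 - zeta ^ h * w)) \<le> norm w * (1 / (1 - norm w) + 2 * real p / zeta_gap)"
    by (intro mult_left_mono sum_inverse_zeta_le w1) auto
  also have "\<dots> = norm w / (1 - norm w) + 2 * real p / zeta_gap * norm w" by (simp add: algebra_simps)
  also have "\<dots> \<le> 1 / u + 2 * real p / zeta_gap * norm w" using norm_geometric_le[OF w] by simp
  finally show ?thesis using norm_G1_le_sum[OF w1] divide_right_mono[of _ _ "sqrt (real p)"]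
    by (meson order_trans real_sqrt_ge_zero of_nat_0_le_iff)
qed

lemma Re_G0_le:
  assumes w: "norm w = exp (- u)" "0 < u"
  shows "Re (G0 w) \<le> 1 / u + 2 * norm w" and "Re (G0 w) \<le> 1 / norm (1 - w)"
proof -
  have w1: "norm w < 1" using w by simp
  have le: "norm (w ^ p) \<le> norm w"
    using power_decreasing[of 1 p "norm w"] w1 p_ge_13 by (simp add: norm_power)
  then have wp: "norm (w ^ p) < 1" using w1 by simp
  have ne: "1 - w \<noteq> 0" "1 - w ^ p \<noteq> 0" using w1 wp by auto
  have "G0 w = w / (1 - w) - w ^ p / (1 - w ^ p)"
  proof -
    have "w / (1 - w) = 1 / (1 - w) - 1" "w ^ p / (1 - w ^ p) = 1 / (1 - w ^ p) - 1"
      using ne by (simp_all add: field_simps)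
    then show ?thesis by (simp add: G0_def)
  qed
  then have "Re (G0 w) = Re (w / (1 - w)) - Re (w ^ p / (1 - w ^ p))" by simp
  also have "Re (w / (1 - w)) \<le> norm w / (1 - norm w)"
  proof -
    have "norm (w / (1 - w)) \<le> norm w / (1 - norm w)"
      using norm_triangle_ineq2[of 1 w] w1 unfolding norm_divide by (intro divide_left_mono mult_pos_pos) (auto simp: ne)
    then show ?thesis using complex_Re_le_cmod order_trans by blast
  qed
  also have "norm w / (1 - norm w) \<le> 1 / u" by (rule norm_geometric_le[OF w])
  finally show "Re (G0 w) \<le> 1 / u + 2 * norm w" using Re_geometric_ge[OF wp] le by linarith
  have "Re (G0 w) = Re (1 / (1 - w)) - Re (1 / (1 - w ^ p))" by (simp add: G0_def)
  also have "\<dots> \<le> Re (1 / (1 - w))" using Re_inverse_one_minus_ge[OF wp] by linarith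
  also have "\<dots> \<le> norm (1 / (1 - w))" by (rule complex_Re_le_cmod)
  finally show "Re (G0 w) \<le> 1 / norm (1 - w)" by (simp add: norm_divide)
qed


text \<open>\<open>|1 - z^2| = |z| |1 / z - z|\<close> is at least \<open>(1 + r^2) |sin y|\<close>
  with \<open>r = exp (- x)\<close>. Jordan's inequality and \<open>pi <= 16/5\<close> give
  \<open>|sin y| >= 5/2 x\<close>, and \<open>x <= 1/20\<close> gives \<open>1 + r^2 >= 9/5\<close>,
  whence the factor \<open>9/2\<close>.\<close>

lemma norm_one_minus_square_ge:
  assumes x: "0 < x" "x \<le> 1/20" and y: "4 * x \<le> \<bar>y\<bar>" "\<bar>y\<bar> \<le> pi / 2"
    and z: "z = exp (- Complex x (- y)) \<or> z = - exp (- Complex x (- y))"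
  shows "9/2 * x \<le> norm (1 - z^2)"
proof -
  define E where "E = exp (- Complex x (- y))"
  define r where "r = exp (- x)"
  have r: "0 < r" by (simp add: r_def)
  have E: "E = of_real r * cis y"
    unfolding E_def r_def by (simp add: exp_eq_polar)
  have inv: "E * (of_real (1 / r) * cis (- y)) = 1" using r by (simp add: E cis_mult)
  have "1 - E^2 = E * (of_real (1 / r) * cis (- y) - E)"
    by (simp only: right_diff_distrib inv power2_eq_square)
  also have "norm \<dots> = r * norm (of_real (1 / r) * cis (- y) - E)" using r by (simp add: E norm_mult)
  finally have n: "norm (1 - E^2) = r * norm (of_real (1 / r) * cis (- y) - E)" .
  have "\<bar>Im (of_real (1 / r) * cis (- y) - E)\<bar> = (1 / r + r) * \<bar>sin y\<bar>"
  proof -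
    have "Im (of_real (1 / r) * cis (- y) - E) = - ((1 / r + r) * sin y)"
      by (simp add: E algebra_simps)
    then show ?thesis using r by (simp add: abs_mult)
  qed
  then have "r * ((1 / r + r) * \<bar>sin y\<bar>) \<le> norm (1 - E^2)"
    unfolding n using abs_Im_le_cmod[of "of_real (1 / r) * cis (- y) - E"] r by (intro mult_left_mono) auto
  moreover have "r * ((1 / r + r) * \<bar>sin y\<bar>) = (1 + r^2) * \<bar>sin y\<bar>" using r by (simp add: field_simps power2_eq_square)
  ultimately have a: "(1 + r^2) * \<bar>sin y\<bar> \<le> norm (1 - E^2)" by simp
  have pi32: "pi \<le> 16/5"
  proof (rule ccontr)
    assume "\<not> pi \<le> 16/5"
    then have "(16/5)^2 \<le> pi^2" by (intro power_mono) auto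
    then show False using pi_square_le by (simp add: power2_eq_square)
  qed
  have "5/2 * x \<le> \<bar>sin y\<bar>"
  proof -
    have s: "2 * \<bar>y\<bar> / pi \<le> sin (pi * (2 * \<bar>y\<bar> / pi) / 2)"
      using y by (intro sin_half_pi_ge) (auto simp: field_simps)
    have "5/2 * x \<le> 2 * (4 * x) / pi" using x pi32 by (simp add: field_simps)
    also have "\<dots> \<le> 2 * \<bar>y\<bar> / pi" using y by (intro divide_right_mono) auto
    also have "\<dots> \<le> sin \<bar>y\<bar>" using s by simp
    also have "\<dots> \<le> \<bar>sin y\<bar>" by (cases "0 \<le> y") auto
    finally show ?thesis .
  qed
  moreover have "9/5 \<le> 1 + r^2"
  proof -
    have "1 + (- 2 * x) \<le> exp (- 2 * x)" by (rule exp_ge_add_one_self)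
    moreover have "exp (- 2 * x) = r^2" by (simp add: r_def exp_double[symmetric])
    ultimately show ?thesis using x by simp
  qed
  ultimately have "9/5 * (5/2 * x) \<le> (1 + r^2) * \<bar>sin y\<bar>" using x by (intro mult_mono) auto
  then have "9/2 * x \<le> norm (1 - E^2)" using a by simp
  then show ?thesis using z by (auto simp: E_def)
qed

text \<open>Dividing the generic bound for \<open>Re (G0 (z ^ (2 * Suc j)))\<close> by
  \<open>2 * Suc j\<close> and summing yields \<open>pi^2 / (24 * x)\<close> and a logarithm; in the
  first \<open>m\<close> terms the main part is exchanged for \<open>B\<close>. The leading term
  exceeds \<open>saddle_const / x\<close>, so part of the gain from the exchange is spent on that
  excess.\<close>

lemma even_minor_bound:
  assumes x: "0 < x" and z: "norm z = exp (- x)"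
    and B: "\<And>j. j < m \<Longrightarrow> Re (G0 (z ^ (2 * Suc j))) \<le> B" "0 \<le> B"
  shows "Re (\<Sum>j. G0 (z ^ (2 * Suc j)) / of_nat (2 * Suc j)) \<le>
    pi^2 / (24 * x) - ln (1 - exp (- x)) + (\<Sum>j<m. B / (2 * real (Suc j)) - 1 / (4 * x * (real (Suc j))^2))"
proof -
  define r where "r = exp (- x)"
  have r: "0 < r" "r < 1" using x by (auto simp: r_def)
  have nz: "norm z < 1" using x by (simp add: z)
  have nzk: "norm (z ^ k) = exp (- (real k * x))" for k
    using exp_of_nat_mult[of k "- x"] by (simp add: norm_power z)
  have summ: "summable (\<lambda>j. G0 (z ^ (2 * Suc j)) / of_nat (2 * Suc j))"
    by (rule summable_norm_cancel[OF odd_even_summable(1)[OF nz]])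
  have e: "Re (G0 (z ^ (2 * Suc j)) / of_nat (2 * Suc j)) = Re (G0 (z ^ (2 * Suc j))) / (2 * real (Suc j))" for j
  proof -
    have "Re (G0 (z ^ (2 * Suc j)) / of_nat (2 * Suc j)) = Re (G0 (z ^ (2 * Suc j))) / real (2 * Suc j)"
      by (rule Re_divide_of_nat)
    then show ?thesis by (simp only: of_nat_mult of_nat_numeral)
  qed
  have "(\<lambda>j. 1 / (real (Suc j))^2) sums (pi^2 / 6)" using inverse_squares_sums by (simp add: algebra_simps)
  from sums_mult[OF this, of "1 / (4 * x)"]
  have b1: "(\<lambda>j. 1 / (4 * x) * (1 / (real (Suc j))^2)) sums (pi^2 / (24 * x))" by (simp add: field_simps)
  have b2: "(\<lambda>j. r ^ Suc j / real (Suc j)) sums (- ln (1 - r))" by (rule log_series_real[OF r])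
  have gen: "Re (G0 (z ^ (2 * Suc j))) / (2 * real (Suc j)) \<le> 1 / (4 * x) * (1 / (real (Suc j))^2) + r ^ Suc j / real (Suc j)" for j
  proof -
    define N where "N = real (Suc j)"
    have N: "0 < N" by (simp add: N_def)
    have "norm (z ^ (2 * Suc j)) = exp (- (2 * N * x))" unfolding nzk N_def by simp
    from Re_G0_le(1)[OF this] have "Re (G0 (z ^ (2 * Suc j))) \<le> 1 / (2 * N * x) + 2 * norm (z ^ (2 * Suc j))"
      using N x by simp
    also have "norm (z ^ (2 * Suc j)) \<le> r ^ Suc j"
      unfolding norm_power z r_def[symmetric] using r by (intro power_decreasing) auto
    finally have "Re (G0 (z ^ (2 * Suc j))) / (2 * N) \<le> (1 / (2 * N * x) + 2 * r ^ Suc j) / (2 * N)"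
      using N by (intro divide_right_mono) auto
    also have "\<dots> = 1 / (4 * x) * (1 / N^2) + r ^ Suc j / N" using N x by (simp add: field_simps power2_eq_square)
    finally show ?thesis by (simp only: N_def)
  qed
  have "Re (\<Sum>j. G0 (z ^ (2 * Suc j)) / of_nat (2 * Suc j)) = (\<Sum>j. Re (G0 (z ^ (2 * Suc j))) / (2 * real (Suc j)))"
    using summ by (simp only: Re_suminf[OF summ] e)
  also have "\<dots> \<le> (pi^2 / (24 * x) + - ln (1 - r)) + (\<Sum>j<m. B / (2 * real (Suc j)) - 1 / (4 * x * (real (Suc j))^2))"
  proof (rule suminf_improved_bound)
    show "summable (\<lambda>j. Re (G0 (z ^ (2 * Suc j))) / (2 * real (Suc j)))"
      using summable_Re[OF summ] by (simp only: e)
    show "(\<lambda>j. 1 / (4 * x) * (1 / (real (Suc j))^2) + r ^ Suc j / real (Suc j)) sums (pi^2 / (24 * x) + - ln (1 - r))"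
      by (rule sums_add[OF b1 b2])
    show "Re (G0 (z ^ (2 * Suc j))) / (2 * real (Suc j)) \<le> 1 / (4 * x) * (1 / (real (Suc j))^2) + r ^ Suc j / real (Suc j)" for j
      by (rule gen)
    fix j assume j: "j < m"
    have "Re (G0 (z ^ (2 * Suc j))) / (2 * real (Suc j)) \<le> B / (2 * real (Suc j))"
      using B(1)[OF j] by (intro divide_right_mono) auto
    moreover have "0 \<le> r ^ Suc j / real (Suc j)" using r by simp
    moreover have "1 / (4 * x) * (1 / (real (Suc j))^2) = 1 / (4 * x * (real (Suc j))^2)" by simp
    ultimately show "Re (G0 (z ^ (2 * Suc j))) / (2 * real (Suc j)) \<le>
        1 / (4 * x) * (1 / (real (Suc j))^2) + r ^ Suc j / real (Suc j) + (B / (2 * real (Suc j)) - 1 / (4 * x * (real (Suc j))^2))"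
      by linarith
  qed
  finally show ?thesis by (simp add: r_def)
qed

text \<open>The odd counterpart: absolute values are taken termwise, and \<open>norm_G1_le\<close>
  with the sum of the inverse odd squares gives the leading term
  \<open>pi^2 / (8 x sqrt p)\<close>.\<close>

lemma odd_minor_bound:
  assumes x: "0 < x" and z: "norm z = exp (- x)"
    and B: "\<And>j. j < m \<Longrightarrow> norm (G1 (z ^ (2 * j + 1))) \<le> B"
  shows "norm (\<Sum>j. G1 (z ^ (2 * j + 1)) / of_nat (2 * j + 1)) \<le>
    (pi^2 / (8 * x) - 2 * real p / zeta_gap * ln (1 - exp (- x))) / sqrt (real p)
      + (\<Sum>j<m. B / real (2 * j + 1) - 1 / (x * (real (2 * j + 1))^2 * sqrt (real p)))"
proof -
  define r where "r = exp (- x)"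
  define M where "M = 2 * real p / zeta_gap"
  have M: "0 \<le> M" using zeta_gap_pos by (simp add: M_def)
  have r: "0 < r" "r < 1" using x by (auto simp: r_def)
  have sp: "0 < sqrt (real p)" using p_pos by simp
  have nz: "norm z < 1" using x by (simp add: z)
  have nzk: "norm (z ^ k) = exp (- (real k * x))" for k
    using exp_of_nat_mult[of k "- x"] by (simp add: norm_power z)
  have summ: "summable (\<lambda>j. norm (G1 (z ^ (2 * j + 1)) / of_nat (2 * j + 1)))"
    by (rule odd_even_summable(2)[OF nz])
  have e: "norm (G1 (z ^ (2 * j + 1)) / of_nat (2 * j + 1)) = norm (G1 (z ^ (2 * j + 1))) / real (2 * j + 1)" for j
    by (simp only: norm_divide norm_of_nat)
  have b1: "(\<lambda>j. 1 / x * (1 / (real (2 * j + 1))^2)) sums (1 / x * (pi^2 / 8))"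
    by (rule sums_mult[OF sums_odd_inverse_squares])
  have b2: "(\<lambda>j. M * (r ^ Suc j / real (Suc j))) sums (M * (- ln (1 - r)))"
    by (rule sums_mult[OF log_series_real[OF r]])
  have b: "(\<lambda>j. (1 / x * (1 / (real (2 * j + 1))^2) + M * (r ^ Suc j / real (Suc j))) / sqrt (real p)) sums
      ((1 / x * (pi^2 / 8) + M * (- ln (1 - r))) / sqrt (real p))"
    by (rule sums_divide[OF sums_add[OF b1 b2]])
  have gen: "norm (G1 (z ^ (2 * j + 1))) / real (2 * j + 1) \<le> (1 / x * (1 / (real (2 * j + 1))^2) + M * (r ^ Suc j / real (Suc j))) / sqrt (real p)" for j
  proof -
    define N where "N = real (2 * j + 1)"
    have N: "0 < N" "real (Suc j) \<le> N" by (simp_all add: N_def)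
    have "norm (z ^ (2 * j + 1)) = exp (- (N * x))" by (simp only: nzk N_def)
    from norm_G1_le[OF this] have "norm (G1 (z ^ (2 * j + 1))) \<le> (1 / (N * x) + M * norm (z ^ (2 * j + 1))) / sqrt (real p)"
      using N x by (simp add: M_def)
    then have "norm (G1 (z ^ (2 * j + 1))) / N \<le> (1 / (N * x) + M * norm (z ^ (2 * j + 1))) / sqrt (real p) / N"
      using N by (intro divide_right_mono) auto
    also have "\<dots> = (1 / x * (1 / N^2) + M * (norm (z ^ (2 * j + 1)) / N)) / sqrt (real p)"
      using N x sp by (simp add: field_simps power2_eq_square)
    also have "\<dots> \<le> (1 / x * (1 / N^2) + M * (r ^ Suc j / real (Suc j))) / sqrt (real p)"
    proof (intro divide_right_mono add_left_mono mult_left_mono frac_le M)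
      show "norm (z ^ (2 * j + 1)) \<le> r ^ Suc j"
        unfolding norm_power z r_def[symmetric] using r by (intro power_decreasing) auto
    qed (use N r sp in auto)
    finally show ?thesis by (simp only: N_def)
  qed
  have "norm (\<Sum>j. G1 (z ^ (2 * j + 1)) / of_nat (2 * j + 1)) \<le> (\<Sum>j. norm (G1 (z ^ (2 * j + 1))) / real (2 * j + 1))"
    using summable_norm[OF summ] by (simp only: e)
  also have "\<dots> \<le> (1 / x * (pi^2 / 8) + M * (- ln (1 - r))) / sqrt (real p)
      + (\<Sum>j<m. B / real (2 * j + 1) - 1 / (x * (real (2 * j + 1))^2 * sqrt (real p)))"
  proof (rule suminf_improved_bound[OF _ b gen])
    show "summable (\<lambda>j. norm (G1 (z ^ (2 * j + 1))) / real (2 * j + 1))" using summ by (simp only: e)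
    fix j assume j: "j < m"
    have "norm (G1 (z ^ (2 * j + 1))) / real (2 * j + 1) \<le> B / real (2 * j + 1)"
      using B[OF j] by (intro divide_right_mono) auto
    moreover have "0 \<le> M * (r ^ Suc j / real (Suc j)) / sqrt (real p)" using r M sp by simp
    moreover have "(1 / x * (1 / (real (2 * j + 1))^2) + M * (r ^ Suc j / real (Suc j))) / sqrt (real p) =
        1 / (x * (real (2 * j + 1))^2 * sqrt (real p)) + M * (r ^ Suc j / real (Suc j)) / sqrt (real p)"
      by (simp add: add_divide_distrib)
    ultimately show "norm (G1 (z ^ (2 * j + 1))) / real (2 * j + 1) \<le>
        (1 / x * (1 / (real (2 * j + 1))^2) + M * (r ^ Suc j / real (Suc j))) / sqrt (real p)
        + (B / real (2 * j + 1) - 1 / (x * (real (2 * j + 1))^2 * sqrt (real p)))"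
      by linarith
  qed
  also have "1 / x * (pi^2 / 8) + M * (- ln (1 - r)) = pi^2 / (8 * x) - M * ln (1 - r)" by simp
  finally show ?thesis unfolding r_def M_def .
qed

text \<open>Either the term \<open>k = 1\<close> of the odd part is bounded, or \<open>z\<close> is close to a nontrivial \<open>p\<close>-th root of
  unity and the first twelve terms of the even part are bounded.\<close>
lemma minor_arc_bound:
  obtains C where "0 \<le> C"
    "\<And>x y z. 0 < x \<Longrightarrow> x \<le> 1/20 \<Longrightarrow> 4 * x \<le> \<bar>y\<bar> \<Longrightarrow> \<bar>y\<bar> \<le> pi / 2 \<Longrightarrow>
      z = exp (- Complex x (- y)) \<or> z = - exp (- Complex x (- y)) \<Longrightarrow>
      Re (Lam z) \<le> (saddle_const - 1/100) / x + C * (ln (2 / x) + 1)"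
proof -
  define M where "M = 2 * real p / zeta_gap"
  have M: "0 \<le> M" using zeta_gap_pos by (simp add: M_def)
  define s where "s = 1 / sqrt (real p)"
  define Q where "Q = pi^2"
  have Q: "0 \<le> Q" "Q \<le> 989/100" using pi_square_le by (auto simp: Q_def)
  have s: "0 < s" "s \<le> 5/18" and ss: "s * s = 1 / real p"
  proof -
    show "0 < s" using p_pos by (simp add: s_def)
    \<comment> \<open>\<open>(18/5)^2 = 12.96 < 13\<close>; this is where \<open>13 <= p\<close>
      enters the numerical inequalities.\<close>
    have "18/5 \<le> sqrt (real p)" using p_ge_13 by (intro real_le_rsqrt) (simp add: power2_eq_square)
    then have "1 / sqrt (real p) \<le> 1 / (18/5)" using p_pos by (intro divide_left_mono) auto
    then show "s \<le> 5/18" by (simp add: s_def)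
    show "s * s = 1 / real p" by (simp add: s_def)
  qed
  have Qs: "Q * s \<le> 989/100 * (5/18)" using Q s by (intro mult_mono) auto
  have ss': "s * s \<le> 5/18 * (5/18)" using s by (intro mult_mono) auto
  have Qss: "Q * (s * s) \<le> 989/100 * (5/18 * (5/18))" using Q s ss' by (intro mult_mono) auto
  have A: "saddle_const = (Q - Q * (s * s)) / 24" by (simp add: saddle_const_def Q_def ss algebra_simps)
  define C where "C = M + 1 + real p * (48 / zeta_gap) + 100 / zeta_gap"
  show ?thesis
  proof (rule that[of C])
    show "0 \<le> C" using M zeta_gap_pos by (simp add: C_def)
    fix x y :: real and z :: complex
    assume x: "0 < x" "x \<le> 1/20" and y: "4 * x \<le> \<bar>y\<bar>" "\<bar>y\<bar> \<le> pi / 2"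
      and z: "z = exp (- Complex x (- y)) \<or> z = - exp (- Complex x (- y))"
    have nz: "norm z = exp (- x)" using z by auto
    have nz1: "norm z < 1" using x by (simp add: nz)
    have nzk: "norm (z ^ k) = exp (- (real k * x))" for k
      using exp_of_nat_mult[of k "- x"] by (simp add: norm_power nz)
    define l where "l = - ln (1 - exp (- x))"
    have l: "l \<le> ln (2 / x)" "0 \<le> l"
    proof -
      have "exp (- x) \<le> 1 - x / 2"
      proof -
        have "1 + x \<le> exp x" by (rule exp_ge_add_one_self)
        then have "exp (- x) \<le> 1 / (1 + x)" using x by (simp add: exp_minus inverse_eq_divide frac_le)
        also have "\<dots> \<le> 1 - x / 2" using x by (simp add: field_simps)
        finally show ?thesis .
      qed
      then have "x / 2 \<le> 1 - exp (- x)" by simp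
      then have "ln (x / 2) \<le> ln (1 - exp (- x))" using x by (subst ln_le_cancel_iff) auto
      moreover have "ln (2 / x) = - ln (x / 2)" using x by (simp add: ln_div)
      ultimately show "l \<le> ln (2 / x)" by (simp add: l_def)
      show "0 \<le> l" using x by (simp add: l_def)
    qed
    have Re: "Re (Lam z) \<le> Re (\<Sum>j. G0 (z ^ (2 * Suc j)) / of_nat (2 * Suc j)) + norm (\<Sum>j. G1 (z ^ (2 * j + 1)) / of_nat (2 * j + 1))"
      unfolding Lam_split[OF nz1] using complex_Re_le_cmod[of "\<Sum>j. G1 (z ^ (2 * j + 1)) / of_nat (2 * j + 1)"] by simp
    have sp1: "1 \<le> sqrt (real p)" using p_pos by simp
    have sM: "M * l / sqrt (real p) \<le> M * l"
    proof -
      have "M * l / sqrt (real p) \<le> M * l / 1" using M l sp1 by (intro divide_left_mono mult_nonneg_nonneg) auto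
      then show ?thesis by simp
    qed
    have split8: "(pi^2 / (8 * x) - M * ln (1 - exp (- x))) / sqrt (real p) = Q * s / 8 / x + M * l / sqrt (real p)"
      by (simp add: Q_def s_def l_def add_divide_distrib diff_divide_distrib)
    \<comment> \<open>The threshold \<open>zeta_gap / 48\<close> is fitted to exponents up to
      \<open>24\<close>: closer than that, \<open>zeta ^ h * z\<close> raised to such a power stays
      within \<open>zeta_gap / 2\<close> of \<open>1\<close>.\<close>
    show "Re (Lam z) \<le> (saddle_const - 1/100) / x + C * (ln (2 / x) + 1)"
    proof (cases "\<forall>h\<in>{1..<p}. zeta_gap / 48 \<le> norm (1 - zeta ^ h * z)")
      case True
      have g1b: "norm (G1 z) \<le> real p * (48 / zeta_gap)"
      proof -
        have "(\<Sum>h=1..<p. 1 / norm (1 - zeta ^ h * z)) \<le> real (card {1..<p}) * (48 / zeta_gap)"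
        proof (rule sum_bounded_above)
          fix h assume h: "h \<in> {1..<p}"
          have "1 / norm (1 - zeta ^ h * z) \<le> 1 / (zeta_gap / 48)"
            using True h zeta_gap_pos by (intro divide_left_mono mult_pos_pos) force+
          then show "1 / norm (1 - zeta ^ h * z) \<le> 48 / zeta_gap" by simp
        qed
        also have "\<dots> \<le> real p * (48 / zeta_gap)" using zeta_gap_pos by (intro mult_right_mono) auto
        finally have S: "(\<Sum>h=1..<p. 1 / norm (1 - zeta ^ h * z)) \<le> real p * (48 / zeta_gap)" .
        have S0: "0 \<le> (\<Sum>h=1..<p. 1 / norm (1 - zeta ^ h * z))" by (intro sum_nonneg) auto
        have "norm (G1 z) \<le> norm z * (\<Sum>h=1..<p. 1 / norm (1 - zeta ^ h * z)) / sqrt (real p)" by (rule norm_G1_le_sum[OF nz1])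
        also have "\<dots> \<le> 1 * (\<Sum>h=1..<p. 1 / norm (1 - zeta ^ h * z)) / 1"
          using nz1 sp1 S0 by (intro frac_le mult_right_mono mult_nonneg_nonneg) auto
        finally show ?thesis using S by simp
      qed
      have g0b: "Re (G0 (z^2)) \<le> 2 / (9 * x)"
      proof -
        have "norm (z^2) = exp (- (2 * x))" using exp_of_nat_mult[of 2 "- x"] by (simp add: norm_power nz)
        then have "Re (G0 (z^2)) \<le> 1 / norm (1 - z^2)" by (rule Re_G0_le(2)) (use x in simp)
        also have "\<dots> \<le> 1 / (9/2 * x)"
          using norm_one_minus_square_ge[OF x y z] x by (intro divide_left_mono mult_pos_pos) auto
        finally show ?thesis by simp
      qed
      have E: "Re (\<Sum>j. G0 (z ^ (2 * Suc j)) / of_nat (2 * Suc j)) \<le>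
          pi^2 / (24 * x) - ln (1 - exp (- x)) + (\<Sum>j<1. 2 / (9 * x) / (2 * real (Suc j)) - 1 / (4 * x * (real (Suc j))^2))"
        by (rule even_minor_bound[OF x(1) nz]) (use g0b x in auto)
      have O: "norm (\<Sum>j. G1 (z ^ (2 * j + 1)) / of_nat (2 * j + 1)) \<le>
          (pi^2 / (8 * x) - 2 * real p / zeta_gap * ln (1 - exp (- x))) / sqrt (real p)
          + (\<Sum>j<1. real p * (48 / zeta_gap) / real (2 * j + 1) - 1 / (x * (real (2 * j + 1))^2 * sqrt (real p)))"
        by (rule odd_minor_bound[OF x(1) nz]) (use g1b in auto)
      have "Re (Lam z) \<le> Q / 24 / x + l + (1/9 - 1/4) / x + (Q * s / 8 / x + M * l / sqrt (real p)) + real p * (48 / zeta_gap) - s / x"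
        using Re E O unfolding M_def[symmetric] split8 by (simp add: Q_def l_def s_def field_simps)
      also have "\<dots> \<le> (Q / 24 + (1/9 - 1/4) + Q * s / 8 - s) / x + (l + M * l + real p * (48 / zeta_gap))"
        using sM by (simp add: add_divide_distrib diff_divide_distrib)
      also have "\<dots> \<le> (saddle_const - 1/100) / x + C * (ln (2 / x) + 1)"
      proof (rule add_mono)
        \<comment> \<open>At the extreme values of \<open>Q\<close> and \<open>s\<close> the left
          side is below \<open>0.098\<close>, while \<open>1/4 - 1/9 - 1/100\<close>, the part left
          over from the exchanged term of the even part, is about \<open>0.129\<close>.\<close>
        have "Q * (s * s) / 24 + (Q / 8 - 1) * s \<le> 989/100 * (5/18 * (5/18)) / 24 + (989/800 - 1) * (5/18)"
        proof (rule add_mono)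
          show "(Q / 8 - 1) * s \<le> (989/800 - 1) * (5/18)"
          proof -
            have "(Q / 8 - 1) * s \<le> (989/800 - 1) * s" using Q s by (intro mult_right_mono) auto
            also have "\<dots> \<le> (989/800 - 1) * (5/18)" using s by (intro mult_left_mono) auto
            finally show ?thesis .
          qed
        qed (use Qss in simp)
        then have "Q / 24 + (1/9 - 1/4) + Q * s / 8 - s \<le> saddle_const - 1/100"
          unfolding A by (simp add: algebra_simps)
        then show "(Q / 24 + (1/9 - 1/4) + Q * s / 8 - s) / x \<le> (saddle_const - 1/100) / x"
          using x by (intro divide_right_mono) auto
        have "l + M * l + real p * (48 / zeta_gap) \<le> (M + 1) * ln (2 / x) + real p * (48 / zeta_gap)"
          using mult_left_mono[OF l(1) M] l by (simp add: algebra_simps)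
        also have "\<dots> \<le> C * ln (2 / x) + C"
          using M zeta_gap_pos l by (intro add_mono mult_right_mono) (auto simp: C_def)
        finally show "l + M * l + real p * (48 / zeta_gap) \<le> C * (ln (2 / x) + 1)" by (simp add: distrib_left)
      qed
      finally show ?thesis .
    next
      case False
      then obtain h where h: "h \<in> {1..<p}" "norm (1 - zeta ^ h * z) < zeta_gap / 48" by (auto simp: not_le)
      have g0b: "Re (G0 (z ^ (2 * Suc j))) \<le> 2 / zeta_gap" if j: "j < 12" for j
      proof -
        let ?m = "2 * Suc j"
        \<comment> \<open>\<open>2\<close>, \<open>Suc j <= 12\<close> and \<open>h\<close> are all
          smaller than \<open>p\<close>; twelve is the largest number of terms available in this way
          for \<open>p = 13\<close>.\<close>
        have "\<not> p dvd ?m * h"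
        proof
          assume "p dvd ?m * h"
          then have "p dvd 2 \<or> p dvd Suc j \<or> p dvd h" by (simp only: prime_dvd_mult_iff[OF prime_p] disj_assoc)
          then show False using h j p_ge_13 by (auto dest!: dvd_imp_le)
        qed
        then have gap: "zeta_gap \<le> norm (1 - zeta ^ (?m * h))" by (rule zeta_gap_le)
        have "norm (1 ^ ?m - (zeta ^ h * z) ^ ?m) \<le> real ?m * norm (1 - zeta ^ h * z)"
          by (rule norm_power_diff) (use nz1 in \<open>auto simp: norm_mult norm_zeta\<close>)
        also have "\<dots> \<le> 24 * (zeta_gap / 48)" using h j by (intro mult_mono) auto
        finally have c: "norm (1 - (zeta ^ h * z) ^ ?m) \<le> zeta_gap / 2" by simp
        have "norm (1 - z ^ ?m) = norm (zeta ^ (?m * h) * (1 - z ^ ?m))" by (simp only: norm_mult norm_zeta mult_1)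
        also have "zeta ^ (?m * h) * (1 - z ^ ?m) = (1 - (zeta ^ h * z) ^ ?m) - (1 - zeta ^ (?m * h))"
          by (simp only: power_mult_distrib power_mult[symmetric] mult.commute[of h] right_diff_distrib) simp
        finally have n: "norm (1 - z ^ ?m) = norm ((1 - (zeta ^ h * z) ^ ?m) - (1 - zeta ^ (?m * h)))" .
        have "zeta_gap / 2 \<le> norm (1 - z ^ ?m)"
          unfolding n using norm_triangle_ineq2[of "1 - zeta ^ (?m * h)" "1 - (zeta ^ h * z) ^ ?m"] gap c
          by (simp only: norm_minus_commute[of "1 - (zeta ^ h * z) ^ ?m"])
        then have "1 / norm (1 - z ^ ?m) \<le> 1 / (zeta_gap / 2)"
          using zeta_gap_pos by (intro divide_left_mono mult_pos_pos) auto
        moreover have "norm (z ^ ?m) = exp (- (real ?m * x))" by (rule nzk)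
        then have "Re (G0 (z ^ ?m)) \<le> 1 / norm (1 - z ^ ?m)" by (rule Re_G0_le(2)) (use x in simp)
        ultimately show ?thesis by simp
      qed
      have E: "Re (\<Sum>j. G0 (z ^ (2 * Suc j)) / of_nat (2 * Suc j)) \<le>
          pi^2 / (24 * x) - ln (1 - exp (- x)) + (\<Sum>j<12. 2 / zeta_gap / (2 * real (Suc j)) - 1 / (4 * x * (real (Suc j))^2))"
        by (rule even_minor_bound[OF x(1) nz]) (use g0b zeta_gap_pos in auto)
      also have "(\<Sum>j<12. 2 / zeta_gap / (2 * real (Suc j)) - 1 / (4 * x * (real (Suc j))^2)) =
          (\<Sum>j<12. 1 / real (Suc j)) / zeta_gap - (\<Sum>j<12. 1 / (real (Suc j))^2) / 4 / x"
      proof -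
        have "2 / zeta_gap / (2 * N) - 1 / (4 * x * N^2) = 1 / N / zeta_gap - 1 / N^2 / 4 / x" if "0 < N" for N :: real
          using that by (simp add: mult_ac)
        then show ?thesis by (simp only: sum_divide_distrib sum_subtractf[symmetric] of_nat_0_less_iff zero_less_Suc)
      qed
      also have "\<dots> \<le> 12 / zeta_gap - (1564/1000) / 4 / x"
      proof (rule diff_mono)
        have "(\<Sum>j<12. 1 / real (Suc j)) \<le> (\<Sum>j<12::nat. 1)" by (intro sum_mono) auto
        then show "(\<Sum>j<12. 1 / real (Suc j)) / zeta_gap \<le> 12 / zeta_gap"
          using zeta_gap_pos by (intro divide_right_mono) auto
        have "1564/1000 \<le> (\<Sum>j<12. 1 / (real (Suc j))^2)" by (simp add: lessThan_nat_numeral lessThan_Suc)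
        then show "(1564/1000) / 4 / x \<le> (\<Sum>j<12. 1 / (real (Suc j))^2) / 4 / x"
          using x by (intro divide_right_mono) auto
      qed
      finally have E: "Re (\<Sum>j. G0 (z ^ (2 * Suc j)) / of_nat (2 * Suc j)) \<le>
          pi^2 / (24 * x) - ln (1 - exp (- x)) + (12 / zeta_gap - (1564/1000) / 4 / x)" by simp
      have O: "norm (\<Sum>j. G1 (z ^ (2 * j + 1)) / of_nat (2 * j + 1)) \<le>
          (pi^2 / (8 * x) - 2 * real p / zeta_gap * ln (1 - exp (- x))) / sqrt (real p)
          + (\<Sum>j<0. 0 / real (2 * j + 1) - 1 / (x * (real (2 * j + 1))^2 * sqrt (real p)))"
        by (rule odd_minor_bound[OF x(1) nz]) auto
      have "Re (Lam z) \<le> Q / 24 / x + l - 391/1000 / x + (Q * s / 8 / x + M * l / sqrt (real p)) + 12 / zeta_gap"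
        using Re E O unfolding M_def[symmetric] split8 by (simp add: Q_def l_def)
      also have "\<dots> \<le> (Q / 24 - 391/1000 + Q * s / 8) / x + (l + M * l + 12 / zeta_gap)"
        using sM by (simp add: add_divide_distrib diff_divide_distrib)
      also have "\<dots> \<le> (saddle_const - 1/100) / x + C * (ln (2 / x) + 1)"
      proof (rule add_mono)
        \<comment> \<open>\<open>391/1000\<close> is a quarter of \<open>1564/1000\<close>, the
          lower bound for twelve terms of the inverse squares. The claim amounts to
          \<open>Q s / 8 + Q s^2 / 24 <= 0.381\<close>; the extreme values give about
          \<open>0.3752\<close>.\<close>
        have "Q / 24 - 391/1000 + Q * s / 8 \<le> saddle_const - 1/100"
          unfolding A diff_divide_distrib using Qs Qss by linarith
        then show "(Q / 24 - 391/1000 + Q * s / 8) / x \<le> (saddle_const - 1/100) / x"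
          using x by (intro divide_right_mono) auto
        have "l + M * l + 12 / zeta_gap \<le> (M + 1) * ln (2 / x) + 12 / zeta_gap"
          using mult_left_mono[OF l(1) M] l by (simp add: algebra_simps)
        also have "\<dots> \<le> C * ln (2 / x) + C"
        proof (intro add_mono mult_right_mono)
          have "12 / zeta_gap \<le> 100 / zeta_gap" using zeta_gap_pos by (intro divide_right_mono) auto
          moreover have "0 \<le> real p * (48 / zeta_gap)" using zeta_gap_pos by simp
          ultimately show "12 / zeta_gap \<le> C" using M by (simp add: C_def)
          show "M + 1 \<le> C" using zeta_gap_pos by (simp add: C_def)
        qed (use l in simp)
        finally show "l + M * l + 12 / zeta_gap \<le> C * (ln (2 / x) + 1)" by (simp add: distrib_left)
      qed
      finally show ?thesis .
    qed
  qed
qed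

end

section \<open>The saddle point integral\<close>

lemma gaussian_integral_UNIV:
  fixes N :: real
  assumes N: "0 < N"
  shows "integrable lborel (\<lambda>v::real. exp (- N * v^2))" and "(\<integral>v. exp (- N * v^2) \<partial>lborel) = sqrt (pi / N)"
proof -
  define \<sigma> where "\<sigma> = sqrt (1 / (2 * N))"
  have s: "0 < \<sigma>" "\<sigma>^2 = 1 / (2 * N)" using N by (auto simp: \<sigma>_def)
  have e: "normal_density 0 \<sigma> = (\<lambda>v. sqrt (N / pi) * exp (- N * v^2))"
  proof
    fix v
    have "sqrt (2 * pi * \<sigma>^2) = sqrt (pi / N)" using N by (simp add: s)
    then show "normal_density 0 \<sigma> v = sqrt (N / pi) * exp (- N * v^2)"
      using N by (simp add: normal_density_def s real_sqrt_divide)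
  qed
  have g: "sqrt (N / pi) > 0" using N by simp
  have "integrable lborel (\<lambda>v. sqrt (N / pi) * exp (- N * v^2))"
    using integrable_normal_density[OF s(1), of 0] by (simp only: e)
  then show I: "integrable lborel (\<lambda>v::real. exp (- N * v^2))"
  proof -
    assume "integrable lborel (\<lambda>v. sqrt (N / pi) * exp (- N * v^2))"
    then have "integrable lborel (\<lambda>v. 1 / sqrt (N / pi) * (sqrt (N / pi) * exp (- N * v^2)))"
      by (rule integrable_mult_right)
    moreover have "(\<lambda>v. 1 / sqrt (N / pi) * (sqrt (N / pi) * exp (- N * v^2))) = (\<lambda>v::real. exp (- N * v^2))"
      using N by (simp add: fun_eq_iff)
    ultimately show ?thesis by (simp only:)
  qed
  have "sqrt (N / pi) * (\<integral>v. exp (- N * v^2) \<partial>lborel) = 1"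
    using integral_normal_density[OF s(1), of 0] by (simp only: e integral_mult_right_zero)
  moreover have "sqrt (N / pi) * sqrt (pi / N) = 1" using N by (simp flip: real_sqrt_mult)
  ultimately show "(\<integral>v. exp (- N * v^2) \<partial>lborel) = sqrt (pi / N)"
    using g by (metis mult_cancel_left order_less_irrefl)
qed

text \<open>For \<open>|v| >= 4\<close> half of the exponent is at least \<open>8 N\<close>, so the
  tails carry the factor \<open>exp (- 8 * N)\<close> times a convergent Gaussian integral.\<close>

lemma gaussian_integral_truncated:
  fixes N :: real
  assumes N: "0 < N"
  shows "\<bar>integral {-4..4} (\<lambda>v. exp (- N * v^2)) - sqrt (pi / N)\<bar> \<le> 1 / N"
proof -
  let ?f = "\<lambda>v::real. exp (- N * v^2)" and ?g = "\<lambda>v::real. exp (- (N / 2) * v^2)"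
  have I: "integrable lborel ?f" by (rule gaussian_integral_UNIV[OF N])
  have Ig: "integrable lborel ?g" "(\<integral>v. ?g v \<partial>lborel) = sqrt (pi / (N / 2))"
    using gaussian_integral_UNIV[of "N / 2"] N by auto
  have Iin: "integrable lborel (\<lambda>v. indicator {-4..4} v * ?f v)"
    and Iout: "integrable lborel (\<lambda>v. indicator (- {-4..4}) v * ?f v)"
    using integrable_mult_indicator[OF _ I, of "{-4..4}"] integrable_mult_indicator[OF _ I, of "- {-4..4}"] by simp_all
  have "set_integrable lborel {-4..4} ?f" using Iin by (simp add: set_integrable_def)
  from set_borel_integral_eq_integral(2)[OF this]
  have in_eq: "(\<integral>v. indicator {-4..4} v * ?f v \<partial>lborel) = integral {-4..4} ?f" by (simp add: set_lebesgue_integral_def)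
  have "(\<integral>v. ?f v \<partial>lborel) = (\<integral>v. indicator {-4..4} v * ?f v + indicator (- {-4..4}) v * ?f v \<partial>lborel)"
    by (intro Bochner_Integration.integral_cong) (auto simp: indicator_def)
  also have "\<dots> = integral {-4..4} ?f + (\<integral>v. indicator (- {-4..4}) v * ?f v \<partial>lborel)"
    using Iin Iout in_eq by simp
  finally have split: "sqrt (pi / N) = integral {-4..4} ?f + (\<integral>v. indicator (- {-4..4}) v * ?f v \<partial>lborel)"
    using gaussian_integral_UNIV(2)[OF N] by simp
  have nonneg: "0 \<le> (\<integral>v. indicator (- {-4..4}) v * ?f v \<partial>lborel)" by (intro Bochner_Integration.integral_nonneg) auto
  have "(\<integral>v. indicator (- {-4..4}) v * ?f v \<partial>lborel) \<le> (\<integral>v. exp (- 8 * N) * ?g v \<partial>lborel)"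
  proof (rule integral_mono[OF Iout])
    show "integrable lborel (\<lambda>v. exp (- 8 * N) * ?g v)" using Ig by simp
    fix v :: real
    show "indicator (- {-4..4}) v * ?f v \<le> exp (- 8 * N) * ?g v"
    proof (cases "v \<in> {-4..4}")
      case False
      then have "4 \<le> \<bar>v\<bar>" by auto
      then have "4^2 \<le> \<bar>v\<bar>^2" by (intro power_mono) auto
      then have "16 * N \<le> N * v^2" using N by simp
      then have "- N * v^2 \<le> - 8 * N + - (N / 2) * v^2" by simp
      then have "?f v \<le> exp (- 8 * N + - (N / 2) * v^2)" by (simp only: exp_le_cancel_iff)
      then have "?f v \<le> exp (- 8 * N) * ?g v" by (simp only: exp_add)
      then show ?thesis using False by simp
    qed simp
  qed
  also have "\<dots> = exp (- 8 * N) * sqrt (2 * pi / N)" using Ig by (simp add: field_simps)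
  also have "\<dots> \<le> 1 / N"
  proof -
    have "sqrt (2 * pi / N) * N = sqrt (2 * pi * N)"
      using N by (simp add: real_sqrt_mult real_sqrt_divide) (simp add: field_simps)
    also have "\<dots> \<le> (1 + 2 * pi * N) / 2"
      using arith_geo_mean_sqrt[of 1 "2 * pi * N"] N by simp
    also have "\<dots> \<le> 1 + 8 * N" 
    proof -
      have "pi * N < 4 * N" using N pi_less_4 by (intro mult_strict_right_mono)
      moreover have "(1 + 2 * pi * N) / 2 = 1 / 2 + pi * N" by (simp add: field_simps)
      ultimately show ?thesis using N by linarith
    qed
    also have "\<dots> \<le> exp (8 * N)" by (rule exp_ge_add_one_self)
    finally have "exp (- 8 * N) * (sqrt (2 * pi / N) * N) \<le> exp (- 8 * N) * exp (8 * N)" by (intro mult_left_mono) auto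
    also have "\<dots> = 1" by (simp flip: exp_add)
    finally show ?thesis using N by (simp add: field_simps)
  qed
  finally show ?thesis using split nonneg by simp
qed

text \<open>\<open>F\<close> in the proof is an explicit antiderivative of
  \<open>- v^3 exp (- k v^2)\<close>, and the two halves contribute at most
  \<open>2 F(0) = 1 / k^2\<close>.\<close>

lemma cubic_gaussian_integral:
  fixes k :: real
  assumes k: "0 < k"
  shows "(\<lambda>v. \<bar>v\<bar>^3 * exp (- k * v^2)) integrable_on {-4..4}"
    and "integral {-4..4} (\<lambda>v. \<bar>v\<bar>^3 * exp (- k * v^2)) \<le> 1 / k^2"
proof -
  let ?f = "\<lambda>v::real. \<bar>v\<bar>^3 * exp (- k * v^2)"
  define F where "F v = (v^2 / (2 * k) + 1 / (2 * k^2)) * exp (- k * v^2)" for v :: real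
  have F0: "F 0 = 1 / (2 * k^2)" by (simp add: F_def)
  have Fp: "0 \<le> F v" for v using k by (simp add: F_def)
  have d: "(F has_real_derivative - (v^3 * exp (- k * v^2))) (at v within S)" for v S
  proof -
    have "(F has_real_derivative (2 * v / (2 * k)) * exp (- k * v^2) + (v^2 / (2 * k) + 1 / (2 * k^2)) * (exp (- k * v^2) * (- k * (2 * v)))) (at v within S)"
      unfolding F_def using k by (auto intro!: derivative_eq_intros)
    moreover have "(2 * v / (2 * k)) * exp (- k * v^2) + (v^2 / (2 * k) + 1 / (2 * k^2)) * (exp (- k * v^2) * (- k * (2 * v))) = - (v^3 * exp (- k * v^2))"
      using k by (simp add: field_simps power2_eq_square power3_eq_cube)
    ultimately show ?thesis by simp
  qed
  have p: "(?f has_integral (F 0 - F 4)) {0..4}"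
  proof -
    have "((\<lambda>v. v^3 * exp (- k * v^2)) has_integral (- F 4 - - F 0)) {0..4}"
      by (rule fundamental_theorem_of_calculus)
         (auto intro!: derivative_eq_intros d simp flip: has_real_derivative_iff_has_vector_derivative)
    then have "((\<lambda>v. v^3 * exp (- k * v^2)) has_integral (F 0 - F 4)) {0..4}" by simp
    then show ?thesis by (rule has_integral_eq[rotated]) auto
  qed
  have m: "(?f has_integral (F 0 - F (-4))) {-4..0}"
  proof -
    have "((\<lambda>v. - (v^3 * exp (- k * v^2))) has_integral (F 0 - F (-4))) {-4..0}"
      by (rule fundamental_theorem_of_calculus)
         (use d in \<open>simp_all flip: has_real_derivative_iff_has_vector_derivative\<close>)
    then show ?thesis by (rule has_integral_eq[rotated]) (auto simp: abs_if power3_eq_cube)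
  qed
  have "(?f has_integral ((F 0 - F (-4)) + (F 0 - F 4))) {-4..4}"
    by (rule has_integral_combine[OF _ _ m p]) auto
  then show "?f integrable_on {-4..4}" "integral {-4..4} ?f \<le> 1 / k^2"
    using Fp[of 4] Fp[of "-4"] by (auto simp: F0 integral_unique)
qed

text \<open>The exponent differs from \<open>- N v^2\<close> by at most \<open>N |v|^3\<close>, and
  for \<open>|v| <= 4\<close> its real part is at most \<open>- N v^2 / 17\<close>, where
  \<open>17 = 1 + 4^2\<close>. The cubic Gaussian integral then costs
  \<open>17^2 / N = 289 / N\<close> and the truncation another \<open>1 / N\<close>. Relative to
  \<open>sqrt (pi / N)\<close> the error has order \<open>N^(-1/2)\<close>.\<close>

lemma saddle_integral:
  fixes N :: real
  assumes N: "0 < N"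
  shows "norm (integral {-4..4} (\<lambda>v. exp (- of_real (N * v^2) / (1 - \<i> * of_real v))) - of_real (sqrt (pi / N))) \<le> 290 / N"
proof -
  let ?a = "\<lambda>v::real. - of_real (N * v^2) / (1 - \<i> * of_real v) :: complex"
  let ?b = "\<lambda>v::real. of_real (- N * v^2) :: complex"
  have nz: "1 - \<i> * of_real v \<noteq> 0" for v :: real by (auto simp: complex_eq_iff)
  have ca: "continuous_on {-4..4} (\<lambda>v. exp (?a v))" by (intro continuous_intros) (use nz in auto)
  have cb: "continuous_on {-4..4} (\<lambda>v. exp (?b v))" by (intro continuous_intros)
  have cr: "(\<lambda>v::real. exp (- N * v^2)) integrable_on {-4..4}"
    by (intro integrable_continuous_interval continuous_intros)
  have "((\<lambda>v. complex_of_real (exp (- N * v^2))) has_integral of_real (integral {-4..4} (\<lambda>v. exp (- N * v^2)))) {-4..4}"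
    using has_integral_of_real[OF integrable_integral[OF cr], where 'b = complex] .
  then have ib: "integral {-4..4} (\<lambda>v. exp (?b v)) = of_real (integral {-4..4} (\<lambda>v. exp (- N * v^2)))"
    by (simp only: exp_of_real integral_unique)
  have pt: "norm (exp (?a v) - exp (?b v)) \<le> N * (\<bar>v\<bar>^3 * exp (- (N / 17) * v^2))" if v: "v \<in> {-4..4}" for v
  proof -
    have v2: "v^2 \<le> 16" using power_mono[of "\<bar>v\<bar>" 4 2] v by auto
    have Rea: "Re (?a v) = - N * v^2 / (1 + v^2)" by (simp add: Re_divide power2_eq_square)
    have diff: "?a v - ?b v = of_real (N * v^2) * (- \<i> * of_real v / (1 - \<i> * of_real v))"
      using nz[of v] by (simp add: field_simps)
    have n1: "1 \<le> norm (1 - \<i> * of_real v :: complex)" using abs_Re_le_cmod[of "1 - \<i> * of_real v"] by simp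
    have nd: "norm (?a v - ?b v) \<le> N * \<bar>v\<bar>^3"
    proof -
      have "norm (?a v - ?b v) = N * v^2 * (\<bar>v\<bar> / norm (1 - \<i> * of_real v :: complex))"
      proof -
        have "norm (of_real (N * v^2) :: complex) = N * v^2" using N by (simp only: norm_of_real) simp
        moreover have "norm (- \<i> * of_real v) = \<bar>v\<bar>" by (simp add: norm_mult)
        ultimately show ?thesis unfolding diff norm_mult[of "of_real (N * v^2)"] norm_divide by (simp only:)
      qed
      also have "\<dots> \<le> N * v^2 * (\<bar>v\<bar> / 1)" using N n1 by (intro mult_left_mono divide_left_mono) auto
      also have "\<dots> = N * \<bar>v\<bar>^3" by (simp add: power3_eq_cube power2_eq_square)
      finally show ?thesis .
    qed
    have le: "v^2 / 17 \<le> v^2 / (1 + v^2)" using v2 by (intro divide_left_mono) (auto intro: add_pos_nonneg)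
    have "v^2 / (1 + v^2) \<le> v^2 / 1" by (intro divide_left_mono) (auto intro: add_pos_nonneg)
    then have "0 \<le> N * (v^2 - v^2 / (1 + v^2))" using N by simp
    then have Rd: "0 \<le> Re (?a v - ?b v)" using Rea by (simp add: algebra_simps)
    have "norm (exp (?a v - ?b v) - 1) \<le> exp \<bar>Re (?a v - ?b v)\<bar> * norm (?a v - ?b v)"
      using Taylor_exp[of "?a v - ?b v" 0] by simp
    then have "exp (Re (?b v)) * norm (exp (?a v - ?b v) - 1) \<le> exp (Re (?b v)) * (exp \<bar>Re (?a v - ?b v)\<bar> * norm (?a v - ?b v))"
      by (intro mult_left_mono) auto
    also have "\<dots> = exp (Re (?a v)) * norm (?a v - ?b v)"
      using Rd by (simp add: mult.assoc[symmetric] flip: exp_add)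
    also have "exp (Re (?b v)) * norm (exp (?a v - ?b v) - 1) = norm (exp (?b v) * (exp (?a v - ?b v) - 1))"
      by (simp only: norm_mult norm_exp_eq_Re)
    also have "exp (?b v) * (exp (?a v - ?b v) - 1) = exp (?a v) - exp (?b v)"
      by (simp only: right_diff_distrib exp_add[symmetric]) simp
    finally have "norm (exp (?a v) - exp (?b v)) \<le> exp (Re (?a v)) * norm (?a v - ?b v)" .
    also have "\<dots> \<le> exp (- (N / 17) * v^2) * (N * \<bar>v\<bar>^3)"
    proof (intro mult_mono nd)
      have "N * (v^2 / 17) \<le> N * (v^2 / (1 + v^2))" using le N by (intro mult_left_mono) auto
      then show "exp (Re (?a v)) \<le> exp (- (N / 17) * v^2)" unfolding Rea by simp
    qed auto
    finally show ?thesis by (simp add: mult_ac)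
  qed
  have "norm (integral {-4..4} (\<lambda>v. exp (?a v) - exp (?b v))) \<le> integral {-4..4} (\<lambda>v. N * (\<bar>v\<bar>^3 * exp (- (N / 17) * v^2)))"
  proof (rule integral_norm_bound_integral)
    show "(\<lambda>v. exp (?a v) - exp (?b v)) integrable_on {-4..4}"
      by (intro integrable_continuous_interval continuous_on_diff ca cb)
    show "(\<lambda>v. N * (\<bar>v\<bar>^3 * exp (- (N / 17) * v^2))) integrable_on {-4..4}"
      using integrable_on_cmult_left[OF cubic_gaussian_integral(1)[of "N / 17"]] N by simp
  qed (rule pt)
  also have "\<dots> = N * integral {-4..4} (\<lambda>v. \<bar>v\<bar>^3 * exp (- (N / 17) * v^2))" by (rule integral_mult_right)
  also have "\<dots> \<le> N * (1 / (N / 17)^2)" using N by (intro mult_left_mono cubic_gaussian_integral) auto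
  also have "\<dots> = 289 / N" using N by (simp add: field_simps power2_eq_square)
  also have "integral {-4..4} (\<lambda>v. exp (?a v) - exp (?b v)) = integral {-4..4} (\<lambda>v. exp (?a v)) - of_real (integral {-4..4} (\<lambda>v. exp (- N * v^2)))"
    unfolding ib[symmetric] by (intro Henstock_Kurzweil_Integration.integral_diff integrable_continuous_interval ca cb)
  finally have 1: "norm (integral {-4..4} (\<lambda>v. exp (?a v)) - of_real (integral {-4..4} (\<lambda>v. exp (- N * v^2)))) \<le> 289 / N" .
  have "norm (complex_of_real (integral {-4..4} (\<lambda>v. exp (- N * v^2))) - of_real (sqrt (pi / N))) \<le> 1 / N"
    using gaussian_integral_truncated[OF N] by (simp only: of_real_diff[symmetric] norm_of_real)
  with 1 have "norm ((integral {-4..4} (\<lambda>v. exp (?a v)) - of_real (integral {-4..4} (\<lambda>v. exp (- N * v^2))))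
      + (complex_of_real (integral {-4..4} (\<lambda>v. exp (- N * v^2))) - of_real (sqrt (pi / N)))) \<le> 289 / N + 1 / N"
    by (rule norm_triangle_mono)
  then show ?thesis by (simp add: add_divide_distrib[symmetric])
qed

section \<open>The asymptotic formula\<close>

context prime_1_mod_4
begin

lemma saddle_const_pos: "0 < saddle_const"
  using p_ge_13 by (simp add: saddle_const_def)

definition integrand :: "nat \<Rightarrow> real \<Rightarrow> real \<Rightarrow> complex" where
  "integrand n x y = (gen_fun chi (exp (- Complex x (- y))) + (-1) ^ n * gen_fun chi (- exp (- Complex x (- y))))
      * exp (of_nat n * Complex x (- y))"

lemma integral_integrand:
  assumes "0 < x"
  shows "integral {- (pi/2)..pi/2} (integrand n x) = 2 * pi * of_int (signed_partition_number n chi)"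
  using circle_coefficient_integral[OF gen_fun_holomorphic[of chi, OF abs_chi_le] assms, of n]
    gen_fun_coeff[of chi n, OF abs_chi_le]
  by (simp add: integrand_def[abs_def])

lemma continuous_integrand:
  assumes x: "0 < x"
  shows "continuous_on S (integrand n x)"
proof -
  have c: "continuous_on S (\<lambda>y. Complex x (- y))"
    unfolding complex_eq_iff Complex_eq by (intro continuous_intros)
  have H: "continuous_on (ball 0 1) (gen_fun chi)"
    by (rule holomorphic_on_imp_continuous_on[OF gen_fun_holomorphic[of chi, OF abs_chi_le]])
  show ?thesis unfolding integrand_def
    by (intro continuous_intros continuous_on_compose2[OF H] c) (use x in auto)
qed

text \<open>The limit of \<open>exp (Lam z - saddle_const / t)\<close> at \<open>z = 1\<close>;
  \<open>coeff_minus\<close> is its counterpart at \<open>z = - 1\<close>.\<close>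

definition coeff_plus :: real where
  "coeff_plus = exp (- ln (real p) / 4 + sqrt (real p) * L1 / 4)"

definition coeff_minus :: real where
  "coeff_minus = exp (- ln (real p) / 4 + (2 * real_of_int (chi 2) - 1) * (sqrt (real p) * L1 / 4))"

text \<open>Up to a remainder \<open>\<rho>\<close> with \<open>|\<rho>| <= K |t| <= 5 K x\<close>,
  \<open>Lam z\<close> is \<open>saddle_const / t\<close> plus a constant, and
  \<open>|exp \<rho> - 1|\<close> is \<open>O(x)\<close>. As \<open>saddle_const / x = n x\<close>
  at the saddle, the exponential factor never exceeds \<open>exp (2 n x)\<close> on the arc.\<close>

lemma integrand_central:
  obtains C where "0 \<le> C" "\<And>n x y. 0 < x \<Longrightarrow> x \<le> 1/20 \<Longrightarrow> real n * x^2 = saddle_const \<Longrightarrow> \<bar>y\<bar> \<le> 4 * x \<Longrightarrow>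
    norm (integrand n x y - of_real (coeff_plus + (-1) ^ n * coeff_minus)
        * exp (of_real saddle_const / Complex x (- y) + of_nat n * Complex x (- y))) \<le> C * x * exp (2 * real n * x)"
proof -
  obtain K where K: "0 \<le> K"
    "\<And>t. t \<in> sector \<Longrightarrow> t \<noteq> 0 \<Longrightarrow> norm t \<le> 1 \<Longrightarrow>
      norm (Lam (exp (- t)) - of_real saddle_const / t - of_real (- ln (real p) / 4 + sqrt (real p) * L1 / 4)) \<le> K * norm t"
    "\<And>t. t \<in> sector \<Longrightarrow> t \<noteq> 0 \<Longrightarrow> norm t \<le> 1 \<Longrightarrow>
      norm (Lam (- exp (- t)) - of_real saddle_const / t
        - of_real (- ln (real p) / 4 + (2 * real_of_int (chi 2) - 1) * (sqrt (real p) * L1 / 4))) \<le> K * norm t"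
    by (rule Lam_asymptotics) blast
  define C where "C = (coeff_plus + coeff_minus) * (exp K * K * 5)"
  have cp: "0 < coeff_plus" "0 < coeff_minus" by (simp_all add: coeff_plus_def coeff_minus_def)
  show ?thesis
  proof (rule that[of C])
    show "0 \<le> C" using K cp by (simp add: C_def)
    fix n :: nat and x y :: real
    assume x: "0 < x" "x \<le> 1/20" and n: "real n * x^2 = saddle_const" and y: "\<bar>y\<bar> \<le> 4 * x"
    define t where "t = Complex x (- y)"
    have t: "t \<in> sector" "t \<noteq> 0" using x y by (auto simp: sector_def t_def complex_eq_iff)
    have nt5: "norm t \<le> 5 * x" using sector_norm_le[OF t(1)] by (simp add: t_def)
    then have nt: "norm t \<le> 1" using x by simp
    have xt: "x \<le> norm t" using complex_Re_le_cmod[of t] by (simp add: t_def)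
    let ?W = "of_real saddle_const / t + of_nat n * t"
    have ReW: "Re ?W \<le> 2 * real n * x"
    proof -
      have "Re (of_real saddle_const / t) \<le> norm (of_real saddle_const / t)" by (rule complex_Re_le_cmod)
      also have "\<dots> = saddle_const / norm t" using saddle_const_pos by (simp add: norm_divide)
      also have "\<dots> \<le> saddle_const / x" using xt x saddle_const_pos by (intro divide_left_mono mult_pos_pos) auto
      also have "\<dots> = real n * x" using x by (simp add: n[symmetric] power2_eq_square)
      finally have "Re (of_real saddle_const / t) \<le> real n * x" .
      moreover have "Re (of_nat n * t) = real n * x" by (simp add: t_def)
      ultimately show ?thesis unfolding plus_complex.sel by linarith
    qed
    have est: "norm (gen_fun chi z * exp (of_nat n * t) - of_real (exp c) * exp ?W) \<le> exp c * (exp K * K * 5) * x * exp (2 * real n * x)"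
      if z: "norm (Lam z - of_real saddle_const / t - of_real c) \<le> K * norm t" for z c
    proof -
      define \<rho> where "\<rho> = Lam z - of_real saddle_const / t - of_real c"
      have "gen_fun chi z * exp (of_nat n * t) = exp (of_real c) * exp ?W * exp \<rho>"
        by (simp add: gen_fun_def \<rho>_def add.commute flip: exp_add)
      then have "gen_fun chi z * exp (of_nat n * t) - of_real (exp c) * exp ?W = of_real (exp c) * exp ?W * (exp \<rho> - 1)"
        by (simp add: exp_of_real algebra_simps)
      then have "norm (gen_fun chi z * exp (of_nat n * t) - of_real (exp c) * exp ?W) = exp c * exp (Re ?W) * norm (exp \<rho> - 1)"
        by (simp only: norm_mult norm_exp_eq_Re norm_of_real abs_exp_cancel)
      also have "\<dots> \<le> exp c * exp (2 * real n * x) * (exp K * (K * (5 * x)))"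
      proof (intro mult_mono)
        have "norm (exp \<rho> - 1) \<le> exp \<bar>Re \<rho>\<bar> * norm \<rho>" using Taylor_exp[of \<rho> 0] by simp
        also have "\<dots> \<le> exp K * (K * (5 * x))"
        proof (intro mult_mono)
          have r1: "norm \<rho> \<le> K * norm t" using z by (simp add: \<rho>_def)
          have "K * norm t \<le> K * 1" using nt K by (intro mult_left_mono) auto
          then show "exp \<bar>Re \<rho>\<bar> \<le> exp K" using abs_Re_le_cmod[of \<rho>] r1 by simp
          have "K * norm t \<le> K * (5 * x)" using nt5 K by (intro mult_left_mono) auto
          then show "norm \<rho> \<le> K * (5 * x)" using r1 by simp
        qed auto
        finally show "norm (exp \<rho> - 1) \<le> exp K * (K * (5 * x))" .
      qed (use ReW in auto)
      also have "\<dots> = exp c * (exp K * K * 5) * x * exp (2 * real n * x)" by simp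
      finally show ?thesis .
    qed
    let ?c0 = "- ln (real p) / 4 + sqrt (real p) * L1 / 4"
    let ?c1 = "- ln (real p) / 4 + (2 * real_of_int (chi 2) - 1) * (sqrt (real p) * L1 / 4)"
    let ?D0 = "gen_fun chi (exp (- t)) * exp (of_nat n * t) - of_real (exp ?c0) * exp ?W"
    let ?D1 = "gen_fun chi (- exp (- t)) * exp (of_nat n * t) - of_real (exp ?c1) * exp ?W"
    have eq: "integrand n x y - of_real (coeff_plus + (-1) ^ n * coeff_minus) * exp ?W = ?D0 + (-1) ^ n * ?D1"
      by (simp add: integrand_def t_def[symmetric] coeff_plus_def coeff_minus_def algebra_simps)
    have "norm (?D0 + (-1) ^ n * ?D1) \<le> norm ?D0 + norm ?D1"
      by (rule order_trans[OF norm_triangle_ineq]) (simp add: norm_mult norm_power)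
    also have "\<dots> \<le> coeff_plus * (exp K * K * 5) * x * exp (2 * real n * x) + coeff_minus * (exp K * K * 5) * x * exp (2 * real n * x)"
      unfolding coeff_plus_def coeff_minus_def
      by (rule add_mono[OF est[OF K(2)[OF t nt]] est[OF K(3)[OF t nt]]])
    also have "\<dots> = C * x * exp (2 * real n * x)" by (simp add: C_def algebra_simps)
    finally show "norm (integrand n x y - of_real (coeff_plus + (-1) ^ n * coeff_minus)
        * exp (of_real saddle_const / Complex x (- y) + of_nat n * Complex x (- y))) \<le> C * x * exp (2 * real n * x)"
      unfolding t_def[symmetric] eq .
  qed
qed

lemma integrand_minor:
  obtains C where "0 \<le> C" "\<And>n x y. 0 < x \<Longrightarrow> x \<le> 1/20 \<Longrightarrow> real n * x^2 = saddle_const \<Longrightarrow> 4 * x \<le> \<bar>y\<bar> \<Longrightarrow> \<bar>y\<bar> \<le> pi/2 \<Longrightarrow>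
    norm (integrand n x y) \<le> 2 * exp (- (1/100) / x + C * (ln (2 / x) + 1)) * exp (2 * real n * x)"
proof -
  obtain C where C: "0 \<le> C"
    "\<And>x y z. 0 < x \<Longrightarrow> x \<le> 1/20 \<Longrightarrow> 4 * x \<le> \<bar>y\<bar> \<Longrightarrow> \<bar>y\<bar> \<le> pi / 2 \<Longrightarrow>
      z = exp (- Complex x (- y)) \<or> z = - exp (- Complex x (- y)) \<Longrightarrow>
      Re (Lam z) \<le> (saddle_const - 1/100) / x + C * (ln (2 / x) + 1)"
    by (rule minor_arc_bound) blast
  show ?thesis
  proof (rule that[OF C(1)])
    fix n :: nat and x y :: real
    assume x: "0 < x" "x \<le> 1/20" and n: "real n * x^2 = saddle_const" and y: "4 * x \<le> \<bar>y\<bar>" "\<bar>y\<bar> \<le> pi/2"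
    let ?R = "(saddle_const - 1/100) / x + C * (ln (2 / x) + 1)"
    let ?z = "exp (- Complex x (- y))"
    have H: "norm (gen_fun chi z) \<le> exp ?R" if "z = ?z \<or> z = - ?z" for z
      unfolding gen_fun_def norm_exp_eq_Re exp_le_cancel_iff by (rule C(2)[OF x y that])
    have "norm (gen_fun chi ?z + (-1) ^ n * gen_fun chi (- ?z)) \<le> norm (gen_fun chi ?z) + norm (gen_fun chi (- ?z))"
      by (rule order_trans[OF norm_triangle_ineq]) (simp add: norm_mult norm_power)
    also have "\<dots> \<le> exp ?R + exp ?R" by (intro add_mono H) auto
    finally have 1: "norm (gen_fun chi ?z + (-1) ^ n * gen_fun chi (- ?z)) \<le> 2 * exp ?R" by simp
    have "norm (integrand n x y) = norm (gen_fun chi ?z + (-1) ^ n * gen_fun chi (- ?z)) * exp (real n * x)"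
      by (simp add: integrand_def norm_mult)
    also have "\<dots> \<le> 2 * exp ?R * exp (real n * x)" using 1 by (intro mult_right_mono) auto
    also have "\<dots> = 2 * exp (?R + real n * x)" by (simp add: exp_add)
    also have "?R + real n * x = (- (1/100) / x + C * (ln (2 / x) + 1)) + 2 * real n * x"
    proof -
      have "saddle_const / x = real n * x" using x by (simp add: n[symmetric] power2_eq_square)
      then show ?thesis by (simp add: diff_divide_distrib)
    qed
    finally show "norm (integrand n x y) \<le> 2 * exp (- (1/100) / x + C * (ln (2 / x) + 1)) * exp (2 * real n * x)"
      by (simp only: exp_add mult.assoc)
  qed
qed

text \<open>Substitute \<open>y = x v\<close> and put \<open>N = n x\<close>, so that
  \<open>saddle_const = N x\<close> and \<open>t = x u\<close> with \<open>u = 1 - i v\<close>. The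
  exponent becomes \<open>N (1 / u + u)\<close>, and
  \<open>1 / u + u - 2 = (1 - u)^2 / u = - v^2 / u\<close> holds exactly, without a Taylor
  remainder.\<close>

lemma integral_central:
  assumes x: "0 < x" and n: "real n * x^2 = saddle_const"
  shows "integral {- (4 * x)..4 * x} (\<lambda>y. exp (of_real saddle_const / Complex x (- y) + of_nat n * Complex x (- y))) =
    of_real (x * exp (2 * real n * x)) * integral {-4..4} (\<lambda>v. exp (- of_real ((real n * x) * v^2) / (1 - \<i> * of_real v)))"
proof -
  let ?f = "\<lambda>y. exp (of_real saddle_const / Complex x (- y) + of_nat n * Complex x (- y))"
  define N where "N = real n * x"
  have A: "saddle_const = N * x" using n by (simp add: N_def power2_eq_square)
  have "continuous_on S (\<lambda>y. Complex x (- y))" for S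
    unfolding complex_eq_iff Complex_eq by (intro continuous_intros)
  then have cont: "continuous_on S ?f" for S
    by (intro continuous_intros) (use x in \<open>auto simp: complex_eq_iff\<close>)
  have "((\<lambda>v. x *\<^sub>R ?f (x * v)) has_integral integral {x * (-4)..x * 4} ?f) {-4..4}"
  proof (rule has_integral_substitution[where c = "- (4 * x)" and d = "4 * x"])
    show "continuous_on {- (4 * x)..4 * x} ?f" by (rule cont)
    show "((\<lambda>v. x * v) has_field_derivative x) (at v within {-4..4})" for v
      by (auto intro!: derivative_eq_intros)
    show "(\<lambda>v. x * v) ` {-4..4} \<subseteq> {- (4 * x)..4 * x}"
      using x mult_left_mono[of "-4" _ x] mult_left_mono[of _ 4 x] by (fastforce simp: mult.commute)
  qed (use x in auto)
  moreover have "x *\<^sub>R ?f (x * v) = of_real (x * exp (2 * N)) * exp (- of_real (N * v^2) / (1 - \<i> * of_real v))" for v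
  proof -
    let ?u = "1 - \<i> * of_real v :: complex"
    have u: "?u \<noteq> 0" by (auto simp: complex_eq_iff)
    have t: "Complex x (- (x * v)) = of_real x * ?u" by (simp add: complex_eq_iff)
    have "of_real saddle_const / (of_real x * ?u) + of_nat n * (of_real x * ?u) = of_real N * (1 / ?u + ?u)"
      using x by (simp add: A N_def distrib_left)
    also have "1 / ?u + ?u = 2 - of_real (v^2) / ?u"
    proof -
      have "1 / u + u = 2 - w / u" if "u \<noteq> 0" "u * u = 2 * u - 1 - w" for u w :: complex
      proof -
        have "1 + u * u = 2 * u - w" using that by simp
        then have "(1 + u * u) / u = (2 * u - w) / u" by simp
        then show ?thesis using that(1) by (simp add: add_divide_distrib diff_divide_distrib)
      qed
      moreover have "?u * ?u = 2 * ?u - 1 - of_real (v^2)"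
        by (simp add: algebra_simps power2_eq_square)
      ultimately show ?thesis using u by blast
    qed
    also have "of_real N * (2 - of_real (v^2) / ?u) = of_real (2 * N) + - of_real (N * v^2) / ?u"
      by (simp add: right_diff_distrib)
    finally have e: "of_real saddle_const / (of_real x * ?u) + of_nat n * (of_real x * ?u) = of_real (2 * N) + - of_real (N * v^2) / ?u" .
    have "?f (x * v) = exp (of_real (2 * N) + - of_real (N * v^2) / ?u)"
      unfolding t by (simp only: e)
    then have "?f (x * v) = of_real (exp (2 * N)) * exp (- of_real (N * v^2) / ?u)"
      by (simp only: exp_add exp_of_real)
    then show ?thesis by (simp only: scaleR_conv_of_real of_real_mult mult.assoc)
  qed
  ultimately have "((\<lambda>v. of_real (x * exp (2 * N)) * exp (- of_real (N * v^2) / (1 - \<i> * of_real v))) has_integral integral {x * (-4)..x * 4} ?f) {-4..4}"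
    by simp
  then have "integral {-4..4} (\<lambda>v. of_real (x * exp (2 * N)) * exp (- of_real (N * v^2) / (1 - \<i> * of_real v))) = integral {x * (-4)..x * 4} ?f"
    by (rule integral_unique)
  then have "integral {x * (-4)..x * 4} ?f = of_real (x * exp (2 * N)) * integral {-4..4} (\<lambda>v. exp (- of_real (N * v^2) / (1 - \<i> * of_real v)))"
    by (simp only: integral_mult_right)
  moreover have "x * (-4) = - (4 * x)" "x * 4 = 4 * x" "2 * N = 2 * real n * x" by (simp_all add: N_def)
  ultimately show ?thesis by (simp only: N_def)
qed

text \<open>Since \<open>n x\<close> is a constant multiple of \<open>1 / x\<close>, the main term
  has the order \<open>x^(3/2) exp (2 n x)\<close>. Every error is
  \<open>O(x^2 exp (2 n x))\<close>, a relative gain of \<open>x^(1/2)\<close>, that is, of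
  \<open>n^(-1/4)\<close>.\<close>

lemma partition_estimate:
  obtains C x0 where "0 < x0" "0 \<le> C" "\<And>n x. 0 < x \<Longrightarrow> x \<le> x0 \<Longrightarrow> real n * x^2 = saddle_const \<Longrightarrow>
    \<bar>2 * pi * of_int (signed_partition_number n chi)
      - (coeff_plus + (-1) ^ n * coeff_minus) * (x * exp (2 * real n * x) * sqrt (pi / (real n * x)))\<bar> \<le> C * x^2 * exp (2 * real n * x)"
proof -
  obtain C1 where C1: "0 \<le> C1" "\<And>n x y. 0 < x \<Longrightarrow> x \<le> 1/20 \<Longrightarrow> real n * x^2 = saddle_const \<Longrightarrow> \<bar>y\<bar> \<le> 4 * x \<Longrightarrow>
    norm (integrand n x y - of_real (coeff_plus + (-1) ^ n * coeff_minus)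
        * exp (of_real saddle_const / Complex x (- y) + of_nat n * Complex x (- y))) \<le> C1 * x * exp (2 * real n * x)"
    by (rule integrand_central) blast
  obtain C2 where C2: "0 \<le> C2" "\<And>n x y. 0 < x \<Longrightarrow> x \<le> 1/20 \<Longrightarrow> real n * x^2 = saddle_const \<Longrightarrow> 4 * x \<le> \<bar>y\<bar> \<Longrightarrow> \<bar>y\<bar> \<le> pi/2 \<Longrightarrow>
    norm (integrand n x y) \<le> 2 * exp (- (1/100) / x + C2 * (ln (2 / x) + 1)) * exp (2 * real n * x)"
    by (rule integrand_minor) blast
  \<comment> \<open>The saving \<open>exp (- 1 / (100 x))\<close> of the minor arcs beats every
    power of \<open>1 / x\<close>, in particular the one hidden in the logarithm.\<close>
  have "((\<lambda>x. exp (- (1/100) / x + C2 * (ln (2 / x) + 1)) / x^2) \<longlongrightarrow> 0) (at_right 0)"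
    using C2(1) by real_asymp
  then have "\<forall>\<^sub>F x in at_right 0. exp (- (1/100) / x + C2 * (ln (2 / x) + 1)) / x^2 < 1"
    by (rule order_tendstoD) simp
  then obtain b where b: "0 < b" "\<And>x. 0 < x \<Longrightarrow> x < b \<Longrightarrow> exp (- (1/100) / x + C2 * (ln (2 / x) + 1)) / x^2 < 1"
    by (auto simp: eventually_at_right_field)
  define x0 where "x0 = min (1/20) (b / 2)"
  define cc where "cc = coeff_plus + coeff_minus"
  have cc: "0 \<le> cc" by (simp add: cc_def coeff_plus_def coeff_minus_def)
  \<comment> \<open>The three summands belong to the central arc of length \<open>8 x\<close>, to
    the Gaussian approximation and to the minor arcs.\<close>
  define C where "C = 8 * C1 + cc * 290 / saddle_const + 4 * pi"
  show ?thesis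
  proof (rule that[of x0 C])
    show "0 < x0" using b by (simp add: x0_def)
    show "0 \<le> C" using C1 cc saddle_const_pos by (simp add: C_def)
    fix n :: nat and x :: real
    assume x: "0 < x" "x \<le> x0" and n: "real n * x^2 = saddle_const"
    have x20: "x \<le> 1/20" and xb: "x < b" using x b by (auto simp: x0_def)
    define N where "N = real n * x"
    have A: "saddle_const = N * x" using n by (simp add: N_def power2_eq_square)
    have N: "0 < N" using A saddle_const_pos x by (simp add: zero_less_mult_iff)
    let ?e = "exp (2 * real n * x)"
    let ?B = "coeff_plus + (-1) ^ n * coeff_minus"
    let ?f = "\<lambda>y. exp (of_real saddle_const / Complex x (- y) + of_nat n * Complex x (- y))"
    have Bcc: "\<bar>?B\<bar> \<le> cc"
      by (cases "even n") (auto simp: cc_def coeff_plus_def coeff_minus_def abs_le_iff)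
    have cont: "continuous_on S (integrand n x)" for S by (rule continuous_integrand[OF x(1)])
    have int: "integrand n x integrable_on {a..b}" for a b using cont by (rule integrable_continuous_interval)
    have pi4: "4 * x \<le> pi / 2" using x20 pi_gt3 by simp
    have m: "norm (integrand n x y) \<le> 2 * x^2 * ?e" if "4 * x \<le> \<bar>y\<bar>" "\<bar>y\<bar> \<le> pi/2" for y
    proof -
      have "exp (- (1/100) / x + C2 * (ln (2 / x) + 1)) \<le> x^2"
        using b(2)[OF x(1) xb] x by (simp add: divide_less_eq)
      then have "2 * exp (- (1/100) / x + C2 * (ln (2 / x) + 1)) * ?e \<le> 2 * x^2 * ?e"
        by (intro mult_right_mono mult_left_mono) auto
      then show ?thesis using C2(2)[OF x(1) x20 n that] by linarith
    qed
    have I1: "norm (integral {- (pi/2)..- (4 * x)} (integrand n x)) \<le> 2 * x^2 * ?e * (- (4 * x) - - (pi/2))"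
      by (rule integral_bound) (use pi4 x in \<open>auto intro!: cont m\<close>)
    have I3: "norm (integral {4 * x..pi/2} (integrand n x)) \<le> 2 * x^2 * ?e * (pi/2 - 4 * x)"
      by (rule integral_bound) (use pi4 x in \<open>auto intro!: cont m\<close>)
    have "continuous_on S (\<lambda>y. Complex x (- y))" for S
      unfolding complex_eq_iff Complex_eq by (intro continuous_intros)
    then have contf: "continuous_on S ?f" for S
      by (intro continuous_intros) (use x in \<open>auto simp: complex_eq_iff\<close>)
    have I2: "norm (integral {- (4 * x)..4 * x} (\<lambda>y. integrand n x y - of_real ?B * ?f y)) \<le> C1 * x * ?e * (4 * x - - (4 * x))"
    proof (rule integral_bound)
      show "continuous_on {- (4 * x)..4 * x} (\<lambda>y. integrand n x y - of_real ?B * ?f y)"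
        by (intro continuous_on_diff continuous_on_mult continuous_on_const cont contf)
      fix y assume "y \<in> {- (4 * x)..4 * x}"
      then have "\<bar>y\<bar> \<le> 4 * x" by auto
      from C1(2)[OF x(1) x20 n this]
      show "norm (integrand n x y - of_real ?B * ?f y) \<le> C1 * x * ?e" .
    qed (use x in auto)
    have "integral {- (4 * x)..4 * x} (\<lambda>y. integrand n x y - of_real ?B * ?f y) =
        integral {- (4 * x)..4 * x} (integrand n x) - of_real ?B * integral {- (4 * x)..4 * x} ?f"
      by (subst Henstock_Kurzweil_Integration.integral_diff)
         (auto intro!: int integrable_continuous_interval continuous_on_mult contf)
    also have "integral {- (4 * x)..4 * x} ?f = of_real (x * ?e) * integral {-4..4} (\<lambda>v. exp (- of_real (N * v^2) / (1 - \<i> * of_real v)))"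
      unfolding N_def by (rule integral_central[OF x(1) n])
    finally have eq: "integral {- (4 * x)..4 * x} (\<lambda>y. integrand n x y - of_real ?B * ?f y) =
        integral {- (4 * x)..4 * x} (integrand n x) -
        of_real ?B * (of_real (x * ?e) * integral {-4..4} (\<lambda>v. exp (- of_real (N * v^2) / (1 - \<i> * of_real v))))" .
    have r: "C1 * x * ?e * (4 * x - - (4 * x)) = 8 * C1 * x^2 * ?e" by (simp add: power2_eq_square)
    have I2': "norm (integral {- (4 * x)..4 * x} (integrand n x) -
        of_real ?B * (of_real (x * ?e) * integral {-4..4} (\<lambda>v. exp (- of_real (N * v^2) / (1 - \<i> * of_real v))))) \<le> 8 * C1 * x^2 * ?e"
      using I2 unfolding eq r .
    let ?J = "integral {-4..4} (\<lambda>v. exp (- of_real (N * v^2) / (1 - \<i> * of_real v)))"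
    have J: "norm (of_real ?B * (of_real (x * ?e) * ?J) - of_real (?B * (x * ?e * sqrt (pi / N)))) \<le> cc * 290 / saddle_const * x^2 * ?e"
    proof -
      have "of_real ?B * (of_real (x * ?e) * ?J) - of_real (?B * (x * ?e * sqrt (pi / N))) =
          of_real (?B * (x * ?e)) * (?J - of_real (sqrt (pi / N)))"
        by (simp add: algebra_simps)
      also have "norm \<dots> = \<bar>?B\<bar> * (x * ?e) * norm (?J - of_real (sqrt (pi / N)))"
        using x by (simp only: norm_mult norm_of_real abs_mult) simp
      also have "\<dots> \<le> cc * (x * ?e) * (290 / N)"
        using Bcc x N saddle_integral[OF N] by (intro mult_mono) (auto intro: mult_nonneg_nonneg cc)
      also have "\<dots> = cc * 290 / saddle_const * x^2 * ?e"
        using x N by (simp add: A power2_eq_square field_simps)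
      finally show ?thesis .
    qed
    have "2 * pi * of_int (signed_partition_number n chi) = integral {- (pi/2)..pi/2} (integrand n x)"
      by (rule integral_integrand[OF x(1), symmetric])
    also have "\<dots> = integral {- (pi/2)..- (4 * x)} (integrand n x) + integral {- (4 * x)..pi/2} (integrand n x)"
      using Henstock_Kurzweil_Integration.integral_combine[OF _ _ int, of "- (pi/2)" "- (4 * x)" "pi/2"] pi4 x by simp
    also have "integral {- (4 * x)..pi/2} (integrand n x) = integral {- (4 * x)..4 * x} (integrand n x) + integral {4 * x..pi/2} (integrand n x)"
      using Henstock_Kurzweil_Integration.integral_combine[OF _ _ int, of "- (4 * x)" "4 * x" "pi/2"] pi4 x by simp
    finally have total: "complex_of_real (2 * pi * of_int (signed_partition_number n chi)) - of_real (?B * (x * ?e * sqrt (pi / N))) =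
        integral {- (pi/2)..- (4 * x)} (integrand n x) + integral {4 * x..pi/2} (integrand n x)
        + (integral {- (4 * x)..4 * x} (integrand n x) - of_real ?B * (of_real (x * ?e) * ?J))
        + (of_real ?B * (of_real (x * ?e) * ?J) - of_real (?B * (x * ?e * sqrt (pi / N))))" by simp
    have "\<bar>2 * pi * of_int (signed_partition_number n chi) - ?B * (x * ?e * sqrt (pi / N))\<bar> =
        norm (complex_of_real (2 * pi * of_int (signed_partition_number n chi)) - of_real (?B * (x * ?e * sqrt (pi / N))))"
      by (simp only: of_real_diff[symmetric] norm_of_real)
    also have "\<dots> \<le> 2 * x^2 * ?e * (- (4 * x) - - (pi/2)) + 2 * x^2 * ?e * (pi/2 - 4 * x) + 8 * C1 * x^2 * ?e + cc * 290 / saddle_const * x^2 * ?e"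
      unfolding total by (intro norm_triangle_mono I1 I3 I2' J)
    also have "\<dots> \<le> C * x^2 * ?e"
    proof -
      have "2 * x^2 * ?e * (- (4 * x) - - (pi/2)) + 2 * x^2 * ?e * (pi/2 - 4 * x) = (2 * pi - 16 * x) * (x^2 * ?e)"
        by (simp add: algebra_simps)
      also have "\<dots> \<le> 4 * pi * (x^2 * ?e)"
      proof (rule mult_right_mono)
        show "2 * pi - 16 * x \<le> 4 * pi" using x pi_gt_zero by linarith
      qed simp
      finally show ?thesis by (simp add: C_def algebra_simps)
    qed
    finally show "\<bar>2 * pi * of_int (signed_partition_number n chi) - ?B * (x * ?e * sqrt (pi / (real n * x)))\<bar> \<le> C * x^2 * ?e"
      by (simp only: N_def)
  qed
qed

text \<open>The exponents of the two coefficients differ by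
  \<open>(2 chi(2) - 2) sqrt p L(1, chi) / 4\<close>, which by \<open>chi_2\<close> is
  \<open>0\<close> or \<open>- sqrt p L(1, chi)\<close>.\<close>

lemma coeff_minus_eq: "coeff_minus = coeff_plus * coeff_b p"
proof (cases "p mod 8 = 1")
  case True
  then show ?thesis by (simp add: coeff_minus_def coeff_plus_def coeff_b_def chi_2)
next
  case False
  then show ?thesis
    by (simp add: coeff_minus_def coeff_plus_def coeff_b_def chi_2 flip: exp_add)
qed

text \<open>All quantities are nonnegative radicals, so squares are compared for the first claim and
  fourth powers for the second. The number \<open>384\<close> in \<open>coeff_a\<close> is
  \<open>16 * 24\<close>, with \<open>16\<close> from \<open>(2 pi)^4\<close> and \<open>24\<close>
  from \<open>saddle_const\<close>.\<close>

lemma saddle_constants: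
  assumes n: "0 < n" and x: "0 < x" "real n * x^2 = saddle_const"
  shows "2 * real n * x = 1 / 2 * kappa * sqrt ((1 - 1 / real p) * real n)"
    and "coeff_plus * (x * sqrt (pi / (real n * x))) = 2 * pi * (coeff_a p * real n powr (- 3 / 4))"
proof -
  have p1: "0 \<le> 1 - 1 / real p" using p_pos by simp
  have "(2 * real n * x)^2 = 4 * real n * saddle_const" unfolding x(2)[symmetric] by (simp add: power2_eq_square)
  also have "\<dots> = (1 / 2 * kappa * sqrt ((1 - 1 / real p) * real n))^2"
  proof -
    have k: "kappa^2 = pi^2 * (2 / 3)" by (simp add: kappa_def power_mult_distrib)
    have s: "sqrt ((1 - 1 / real p) * real n)^2 = (1 - 1 / real p) * real n" using p1 by simp
    show ?thesis
      unfolding power_mult_distrib k s saddle_const_def by (simp add: power2_eq_square)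
  qed
  finally show "2 * real n * x = 1 / 2 * kappa * sqrt ((1 - 1 / real p) * real n)"
    using x p1 by (subst (asm) power2_eq_iff_nonneg) (auto simp: kappa_def)
  define u where "u = coeff_plus * (x * sqrt (pi / (real n * x)))"
  define w where "w = 2 * pi * (coeff_a p * real n powr (- 3 / 4))"
  have u0: "0 \<le> u" using x by (simp add: u_def coeff_plus_def)
  have w0: "0 \<le> w" by (simp add: w_def coeff_a_def)
  define Y where "Y = exp (sqrt (real p) * L1)"
  have "exp (- ln (real p) / 4 + sqrt (real p) * L1 / 4) ^ 4 = exp (real 4 * (- ln (real p) / 4 + sqrt (real p) * L1 / 4))"
    by (rule exp_of_nat_mult[symmetric])
  also have "\<dots> = exp (- ln (real p)) * Y" by (simp add: Y_def flip: exp_add)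
  also have "exp (- ln (real p)) = 1 / real p" using p_pos by (simp add: exp_minus inverse_eq_divide)
  finally have cp4: "coeff_plus ^ 4 = Y / real p" by (simp add: coeff_plus_def)
  have sq4: "sqrt (pi / (real n * x)) ^ 4 = (pi / (real n * x))^2"
  proof -
    have "sqrt (pi / (real n * x)) ^ 4 = (sqrt (pi / (real n * x)) ^ 2) ^ 2" by (simp flip: power_mult)
    also have "sqrt (pi / (real n * x)) ^ 2 = pi / (real n * x)" using x by simp
    finally show ?thesis .
  qed
  have "u ^ 4 = Y / real p * (x ^ 4 * (pi / (real n * x))^2)"
    unfolding u_def power_mult_distrib cp4 sq4 by simp
  also have "x ^ 4 * (pi / (real n * x))^2 = pi^2 * (real n * x^2) / real n ^ 3"
    using x n by (simp add: field_simps power2_eq_square power3_eq_cube power4_eq_xxxx)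
  also have "Y / real p * (pi^2 * (real n * x^2) / real n ^ 3) = Y * (pi^4 * (real p - 1) / (24 * real p^2) / real n ^ 3)"
    unfolding x(2) saddle_const_def using p_pos n by (simp add: field_simps power2_eq_square power3_eq_cube power4_eq_xxxx)
  finally have u4: "u ^ 4 = Y * (pi^4 * (real p - 1) / (24 * real p^2) / real n ^ 3)" .
  have pw4: "(z powr c) ^ 4 = z powr (4 * c)" if "0 < z" for z c :: real
    using powr_realpow[of "z powr c" 4] that by (simp add: powr_powr mult.commute)
  have e4: "exp (1 / 4 * sqrt (real p) * L1) ^ 4 = Y"
    using exp_of_nat_mult[of 4 "1 / 4 * sqrt (real p) * L1"] by (simp add: Y_def)
  have r0: "0 < (real p - 1) / (384 * (real p)\<^sup>2)" using p_ge_13 by simp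
  have "w ^ 4 = (2 * pi)^4 * (((real p - 1) / (384 * (real p)\<^sup>2)) * Y * real n powr (- 3))"
    unfolding w_def coeff_a_def power_mult_distrib e4 pw4[OF r0] using n r0 p_ge_13 by (simp add: pw4)
  also have "real n powr (- 3) = 1 / real n ^ 3"
    using n powr_realpow[of "real n" 3] by (simp add: powr_minus_divide)
  also have "(2 * pi)^4 * (((real p - 1) / (384 * (real p)\<^sup>2)) * Y * (1 / real n ^ 3)) = u ^ 4"
    unfolding u4 by (simp add: power_mult_distrib mult_ac)
  finally have "u ^ 4 = w ^ 4" by simp
  then show "coeff_plus * (x * sqrt (pi / (real n * x))) = 2 * pi * (coeff_a p * real n powr (- 3 / 4))"
    unfolding u_def[symmetric] w_def[symmetric] using u0 w0 power_eq_imp_eq_base[of u 4 w] by simp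
qed

end

theorem theorem1p3:
  fixes p :: nat
  assumes "prime p" and "[p = 1] (mod 4)" and "p \<noteq> 5"
  shows "\<exists>E :: nat \<Rightarrow> real. E \<in> O(\<lambda>n. real n powr (- 1 / 5)) \<and>
    (\<forall>\<^sub>F n in sequentially.
       of_int (signed_partition_number n (legendre_char p)) =
         coeff_a p * real n powr (- 3 / 4)
         * exp (1 / 2 * kappa * sqrt ((1 - 1 / real p) * real n))
         * (1 + (- 1) ^ n * coeff_b p + E n))"
proof -
  interpret prime_1_mod_4 p using assms by unfold_locales
  define P where "P n = real_of_int (signed_partition_number n (legendre_char p))" for n
  define M where "M n = coeff_a p * real n powr (- 3 / 4) * exp (1 / 2 * kappa * sqrt ((1 - 1 / real p) * real n))" for n
  \<comment> \<open>\<open>E\<close> is defined by the asserted equation, so the equation holds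
    wherever \<open>M n\<close> is nonzero and only the size of \<open>E\<close> is left to
    estimate.\<close>
  define E where "E n = P n / M n - 1 - (-1) ^ n * coeff_b p" for n
  have a: "0 < coeff_a p" using p_ge_13 by (simp add: coeff_a_def)
  have M: "0 < M n" if "0 < n" for n using that a by (simp add: M_def)
  obtain C x0 where C: "0 < x0" "0 \<le> C" "\<And>n x. 0 < x \<Longrightarrow> x \<le> x0 \<Longrightarrow> real n * x^2 = saddle_const \<Longrightarrow>
    \<bar>2 * pi * of_int (signed_partition_number n chi)
      - (coeff_plus + (-1) ^ n * coeff_minus) * (x * exp (2 * real n * x) * sqrt (pi / (real n * x)))\<bar> \<le> C * x^2 * exp (2 * real n * x)"
    by (rule partition_estimate) blast
  have bound: "\<bar>E n\<bar> \<le> C * saddle_const / (2 * pi * coeff_a p) * real n powr (- 1 / 5)"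
    if n: "0 < n" "saddle_const / x0^2 \<le> real n" for n
  proof -
    \<comment> \<open>The saddle point, which balances \<open>saddle_const / x\<close> against
      \<open>n x\<close>.\<close>
    define x where "x = sqrt (saddle_const / real n)"
    have x: "0 < x" "real n * x^2 = saddle_const" using n saddle_const_pos by (simp_all add: x_def)
    have "x \<le> x0"
    proof -
      have "saddle_const / real n \<le> x0^2" using n C(1) by (simp add: field_simps)
      then show ?thesis using C(1) unfolding x_def by (intro real_le_lsqrt) auto
    qed
    note est = C(3)[OF x(1) this x(2)]
    let ?e = "exp (2 * real n * x)"
    have "(coeff_plus + (-1) ^ n * coeff_minus) * (x * ?e * sqrt (pi / (real n * x)))
        = (coeff_plus * (x * sqrt (pi / (real n * x)))) * ?e * (1 + (-1) ^ n * coeff_b p)"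
      unfolding coeff_minus_eq by (simp add: algebra_simps)
    also have "\<dots> = 2 * pi * (M n * (1 + (-1) ^ n * coeff_b p))"
      unfolding saddle_constants(2)[OF n(1) x] saddle_constants(1)[OF n(1) x] M_def by simp
    finally have "2 * pi * P n - (coeff_plus + (-1) ^ n * coeff_minus) * (x * ?e * sqrt (pi / (real n * x))) = 2 * pi * (M n * E n)"
      using M[OF n(1)] by (simp add: E_def algebra_simps)
    then have "\<bar>2 * pi * (M n * E n)\<bar> \<le> C * x^2 * ?e" using est by (simp only: P_def)
    then have 1: "2 * pi * (M n * \<bar>E n\<bar>) \<le> C * x^2 * ?e" using M[OF n(1)] by (simp add: abs_mult)
    have "M n = coeff_a p * real n powr (- 3 / 4) * ?e"
      unfolding M_def saddle_constants(1)[OF n(1) x] ..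
    with 1 have "(2 * pi * coeff_a p * real n powr (- 3 / 4) * \<bar>E n\<bar>) * ?e \<le> (C * x^2) * ?e" by (simp add: mult_ac)
    then have "2 * pi * coeff_a p * real n powr (- 3 / 4) * \<bar>E n\<bar> \<le> C * x^2" by (simp only: mult_le_cancel_right_pos exp_gt_zero)
    also have "x^2 = saddle_const * real n powr (- 1)" using n x by (simp add: powr_minus_divide field_simps)
    finally have "\<bar>E n\<bar> \<le> C * (saddle_const * real n powr (- 1)) / (2 * pi * coeff_a p * real n powr (- 3 / 4))"
      using a n by (simp add: field_simps)
    also have "\<dots> = C * saddle_const / (2 * pi * coeff_a p) * (real n powr (- 1) / real n powr (- 3 / 4))" by simp
    also have "real n powr (- 1) / real n powr (- 3 / 4) = real n powr (- 1 / 4)"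
  proof -
      have "real n powr (- 1) / real n powr (- 3 / 4) = real n powr (- 1 - (- 3 / 4))" by (rule powr_diff[symmetric])
      then show ?thesis by simp
    qed
    \<comment> \<open>The argument yields the exponent \<open>-1/4\<close>; for
      \<open>n >= 1\<close> it may be weakened to the stated \<open>-1/5\<close>.\<close>
    also have "C * saddle_const / (2 * pi * coeff_a p) * real n powr (- 1 / 4) \<le> C * saddle_const / (2 * pi * coeff_a p) * real n powr (- 1 / 5)"
      using C(2) saddle_const_pos a n by (intro mult_left_mono powr_mono) auto
    finally show ?thesis .
  qed
  have "E \<in> O(\<lambda>n. real n powr (- 1 / 5))"
  proof (rule bigoI)
    have "\<forall>\<^sub>F n in sequentially. 0 < n \<and> saddle_const / x0^2 \<le> real n"
      by (intro eventually_conj eventually_gt_at_top) real_asymp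
    then show "\<forall>\<^sub>F n in sequentially. norm (E n) \<le> C * saddle_const / (2 * pi * coeff_a p) * norm (real n powr (- 1 / 5))"
      by eventually_elim (use bound in simp)
  qed
  moreover have "\<forall>\<^sub>F n in sequentially. P n = M n * (1 + (-1) ^ n * coeff_b p + E n)"
    using eventually_gt_at_top[of 0]
  proof eventually_elim
    case (elim n)
    show ?case using M[OF elim] by (simp add: E_def)
  qed
  ultimately show ?thesis unfolding P_def M_def by blast
qed

end
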